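(* Let $G$ be an infinite compact abelian group with dual group $\Gamma$, and let $\Lambda\subset\Gamma$ be such that $\Gamma\setminus(-\Lambda)$ is a semi-Riesz set. Let $T\in L(C_\Lambda)$ and suppose that $T$ is weakly compact, or that $T$ factors through a closed subspace of $c_0$, or (more generally than weak compactness) that for every $h\in G$ the function $g\mapsto \pi_h(T^*p_g)$ is continuous on $G$. Then $\|\mathrm{Id}+T\|=1+\|T\|$.
   Context: $C_\Lambda=\{f\in C(G):\hat f(\gamma)=0 \text{ for all }\gamma\notin\Lambda\}$ with the sup norm, where $\hat f$ is the Fourier transform. For $\Lambda'\subset\Gamma$, $M_{\Lambda'}$ is the space of measures $\mu\in M(G)$ with $\hat\mu(\gamma)=0$ for $\gamma\notin\Lambda'$; $M_{\rm diff}$ is the space of diffuse measures (those vanishing on singletons). $\Lambda'$ is semi-Riesz if $M_{\Lambda'}\subset M_{\rm diff}$. For $g\in G$, $p_g\in C_\Lambda^*$ is the point evaluation $f\mapsto f(g)$; $\operatorname{lin}\{p_g\}$ is an $L$-summand of $C_\Lambda^*$, i.e. there is a projection $\Pi_g$ of $C_\Lambda^*$ onto it with $\|x^*\|=\|\Pi_gx^*\|+\|x^*-\Pi_gx^*\|$, and $\pi_g\in C_\Lambda^{**}$ is defined by $\Pi_g(x^* )=\pi_g(x^* )p_g$. $T$ factors through a subspace of $c_0$ if $T=T_2T_1$ with bounded $T_1\colon C_\Lambda\to E$, $T_2\colon E\to C_\Lambda$, $E\subset c_0$ closed. *)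

theory Defs
  imports "HOL-Analysis.Analysis"
begin

definition dual_group :: "('g::topological_ab_group_add \<Rightarrow> complex) set" where
  "dual_group = {\<gamma>. continuous_on UNIV \<gamma> \<and> (\<forall>x y. \<gamma> (x + y) = \<gamma> x * \<gamma> y)
                    \<and> (\<forall>x. norm (\<gamma> x) = 1)}"

text \<open>Group inverse in the dual group: \<open>-\<gamma> = conj \<gamma>\<close>; \<open>-\<Lambda>\<close>.\<close>
definition neg_set :: "('g \<Rightarrow> complex) set \<Rightarrow> ('g \<Rightarrow> complex) set" where
  "neg_set L = (\<lambda>\<gamma> x. cnj (\<gamma> x)) ` L"

definition radon :: "'g::topological_space measure \<Rightarrow> bool" where
  "radon M \<longleftrightarrow> sets M = sets borel \<and> finite_measure M \<and>
     (\<forall>A\<in>sets borel. emeasure M A = (INF U\<in>{U. open U \<and> A \<subseteq> U}. emeasure M U)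
                   \<and> emeasure M A = (SUP K\<in>{K. compact K \<and> K \<subseteq> A}. emeasure M K))"

definition haar :: "'g::topological_ab_group_add measure \<Rightarrow> bool" where
  "haar m \<longleftrightarrow> radon m \<and> emeasure m (space m) = 1 \<and>
     (\<forall>x. \<forall>A\<in>sets borel. emeasure m ((\<lambda>y. x + y) ` A) = emeasure m A)"

definition fourier :: "'g measure \<Rightarrow> ('g \<Rightarrow> complex) \<Rightarrow> ('g \<Rightarrow> complex) \<Rightarrow> complex" where
  "fourier m f \<gamma> = (\<integral>x. f x * cnj (\<gamma> x) \<partial>m)"

text \<open>A complex measure is represented as \<open>m1 - m2 + i (m3 - m4)\<close> with finite
  positive Radon measures \<open>mi\<close>.\<close>
type_synonym 'g cmeasure = "'g measure \<times> 'g measure \<times> 'g measure \<times> 'g measure"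

definition is_cmeasure :: "'g::topological_space cmeasure \<Rightarrow> bool" where
  "is_cmeasure \<mu> = (case \<mu> of (m1, m2, m3, m4) \<Rightarrow> radon m1 \<and> radon m2 \<and> radon m3 \<and> radon m4)"

definition cm_val :: "'g cmeasure \<Rightarrow> 'g set \<Rightarrow> complex" where
  "cm_val \<mu> A = (case \<mu> of (m1, m2, m3, m4) \<Rightarrow>
     complex_of_real (measure m1 A - measure m2 A) + \<i> * complex_of_real (measure m3 A - measure m4 A))"

definition cm_int :: "'g cmeasure \<Rightarrow> ('g \<Rightarrow> complex) \<Rightarrow> complex" where
  "cm_int \<mu> f = (case \<mu> of (m1, m2, m3, m4) \<Rightarrow>
     (\<integral>x. f x \<partial>m1) - (\<integral>x. f x \<partial>m2) + \<i> * ((\<integral>x. f x \<partial>m3) - (\<integral>x. f x \<partial>m4)))"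

definition fs_transform :: "'g cmeasure \<Rightarrow> ('g \<Rightarrow> complex) \<Rightarrow> complex" where
  "fs_transform \<mu> \<gamma> = cm_int \<mu> (\<lambda>x. cnj (\<gamma> x))"

definition M_spec :: "('g::topological_ab_group_add \<Rightarrow> complex) set \<Rightarrow> 'g cmeasure set" where
  "M_spec L' = {\<mu>. is_cmeasure \<mu> \<and> (\<forall>\<gamma>\<in>dual_group - L'. fs_transform \<mu> \<gamma> = 0)}"

definition M_diff :: "'g::topological_space cmeasure set" where
  "M_diff = {\<mu>. is_cmeasure \<mu> \<and> (\<forall>x. cm_val \<mu> {x} = 0)}"

definition semi_riesz :: "('g::topological_ab_group_add \<Rightarrow> complex) set \<Rightarrow> bool" where
  "semi_riesz L' \<longleftrightarrow> M_spec L' \<subseteq> M_diff"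

definition supn :: "('x \<Rightarrow> complex) \<Rightarrow> real" where
  "supn f = Sup (range (\<lambda>x. norm (f x)))"

definition C_Lambda :: "'g measure \<Rightarrow> ('g::topological_ab_group_add \<Rightarrow> complex) set
    \<Rightarrow> ('g \<Rightarrow> complex) set" where
  "C_Lambda m L = {f. continuous_on UNIV f \<and> (\<forall>\<gamma>\<in>dual_group - L. fourier m f \<gamma> = 0)}"

definition bdd_clin :: "('x \<Rightarrow> complex) set \<Rightarrow> (('x \<Rightarrow> complex) \<Rightarrow> real) \<Rightarrow>
    ('y \<Rightarrow> complex) set \<Rightarrow> (('y \<Rightarrow> complex) \<Rightarrow> real) \<Rightarrow>
    (('x \<Rightarrow> complex) \<Rightarrow> ('y \<Rightarrow> complex)) \<Rightarrow> bool" where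
  "bdd_clin A nA B nB T \<longleftrightarrow> T ` A \<subseteq> B \<and>
     (\<forall>f\<in>A. \<forall>g\<in>A. T (\<lambda>x. f x + g x) = (\<lambda>y. T f y + T g y)) \<and>
     (\<forall>c. \<forall>f\<in>A. T (\<lambda>x. c * f x) = (\<lambda>y. c * T f y)) \<and>
     (\<exists>K. \<forall>f\<in>A. nB (T f) \<le> K * nA f)"

definition opnorm_on :: "('x \<Rightarrow> complex) set \<Rightarrow> (('x \<Rightarrow> complex) \<Rightarrow> ('x \<Rightarrow> complex)) \<Rightarrow> real" where
  "opnorm_on S T = Sup ((\<lambda>f. supn (T f)) ` {f\<in>S. supn f \<le> 1})"

definition dual_sp :: "('x \<Rightarrow> complex) set \<Rightarrow> (('x \<Rightarrow> complex) \<Rightarrow> complex) set" where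
  "dual_sp S = {\<phi>. (\<forall>f\<in>S. \<forall>g\<in>S. \<phi> (\<lambda>x. f x + g x) = \<phi> f + \<phi> g) \<and>
      (\<forall>c. \<forall>f\<in>S. \<phi> (\<lambda>x. c * f x) = c * \<phi> f) \<and>
      (\<exists>K. \<forall>f\<in>S. norm (\<phi> f) \<le> K * supn f) \<and> (\<forall>f. f \<notin> S \<longrightarrow> \<phi> f = 0)}"

definition dnorm :: "('x \<Rightarrow> complex) set \<Rightarrow> (('x \<Rightarrow> complex) \<Rightarrow> complex) \<Rightarrow> real" where
  "dnorm S \<phi> = Sup ((\<lambda>f. norm (\<phi> f)) ` {f\<in>S. supn f \<le> 1})"

definition pt_eval :: "('x \<Rightarrow> complex) set \<Rightarrow> 'x \<Rightarrow> (('x \<Rightarrow> complex) \<Rightarrow> complex)" where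
  "pt_eval S g = (\<lambda>f. if f \<in> S then f g else 0)"

definition adj_pt :: "('x \<Rightarrow> complex) set \<Rightarrow> (('x \<Rightarrow> complex) \<Rightarrow> ('x \<Rightarrow> complex)) \<Rightarrow> 'x
    \<Rightarrow> (('x \<Rightarrow> complex) \<Rightarrow> complex)" where
  "adj_pt S T g = (\<lambda>f. if f \<in> S then T f g else 0)"

definition L_proj :: "('x \<Rightarrow> complex) set \<Rightarrow> 'x \<Rightarrow>
    ((('x \<Rightarrow> complex) \<Rightarrow> complex) \<Rightarrow> (('x \<Rightarrow> complex) \<Rightarrow> complex)) \<Rightarrow> bool" where
  "L_proj S h P \<longleftrightarrow>
     (\<forall>\<phi>\<in>dual_sp S. \<forall>\<psi>\<in>dual_sp S. P (\<lambda>f. \<phi> f + \<psi> f) = (\<lambda>f. P \<phi> f + P \<psi> f)) \<and>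
     (\<forall>c. \<forall>\<phi>\<in>dual_sp S. P (\<lambda>f. c * \<phi> f) = (\<lambda>f. c * P \<phi> f)) \<and>
     (\<forall>\<phi>\<in>dual_sp S. P (P \<phi>) = P \<phi>) \<and>
     P ` dual_sp S = {(\<lambda>f. c * pt_eval S h f) | c. True} \<and>
     (\<forall>\<phi>\<in>dual_sp S. dnorm S \<phi> = dnorm S (P \<phi>) + dnorm S (\<lambda>f. \<phi> f - P \<phi> f))"

definition Pi_proj :: "('x \<Rightarrow> complex) set \<Rightarrow> 'x \<Rightarrow>
    ((('x \<Rightarrow> complex) \<Rightarrow> complex) \<Rightarrow> (('x \<Rightarrow> complex) \<Rightarrow> complex))" where
  "Pi_proj S h = (SOME P. L_proj S h P)"

definition pi_fun :: "('x \<Rightarrow> complex) set \<Rightarrow> 'x \<Rightarrow> (('x \<Rightarrow> complex) \<Rightarrow> complex) \<Rightarrow> complex" where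
  "pi_fun S h \<phi> = (SOME c. Pi_proj S h \<phi> = (\<lambda>f. c * pt_eval S h f))"

definition weak_top :: "('x \<Rightarrow> complex) set \<Rightarrow> ('x \<Rightarrow> complex) topology" where
  "weak_top S = topology_generated_by {S \<inter> \<phi> -` U | \<phi> U. \<phi> \<in> dual_sp S \<and> open U}"

definition weakly_compact_op :: "('x \<Rightarrow> complex) set \<Rightarrow> (('x \<Rightarrow> complex) \<Rightarrow> ('x \<Rightarrow> complex)) \<Rightarrow> bool" where
  "weakly_compact_op S T \<longleftrightarrow>
     compactin (weak_top S) ((weak_top S) closure_of (T ` {f\<in>S. supn f \<le> 1}))"

definition c0 :: "(nat \<Rightarrow> complex) set" where
  "c0 = {x. (x \<longlonglongrightarrow> 0)}"

definition closed_subspace_c0 :: "(nat \<Rightarrow> complex) set \<Rightarrow> bool" where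
  "closed_subspace_c0 E \<longleftrightarrow> E \<subseteq> c0 \<and> (\<lambda>n. 0) \<in> E \<and>
     (\<forall>x\<in>E. \<forall>y\<in>E. (\<lambda>n. x n + y n) \<in> E) \<and> (\<forall>c. \<forall>x\<in>E. (\<lambda>n. c * x n) \<in> E) \<and>
     (\<forall>xs x. (\<forall>k. xs k \<in> E) \<and> x \<in> c0 \<and> ((\<lambda>k. supn (\<lambda>n. xs k n - x n)) \<longlonglongrightarrow> 0) \<longrightarrow> x \<in> E)"

definition factors_c0 :: "('x \<Rightarrow> complex) set \<Rightarrow> (('x \<Rightarrow> complex) \<Rightarrow> ('x \<Rightarrow> complex)) \<Rightarrow> bool" where
  "factors_c0 S T \<longleftrightarrow> (\<exists>E T1 T2. closed_subspace_c0 E \<and> bdd_clin S supn E supn T1 \<and>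
      bdd_clin E supn S supn T2 \<and> (\<forall>f\<in>S. T f = T2 (T1 f)))"

end

theory Submission
  imports Defs
begin

text \<open>
  A functional \<open>\<phi>\<close> on \<open>C\<^sub>\<Lambda>\<close> extends with the same norm to a complex measure on \<open>G\<close>. Two
  extensions differ by a measure annihilating \<open>C\<^sub>\<Lambda>\<close>, hence the characters in \<open>\<Lambda>\<close>, which is
  diffuse because \<open>\<Gamma> - (-\<Lambda>)\<close> is semi-Riesz. So the point masses of the extension depend only
  on \<open>\<phi>\<close>; they are the numbers \<open>\<pi>\<^sub>h(\<phi>)\<close>, and splitting one of them off is additive for the norm.

  Consequently \<open>\<parallel>p\<^sub>s + T* p\<^sub>s\<parallel> = |1 + \<pi>\<^sub>s(T* p\<^sub>s)| - |\<pi>\<^sub>s(T* p\<^sub>s)| + \<parallel>T* p\<^sub>s\<parallel>\<close>, and the Daugavet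
  equation follows once every nonempty open set contains a point \<open>s\<close> with \<open>\<pi>\<^sub>s(T* p\<^sub>s)\<close> small. If
  \<open>T\<close> factors through a subspace of \<open>c\<^sub>0\<close>, all \<open>T* p\<^sub>s\<close> lie in the closed span of one sequence of
  functionals, so only countably many \<open>t\<close> can be atoms of any \<open>T* p\<^sub>s\<close>, while nonempty open sets
  are uncountable. If \<open>s \<mapsto> \<pi>\<^sub>t(T* p\<^sub>s)\<close> is continuous for every \<open>t\<close>, large values would accumulate
  against \<open>\<Sum>\<^sub>t |\<pi>\<^sub>t(T* p\<^sub>s)| \<le> \<parallel>T\<parallel>\<close>. Weak compactness gives this continuity: by Helly's theorem
  \<open>s \<mapsto> \<pi>\<^sub>t(T* p\<^sub>s)\<close> is a pointwise limit of images under \<open>T\<close> of the unit ball.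
\<close>

section \<open>The Hahn--Banach theorem\<close>

definition sublinear :: "('a::real_vector \<Rightarrow> real) \<Rightarrow> bool" where
  "sublinear p \<longleftrightarrow> (\<forall>x y. p (x + y) \<le> p x + p y) \<and> (\<forall>t x. t \<ge> 0 \<longrightarrow> p (t *\<^sub>R x) = t * p x)"

lemma sublinear_add: "sublinear p \<Longrightarrow> p (x + y) \<le> p x + p y"
  and sublinear_scaleR: "sublinear p \<Longrightarrow> t \<ge> 0 \<Longrightarrow> p (t *\<^sub>R x) = t * p x"
  by (auto simp: sublinear_def)

lemma sublinear_0: "sublinear p \<Longrightarrow> p 0 = 0"
  using sublinear_scaleR[of p 0 0] by simp

lemma sublinear_neg_le: "sublinear p \<Longrightarrow> - p (- x) \<le> p x"
  using sublinear_add[of p x "- x"] sublinear_0[of p] by simp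

lemma sublinearI:
  assumes add: "\<And>x y. p (x + y) \<le> p x + p y" and zero: "p 0 = 0"
    and scaleR_le: "\<And>t x. 0 < t \<Longrightarrow> p (t *\<^sub>R x) \<le> t * p x"
  shows "sublinear p"
proof -
  have "p (t *\<^sub>R x) = t * p x" if "0 \<le> t" for t x
  proof (cases "t = 0")
    case False
    then have "p (inverse t *\<^sub>R (t *\<^sub>R x)) \<le> inverse t * p (t *\<^sub>R x)"
      using that by (intro scaleR_le) simp
    then have "t * p x \<le> p (t *\<^sub>R x)"
      using False that by (simp add: field_simps)
    then show ?thesis
      using scaleR_le[of t x] False that by simp
  qed (simp add: zero)
  then show ?thesis
    using add by (simp add: sublinear_def)
qed

definition inf_convolution :: "('a::real_vector \<Rightarrow> real) \<Rightarrow> ('a \<times> real) set \<Rightarrow> 'a \<Rightarrow> real" where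
  "inf_convolution p C x = (INF (s, c)\<in>C. p (x + s) - c)"

context
  fixes p :: "'a::real_vector \<Rightarrow> real" and C :: "('a \<times> real) set"
  assumes p: "sublinear p" and C: "convex_cone C" and below_p: "\<And>s c. (s, c) \<in> C \<Longrightarrow> c \<le> p s"
begin

lemma inf_convolution_bounds:
  assumes "(s, c) \<in> C"
  shows "inf_convolution p C x \<le> p (x + s) - c" "- p (- x) \<le> p (x + s) - c"
proof -
  have lower: "- p (- x) \<le> p (x + t) - d" if "(t, d) \<in> C" for t d
    using sublinear_add[OF p, of "x + t" "- x"] below_p[OF that] by simp
  then show "- p (- x) \<le> p (x + s) - c"
    using assms .
  have "bdd_below ((\<lambda>(s, c). p (x + s) - c) ` C)"
    by (rule bdd_belowI[of _ "- p (- x)"]) (use lower in auto)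
  then show "inf_convolution p C x \<le> p (x + s) - c"
    using cINF_lower[OF _ assms] by (fastforce simp: inf_convolution_def)
qed

lemma inf_convolution_greatest:
  assumes "\<And>s c. (s, c) \<in> C \<Longrightarrow> b \<le> p (x + s) - c"
  shows "b \<le> inf_convolution p C x"
  unfolding inf_convolution_def using convex_cone_nonempty[OF C] assms by (intro cINF_greatest) auto

lemma inf_convolution_le: "inf_convolution p C x \<le> p x"
proof -
  have "(0, 0) \<in> C"
    using C by (simp add: convex_cone_iff zero_prod_def)
  then show ?thesis
    using inf_convolution_bounds(1)[of 0 0 x] by simp
qed

lemma inf_convolution_neg_le: "(s, c) \<in> C \<Longrightarrow> inf_convolution p C (- s) \<le> - c"
  using inf_convolution_bounds(1)[of s c "- s"] sublinear_0[OF p] by simp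

lemma sublinear_inf_convolution: "sublinear (inf_convolution p C)" (is "sublinear ?q")
proof (rule sublinearI)
  fix x y
  have "?q (x + y) \<le> (p (x + s) - c) + (p (y + t) - d)" if "(s, c) \<in> C" "(t, d) \<in> C" for s c t d
  proof -
    have "(s + t, c + d) \<in> C"
      using convex_cone_add[OF C that] by simp
    then have "?q (x + y) \<le> p ((x + y) + (s + t)) - (c + d)"
      by (rule inf_convolution_bounds)
    also have "(x + y) + (s + t) = (x + s) + (y + t)"
      by simp
    finally show ?thesis
      using sublinear_add[OF p, of "x + s" "y + t"] by simp
  qed
  then have "?q (x + y) - (p (x + s) - c) \<le> ?q y" if "(s, c) \<in> C" for s c
    using that by (intro inf_convolution_greatest) (fastforce simp: algebra_simps)
  then have "?q (x + y) - ?q y \<le> ?q x"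
    by (intro inf_convolution_greatest) (simp add: algebra_simps)
  then show "?q (x + y) \<le> ?q x + ?q y"
    by simp
next
  have "0 \<le> ?q 0"
    using inf_convolution_bounds(2)[of _ _ 0] sublinear_0[OF p]
    by (intro inf_convolution_greatest) simp
  then show "?q 0 = 0"
    using inf_convolution_le[of 0] sublinear_0[OF p] by simp
next
  fix t :: real and x assume t: "0 < t"
  have "?q (t *\<^sub>R x) / t \<le> p (x + s) - c" if "(s, c) \<in> C" for s c
  proof -
    have "(t *\<^sub>R s, t * c) \<in> C"
      using convex_cone_scaleR[OF C _ that, of t] t by simp
    then have "?q (t *\<^sub>R x) \<le> p (t *\<^sub>R x + t *\<^sub>R s) - t * c"
      by (rule inf_convolution_bounds)
    also have "\<dots> = t * (p (x + s) - c)"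
      using sublinear_scaleR[OF p, of t "x + s"] t by (simp add: algebra_simps)
    finally show ?thesis
      using t by (simp add: field_simps)
  qed
  then have "?q (t *\<^sub>R x) / t \<le> ?q x"
    by (rule inf_convolution_greatest)
  then show "?q (t *\<^sub>R x) \<le> t * ?q x"
    using t by (simp add: field_simps)
qed

end

text \<open>Convolving with the ray through \<open>(y, q y)\<close> cannot lower a minimal \<open>q\<close>, so
  \<open>q x \<le> q (x + y) - q y\<close>.\<close>

lemma minimal_sublinear_imp_linear:
  assumes q: "sublinear q" and minimal: "\<And>r. sublinear r \<Longrightarrow> r \<le> q \<Longrightarrow> r = q"
  shows "linear q"
proof -
  have add: "q (x + y) = q x + q y" for x y
  proof -
    define ray where "ray = (\<lambda>t. (t *\<^sub>R y, t * q y)) ` {0..}"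
    have ray: "convex_cone ray"
      unfolding convex_cone_iff
      by (auto simp: ray_def image_iff zero_prod_def
          scaleR_add_left[symmetric] distrib_right[symmetric]
          mult.assoc[symmetric] intro: bexI[of _ 0] add_nonneg_nonneg)
    have below: "c \<le> q s" if "(s, c) \<in> ray" for s c
      using that sublinear_scaleR[OF q] by (auto simp: ray_def)
    have "inf_convolution q ray = q"
      using sublinear_inf_convolution[OF q ray below] inf_convolution_le[OF q ray below]
      by (intro minimal) (auto simp: le_fun_def)
    moreover have "(y, q y) \<in> ray"
      by (auto simp: ray_def image_iff intro: bexI[of _ 1])
    ultimately have "q x \<le> q (x + y) - q y"
      using inf_convolution_bounds(1)[OF q ray below, of y "q y" x] by simp
    then show ?thesis
      using sublinear_add[OF q, of x y] by simp
  qed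
  have neg: "q (- x) = - q x" for x
    using add[of x "- x"] sublinear_0[OF q] by simp
  have "q (t *\<^sub>R x) = t * q x" for t x
  proof (cases "0 \<le> t")
    case False
    then show ?thesis
      using sublinear_scaleR[OF q, of "- t" x] neg[of "t *\<^sub>R x"] by simp
  qed (rule sublinear_scaleR[OF q])
  then show ?thesis
    using add by (intro linearI) simp_all
qed

lemma sublinear_INF_lower:
  fixes Q :: "('a::real_vector \<Rightarrow> real) set"
  assumes Q: "\<And>q. q \<in> Q \<Longrightarrow> sublinear q" "\<And>q. q \<in> Q \<Longrightarrow> q \<le> p" and "q \<in> Q"
  shows "(INF q\<in>Q. q x) \<le> q x"
proof (rule cINF_lower[OF _ \<open>q \<in> Q\<close>])
  have "- p (- x) \<le> r x" if "r \<in> Q" for r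
    using sublinear_neg_le[OF Q(1)[OF that], of x] le_funD[OF Q(2)[OF that], of "- x"] by simp
  then show "bdd_below ((\<lambda>q. q x) ` Q)"
    by (intro bdd_belowI[of _ "- p (- x)"]) auto
qed

lemma sublinear_INF_chain:
  fixes Q :: "('a::real_vector \<Rightarrow> real) set"
  assumes Q: "\<And>q. q \<in> Q \<Longrightarrow> sublinear q" "\<And>q. q \<in> Q \<Longrightarrow> q \<le> p" and nonempty: "Q \<noteq> {}"
    and chain: "\<And>q r. q \<in> Q \<Longrightarrow> r \<in> Q \<Longrightarrow> q \<le> r \<or> r \<le> q"
  shows "sublinear (\<lambda>x. INF q\<in>Q. q x)" (is "sublinear ?i")
proof (rule sublinearI)
  fix x y
  have "?i (x + y) \<le> q x + r y" if qr: "q \<in> Q" "r \<in> Q" for q r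
  proof -
    obtain s where "s \<in> Q" "s \<le> q" "s \<le> r"
      using chain[OF qr] qr by blast
    then show ?thesis
      using sublinear_INF_lower[OF Q \<open>s \<in> Q\<close>, of "x + y"] sublinear_add[OF Q(1)[OF \<open>s \<in> Q\<close>], of x y]
      by (smt (verit) le_funD)
  qed
  then have "?i (x + y) - q x \<le> ?i y" if "q \<in> Q" for q
    using that nonempty by (intro cINF_greatest) (auto simp: diff_le_eq add.commute[of _ "q x"])
  then have "?i (x + y) - ?i y \<le> ?i x"
    using nonempty by (intro cINF_greatest) (auto simp: algebra_simps)
  then show "?i (x + y) \<le> ?i x + ?i y"
    by simp
next
  have "?i 0 = (INF q\<in>Q. 0)"
    using Q(1) sublinear_0 by (intro INF_cong) auto
  then show "?i 0 = 0"
    using nonempty by simp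
next
  fix t :: real and x assume t: "0 < t"
  have "?i (t *\<^sub>R x) / t \<le> q x" if "q \<in> Q" for q
    using sublinear_INF_lower[OF Q that, of "t *\<^sub>R x"] sublinear_scaleR[OF Q(1)[OF that], of t x] t
    by (simp add: field_simps)
  then have "?i (t *\<^sub>R x) / t \<le> ?i x"
    using nonempty by (intro cINF_greatest)
  then show "?i (t *\<^sub>R x) \<le> t * ?i x"
    using t by (simp add: field_simps)
qed

lemma linear_below_sublinear:
  assumes p: "sublinear p"
  obtains w where "linear w" "w \<le> p"
proof -
  define A where "A = {q. sublinear q \<and> q \<le> p}"
  have "\<exists>q\<in>A. \<forall>r\<in>A. q \<ge> r \<longrightarrow> r = q"
  proof (rule predicate_Zorn)
    show "partial_order_on A (relation_of (\<ge>) A)"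
      by (rule partial_order_on_relation_ofI) auto
  next
    fix Q assume "Q \<in> Chains (relation_of (\<ge>) A)"
    then have "Q \<subseteq> A" and chain: "\<And>q r. q \<in> Q \<Longrightarrow> r \<in> Q \<Longrightarrow> q \<le> r \<or> r \<le> q"
      by (auto simp: Chains_def relation_of_def)
    then have Q: "\<And>q. q \<in> Q \<Longrightarrow> sublinear q" "\<And>q. q \<in> Q \<Longrightarrow> q \<le> p"
      by (auto simp: A_def)
    show "\<exists>u\<in>A. \<forall>q\<in>Q. q \<ge> u"
    proof (cases "Q = {}")
      case True
      then show ?thesis
        using p by (auto simp: A_def)
    next
      case False
      have below: "(\<lambda>x. INF q\<in>Q. q x) \<le> q" if "q \<in> Q" for q
        using sublinear_INF_lower[OF Q that] by (simp add: le_fun_def)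
      then have "(\<lambda>x. INF q\<in>Q. q x) \<in> A"
        using sublinear_INF_chain[OF Q False chain] False Q(2) unfolding A_def
        by (blast intro: order_trans)
      then show ?thesis
        using below by blast
    qed
  qed
  then obtain q where q: "sublinear q" "q \<le> p" and "\<And>r. sublinear r \<Longrightarrow> r \<le> p \<Longrightarrow> r \<le> q \<Longrightarrow> r = q"
    by (auto simp: A_def)
  then have "linear q"
    using order_trans by (intro minimal_sublinear_imp_linear) blast+
  then show ?thesis
    using q that by blast
qed

theorem hahn_banach_cone:
  fixes p :: "'a::real_vector \<Rightarrow> real"
  assumes "sublinear p" "convex_cone C" "\<And>s c. (s, c) \<in> C \<Longrightarrow> c \<le> p s"
  obtains w where "linear w" "\<And>x. w x \<le> p x" "\<And>s c. (s, c) \<in> C \<Longrightarrow> c \<le> w s"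
proof -
  obtain w where w: "linear w" "w \<le> inf_convolution p C"
    using linear_below_sublinear[OF sublinear_inf_convolution[OF assms]] by blast
  then have "w x \<le> p x" for x
    using inf_convolution_le[OF assms, of x] by (meson le_funD order_trans)
  moreover have "c \<le> w s" if "(s, c) \<in> C" for s c
    using inf_convolution_neg_le[OF assms that] w(2) linear_neg[OF w(1), of s]
    by (smt (verit) le_funD)
  ultimately show ?thesis
    using that w(1) by blast
qed

corollary hahn_banach:
  fixes p :: "'a::real_vector \<Rightarrow> real" and u :: "'a \<Rightarrow> real"
  assumes p: "sublinear p" and S: "subspace S"
    and add: "\<And>x y. x \<in> S \<Longrightarrow> y \<in> S \<Longrightarrow> u (x + y) = u x + u y"
    and scaleR: "\<And>t x. x \<in> S \<Longrightarrow> u (t *\<^sub>R x) = t * u x"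
    and below_p: "\<And>x. x \<in> S \<Longrightarrow> u x \<le> p x"
  obtains w where "linear w" "\<And>x. w x \<le> p x" "\<And>x. x \<in> S \<Longrightarrow> w x = u x"
proof -
  let ?graph = "(\<lambda>x. (x, u x)) ` S"
  have "convex_cone ?graph"
    unfolding convex_cone_iff
    using subspace_0[OF S] subspace_add[OF S] subspace_scale[OF S] add scaleR scaleR[of 0 0]
    by (auto simp: image_iff zero_prod_def)
  then obtain w where w: "linear w" "\<And>x. w x \<le> p x" "\<And>s c. (s, c) \<in> ?graph \<Longrightarrow> c \<le> w s"
    using hahn_banach_cone[OF p, of ?graph] below_p by auto
  have "w x = u x" if "x \<in> S" for x
  proof (rule antisym)
    have "- u x \<le> w (- x)"
      using that subspace_neg[OF S that] scaleR[OF that, of "-1"] by (intro w(3)) auto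
    then show "w x \<le> u x"
      by (simp add: linear_neg[OF w(1)])
  qed (use that w(3) in auto)
  then show ?thesis
    using that w by blast
qed

section \<open>Spaces of bounded continuous functions and their duals\<close>

lemma bcontfun_iff: "f \<in> bcontfun \<longleftrightarrow> continuous_on UNIV f \<and> bounded (range f)"
  by (simp add: bcontfun_def)

lemma Bcontfun_add:
  "f \<in> bcontfun \<Longrightarrow> g \<in> bcontfun \<Longrightarrow> Bcontfun (\<lambda>x. f x + g x) = Bcontfun f + Bcontfun g"
  by (rule bcontfun_eqI) (simp add: Bcontfun_inverse plus_cont)

lemma Bcontfun_scaleR: "f \<in> bcontfun \<Longrightarrow> Bcontfun (\<lambda>x. t *\<^sub>R f x) = t *\<^sub>R Bcontfun f"
  by (rule bcontfun_eqI) (simp add: Bcontfun_inverse scaleR_cont)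

lemma norm_le_supn: "f \<in> bcontfun \<Longrightarrow> norm (f x) \<le> supn f"
  unfolding supn_def bcontfun_iff bounded_iff
  by (intro cSUP_upper) (auto simp: bdd_above_def)

lemma supn_le: "(\<And>x. norm (f x) \<le> b) \<Longrightarrow> supn f \<le> b"
  unfolding supn_def by (intro cSUP_least) auto

lemma supn_nonneg: "f \<in> bcontfun \<Longrightarrow> 0 \<le> supn f"
  using norm_le_supn[of f] norm_ge_zero order_trans by blast

lemma supn_zero [simp]: "supn (\<lambda>x. 0) = 0"
  by (simp add: supn_def)

lemma supn_eq_norm:
  assumes "f \<in> bcontfun"
  shows "supn f = norm (Bcontfun f)"
proof (rule antisym)
  have f: "apply_bcontfun (Bcontfun f) = f"
    using assms by (simp add: Bcontfun_inverse)
  show "supn f \<le> norm (Bcontfun f)"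
    using norm_bounded[of "Bcontfun f"] by (intro supn_le) (simp add: f)
  show "norm (Bcontfun f) \<le> supn f"
    by (rule norm_bound) (simp add: f norm_le_supn assms)
qed

lemma cmult_bcontfun:
  fixes f :: "'x::topological_space \<Rightarrow> complex"
  assumes "f \<in> bcontfun"
  shows "(\<lambda>x. c * f x) \<in> bcontfun"
  by (rule bcontfun_normI[where b = "norm c * supn f"])
    (use assms in \<open>auto simp: norm_mult bcontfun_iff norm_le_supn
      intro!: continuous_intros mult_left_mono\<close>)

lemma supn_cmult_le: "f \<in> bcontfun \<Longrightarrow> supn (\<lambda>x. c * f x) \<le> norm c * supn f"
  by (rule supn_le) (simp add: norm_mult norm_le_supn mult_left_mono)

lemma dual_spD:
  assumes "\<phi> \<in> dual_sp S"
  shows "f \<in> S \<Longrightarrow> g \<in> S \<Longrightarrow> \<phi> (\<lambda>x. f x + g x) = \<phi> f + \<phi> g"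
    and "f \<in> S \<Longrightarrow> \<phi> (\<lambda>x. c * f x) = c * \<phi> f"
    and "f \<notin> S \<Longrightarrow> \<phi> f = 0"
  using assms by (auto simp: dual_sp_def)

lemma dual_sp_boundE:
  assumes "\<phi> \<in> dual_sp S"
  obtains K where "\<And>f. f \<in> S \<Longrightarrow> norm (\<phi> f) \<le> K * supn f"
  using assms unfolding dual_sp_def by blast

lemma dual_spI:
  assumes "\<And>f g. f \<in> S \<Longrightarrow> g \<in> S \<Longrightarrow> \<phi> (\<lambda>x. f x + g x) = \<phi> f + \<phi> g"
    and "\<And>c f. f \<in> S \<Longrightarrow> \<phi> (\<lambda>x. c * f x) = c * \<phi> f"
    and "\<And>f. f \<in> S \<Longrightarrow> norm (\<phi> f) \<le> K * supn f"
    and "\<And>f. f \<notin> S \<Longrightarrow> \<phi> f = 0"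
  shows "\<phi> \<in> dual_sp S"
  using assms unfolding dual_sp_def by blast

lemma bdd_clinD:
  assumes "bdd_clin A nA B nB T"
  shows "f \<in> A \<Longrightarrow> T f \<in> B"
    and "f \<in> A \<Longrightarrow> g \<in> A \<Longrightarrow> T (\<lambda>x. f x + g x) = (\<lambda>y. T f y + T g y)"
    and "f \<in> A \<Longrightarrow> T (\<lambda>x. c * f x) = (\<lambda>y. c * T f y)"
  using assms by (auto simp: bdd_clin_def)

lemma unimodular_factor:
  obtains c :: complex where "norm c = 1" "c * z = of_real (norm z)"
proof (cases "z = 0")
  case False
  then show ?thesis
    by (intro that[of "of_real (norm z) / z"]) (auto simp: norm_divide)
qed (use that[of 1] in auto)

locale bcont_subspace =
  fixes S :: "('x::topological_space \<Rightarrow> complex) set"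
  assumes zero_mem: "(\<lambda>x. 0) \<in> S"
    and add_mem: "f \<in> S \<Longrightarrow> g \<in> S \<Longrightarrow> (\<lambda>x. f x + g x) \<in> S"
    and cmult_mem: "f \<in> S \<Longrightarrow> (\<lambda>x. c * f x) \<in> S"
    and subset_bcontfun: "S \<subseteq> bcontfun"

interpretation bcontfun: bcont_subspace bcontfun
  by unfold_locales (auto intro: const_bcontfun plus_cont cmult_bcontfun)

context bcont_subspace
begin

lemma mem_bcontfun: "f \<in> S \<Longrightarrow> f \<in> bcontfun"
  using subset_bcontfun by blast

lemma diff_mem: "f \<in> S \<Longrightarrow> g \<in> S \<Longrightarrow> (\<lambda>x. f x - g x) \<in> S"
  using add_mem[OF _ cmult_mem[of g "-1"], of f] by simp

lemma sum_mem: "(\<And>i. i \<in> I \<Longrightarrow> f i \<in> S) \<Longrightarrow> (\<lambda>x. \<Sum>i\<in>I. f i x) \<in> S"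
  by (induction I rule: infinite_finite_induct) (auto intro: add_mem zero_mem)

lemma dual_sp_zero_arg: "\<phi> \<in> dual_sp S \<Longrightarrow> \<phi> (\<lambda>x. 0) = 0"
  using dual_spD(2)[of \<phi> S "\<lambda>x. 0" 0] zero_mem by simp

lemma dual_sp_diff_arg:
  assumes "\<phi> \<in> dual_sp S" "f \<in> S" "g \<in> S"
  shows "\<phi> (\<lambda>x. f x - g x) = \<phi> f - \<phi> g"
  using dual_spD(1)[OF assms(1,2) cmult_mem[OF assms(3), of "-1"]]
    dual_spD(2)[OF assms(1,3), of "-1"] by simp

lemma dual_sp_sum_arg:
  assumes "\<phi> \<in> dual_sp S" "\<And>i. i \<in> I \<Longrightarrow> f i \<in> S"
  shows "\<phi> (\<lambda>x. \<Sum>i\<in>I. f i x) = (\<Sum>i\<in>I. \<phi> (f i))"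
  using assms(2)
  by (induction I rule: infinite_finite_induct)
    (auto simp: dual_sp_zero_arg assms(1) dual_spD(1)[OF assms(1)] sum_mem)

lemma dnorm_least:
  "(\<And>f. f \<in> S \<Longrightarrow> supn f \<le> 1 \<Longrightarrow> norm (\<phi> f) \<le> K) \<Longrightarrow> dnorm S \<phi> \<le> K"
  unfolding dnorm_def using zero_mem by (intro cSUP_least) (auto intro!: exI[of _ "\<lambda>x. 0"])

lemma dnorm_cong: "(\<And>f. f \<in> S \<Longrightarrow> \<phi> f = \<psi> f) \<Longrightarrow> dnorm S \<phi> = dnorm S \<psi>"
  unfolding dnorm_def by (intro arg_cong[of _ _ Sup] image_cong) auto

lemma le_abs_on_unit_ball:
  assumes "a \<le> K * supn f" "f \<in> S" "supn f \<le> 1"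
  shows "a \<le> \<bar>K\<bar>"
proof -
  have "K * supn f \<le> \<bar>K\<bar> * 1"
    using assms supn_nonneg[OF mem_bcontfun] by (intro mult_mono) auto
  then show ?thesis
    using assms(1) by simp
qed

lemma norm_le_dnorm_unit:
  assumes \<phi>: "\<phi> \<in> dual_sp S" and f: "f \<in> S" "supn f \<le> 1"
  shows "norm (\<phi> f) \<le> dnorm S \<phi>"
proof -
  obtain K where K: "\<And>f. f \<in> S \<Longrightarrow> norm (\<phi> f) \<le> K * supn f"
    using dual_sp_boundE[OF \<phi>] by blast
  then have "bdd_above ((\<lambda>f. norm (\<phi> f)) ` {f\<in>S. supn f \<le> 1})"
    by (intro bdd_aboveI[of _ "\<bar>K\<bar>"]) (auto intro: le_abs_on_unit_ball)
  then show ?thesis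
    unfolding dnorm_def using f by (intro cSUP_upper) auto
qed

lemma dnorm_nonneg: "\<phi> \<in> dual_sp S \<Longrightarrow> 0 \<le> dnorm S \<phi>"
  using norm_le_dnorm_unit[OF _ zero_mem] dual_sp_zero_arg by fastforce

lemma norm_le_dnorm:
  assumes \<phi>: "\<phi> \<in> dual_sp S" and f: "f \<in> S"
  shows "norm (\<phi> f) \<le> dnorm S \<phi> * supn f"
proof (cases "supn f = 0")
  case True
  then show ?thesis
    using \<phi> f by (metis dual_sp_boundE mult_zero_right)
next
  case False
  then have pos: "0 < supn f"
    using supn_nonneg[OF mem_bcontfun[OF f]] by simp
  let ?c = "complex_of_real (1 / supn f)"
  have "supn (\<lambda>x. ?c * f x) \<le> 1"
    using supn_cmult_le[OF mem_bcontfun[OF f], of ?c] pos by (simp add: norm_divide)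
  then have "norm (\<phi> (\<lambda>x. ?c * f x)) \<le> dnorm S \<phi>"
    by (intro norm_le_dnorm_unit \<phi> cmult_mem f)
  then have "norm (?c * \<phi> f) \<le> dnorm S \<phi>"
    by (simp only: dual_spD(2)[OF \<phi> f])
  then show ?thesis
    using pos by (simp add: norm_divide norm_mult field_simps)
qed

lemma dnorm_compose_le:
  assumes "bcont_subspace E" "\<rho> \<in> dual_sp E" and T: "\<And>f. f \<in> S \<Longrightarrow> T f \<in> E"
    and K: "\<And>f. f \<in> S \<Longrightarrow> supn (T f) \<le> K * supn f"
  shows "dnorm S (\<lambda>f. \<rho> (T f)) \<le> dnorm E \<rho> * \<bar>K\<bar>"
proof (rule dnorm_least)
  interpret E: bcont_subspace E
    by fact
  fix f assume f: "f \<in> S" "supn f \<le> 1"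
  have "norm (\<rho> (T f)) \<le> dnorm E \<rho> * supn (T f)"
    by (rule E.norm_le_dnorm[OF assms(2) T[OF f(1)]])
  also have "\<dots> \<le> dnorm E \<rho> * \<bar>K\<bar>"
    by (intro mult_left_mono le_abs_on_unit_ball[OF K[OF f(1)] f] E.dnorm_nonneg assms(2))
  finally show "norm (\<rho> (T f)) \<le> dnorm E \<rho> * \<bar>K\<bar>" .
qed

lemma dnorm_eq_0_imp:
  assumes \<phi>: "\<phi> \<in> dual_sp S" and "dnorm S \<phi> = 0"
  shows "\<phi> = (\<lambda>f. 0)"
  using norm_le_dnorm[OF \<phi>] dual_spD(3)[OF \<phi>] assms(2) by fastforce

lemma norm_le_mult_supn_if_Re_le:
  assumes cmult: "\<And>c. \<phi> (\<lambda>x. c * f x) = c * \<phi> f" and f: "f \<in> S"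
    and Re_le: "\<And>g. g \<in> S \<Longrightarrow> supn g \<le> supn f \<Longrightarrow> Re (\<phi> g) \<le> K"
  shows "norm (\<phi> f) \<le> K"
proof -
  obtain c where c: "norm c = 1" "c * \<phi> f = of_real (norm (\<phi> f))"
    by (rule unimodular_factor)
  have "Re (\<phi> (\<lambda>x. c * f x)) \<le> K"
    using supn_cmult_le[OF mem_bcontfun[OF f], of c] c(1) by (intro Re_le cmult_mem f) simp
  then show ?thesis
    using c(2) by (simp add: cmult)
qed

lemma dual_sp_zero: "(\<lambda>f. 0) \<in> dual_sp S"
  by (auto simp: dual_sp_def intro!: exI[of _ 0])

lemma dual_sp_add:
  assumes "\<phi> \<in> dual_sp S" "\<psi> \<in> dual_sp S"
  shows "(\<lambda>f. \<phi> f + \<psi> f) \<in> dual_sp S"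
proof (rule dual_spI)
  show "norm (\<phi> f + \<psi> f) \<le> (dnorm S \<phi> + dnorm S \<psi>) * supn f" if "f \<in> S" for f
    using norm_triangle_ineq[of "\<phi> f" "\<psi> f"]
      norm_le_dnorm[OF assms(1) that] norm_le_dnorm[OF assms(2) that]
    by (simp add: distrib_right)
qed (use assms in \<open>auto simp: dual_spD algebra_simps\<close>)

lemma dual_sp_cmult:
  assumes "\<phi> \<in> dual_sp S"
  shows "(\<lambda>f. c * \<phi> f) \<in> dual_sp S"
proof (rule dual_spI)
  show "norm (c * \<phi> f) \<le> (norm c * dnorm S \<phi>) * supn f" if "f \<in> S" for f
    using mult_left_mono[OF norm_le_dnorm[OF assms that], of "norm c"]
    by (simp add: norm_mult mult.assoc)
qed (use assms in \<open>auto simp: dual_spD algebra_simps\<close>)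

lemma dual_sp_diff: "\<phi> \<in> dual_sp S \<Longrightarrow> \<psi> \<in> dual_sp S \<Longrightarrow> (\<lambda>f. \<phi> f - \<psi> f) \<in> dual_sp S"
  using dual_sp_add[OF _ dual_sp_cmult[of \<psi> "-1"], of \<phi>] by simp

lemma dual_sp_sum: "(\<And>i. i \<in> I \<Longrightarrow> \<phi> i \<in> dual_sp S) \<Longrightarrow> (\<lambda>f. \<Sum>i\<in>I. \<phi> i f) \<in> dual_sp S"
  by (induction I rule: infinite_finite_induct) (auto intro: dual_sp_add dual_sp_zero)

lemma dual_sp_restrict:
  assumes "\<phi> \<in> dual_sp R" "S \<subseteq> R"
  shows "(\<lambda>f. if f \<in> S then \<phi> f else 0) \<in> dual_sp S"
proof -
  obtain K where "\<And>f. f \<in> R \<Longrightarrow> norm (\<phi> f) \<le> K * supn f"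
    using dual_sp_boundE[OF assms(1)] by blast
  then show ?thesis
    by (intro dual_spI[where K = K])
      (use assms in \<open>auto simp: add_mem cmult_mem dual_spD subset_iff\<close>)
qed

lemma dual_sp_eval:
  assumes T: "bdd_clin S supn B supn T" and B: "B \<subseteq> bcontfun"
  shows "(\<lambda>f. if f \<in> S then T f y else 0) \<in> dual_sp S"
proof -
  obtain K where K: "\<And>f. f \<in> S \<Longrightarrow> supn (T f) \<le> K * supn f"
    using T unfolding bdd_clin_def by blast
  have "norm (T f y) \<le> K * supn f" if "f \<in> S" for f
    using norm_le_supn[of "T f" y] K[OF that] bdd_clinD(1)[OF T that] B by fastforce
  then show ?thesis
    by (intro dual_spI[where K = K]) (auto simp: bdd_clinD[OF T] add_mem cmult_mem)
qed

lemma bdd_clin_id: "bdd_clin S supn S supn (\<lambda>f. f)"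
  by (auto simp: bdd_clin_def intro!: exI[of _ 1])

lemma dual_sp_pt_eval: "pt_eval S h \<in> dual_sp S"
  using dual_sp_eval[OF bdd_clin_id subset_bcontfun] by (simp add: pt_eval_def)

lemma dnorm_pt_eval_le: "dnorm S (pt_eval S h) \<le> 1"
  by (rule dnorm_least) (auto simp: pt_eval_def intro: order_trans[OF norm_le_supn] mem_bcontfun)

lemma dnorm_triangle:
  assumes "\<phi> \<in> dual_sp S" "\<psi> \<in> dual_sp S"
  shows "dnorm S (\<lambda>f. \<phi> f + \<psi> f) \<le> dnorm S \<phi> + dnorm S \<psi>"
  by (intro dnorm_least order_trans[OF norm_triangle_ineq] add_mono norm_le_dnorm_unit assms)

lemma dnorm_cmult_le: "\<phi> \<in> dual_sp S \<Longrightarrow> dnorm S (\<lambda>f. c * \<phi> f) \<le> norm c * dnorm S \<phi>"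
  by (intro dnorm_least) (auto simp: norm_mult intro!: mult_left_mono norm_le_dnorm_unit)

lemma dnorm_uminus: "dnorm S (\<lambda>f. - \<phi> f) = dnorm S \<phi>"
  by (simp add: dnorm_def)

text \<open>Bohnenblust--Sobczyk: a complex functional is recovered from its real part.\<close>

lemma dual_sp_complexify:
  fixes v :: "('x \<Rightarrow> complex) \<Rightarrow> real"
  assumes v_add: "\<And>f g. f \<in> S \<Longrightarrow> g \<in> S \<Longrightarrow> v (\<lambda>x. f x + g x) = v f + v g"
    and v_scale: "\<And>t f. f \<in> S \<Longrightarrow> v (\<lambda>x. of_real t * f x) = t * v f"
    and v_le: "\<And>f. f \<in> S \<Longrightarrow> v f \<le> K * supn f" and K: "0 \<le> K"
  defines "\<Phi> \<equiv> \<lambda>f. if f \<in> S then Complex (v f) (- v (\<lambda>x. \<i> * f x)) else 0"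
  shows "\<Phi> \<in> dual_sp S" and "dnorm S \<Phi> \<le> K"
proof -
  have add: "\<Phi> (\<lambda>x. f x + g x) = \<Phi> f + \<Phi> g" if "f \<in> S" "g \<in> S" for f g
    using that v_add[OF that] v_add[OF cmult_mem[OF that(1)] cmult_mem[OF that(2)], of \<i> \<i>]
    by (simp add: \<Phi>_def add_mem complex_eq_iff distrib_left)
  have scale_real: "\<Phi> (\<lambda>x. of_real t * f x) = of_real t * \<Phi> f" if "f \<in> S" for f t
    using that v_scale[OF that] v_scale[OF cmult_mem[OF that], of t \<i>]
    by (simp add: \<Phi>_def cmult_mem complex_eq_iff mult.left_commute)
  have scale_i: "\<Phi> (\<lambda>x. \<i> * f x) = \<i> * \<Phi> f" if "f \<in> S" for f
    using that v_scale[OF that, of "-1"]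
    by (simp add: \<Phi>_def cmult_mem complex_eq_iff mult.assoc[symmetric])
  have scale: "\<Phi> (\<lambda>x. c * f x) = c * \<Phi> f" if f: "f \<in> S" for f c
  proof -
    have "(\<lambda>x. c * f x) = (\<lambda>x. of_real (Re c) * f x + of_real (Im c) * (\<i> * f x))"
      by (simp add: fun_eq_iff complex_eq_iff algebra_simps)
    then have "\<Phi> (\<lambda>x. c * f x) = of_real (Re c) * \<Phi> f + of_real (Im c) * (\<i> * \<Phi> f)"
      using f by (simp add: add cmult_mem scale_real scale_i)
    then show ?thesis
      by (simp add: complex_eq_iff algebra_simps)
  qed
  have norm: "norm (\<Phi> f) \<le> K * supn f" if f: "f \<in> S" for f
  proof (rule norm_le_mult_supn_if_Re_le[OF scale[OF f] f])
    show "Re (\<Phi> g) \<le> K * supn f" if "g \<in> S" "supn g \<le> supn f" for g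
      using v_le[OF that(1)] mult_left_mono[OF that(2) K] that(1) by (simp add: \<Phi>_def)
  qed
  show "\<Phi> \<in> dual_sp S"
    by (rule dual_spI[OF add scale norm]) (auto simp: \<Phi>_def)
  show "dnorm S \<Phi> \<le> K"
  proof (rule dnorm_least)
    show "norm (\<Phi> f) \<le> K" if "f \<in> S" "supn f \<le> 1" for f
      using norm[OF that(1)] mult_left_mono[OF that(2) K] by simp
  qed
qed

lemma Re_dual_extension:
  assumes \<phi>: "\<phi> \<in> dual_sp S"
  obtains w :: "('x \<Rightarrow>\<^sub>C complex) \<Rightarrow> real" where "linear w" "\<And>F. w F \<le> dnorm S \<phi> * norm F"
    "\<And>f. f \<in> S \<Longrightarrow> w (Bcontfun f) = Re (\<phi> f)"
proof -
  define S' where "S' = {F. apply_bcontfun F \<in> S}"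
  let ?C = "dnorm S \<phi>"
  have "sublinear (\<lambda>F :: ('x, complex) bcontfun. ?C * norm F)"
    using dnorm_nonneg[OF \<phi>] unfolding sublinear_def
    by (auto simp: distrib_left[symmetric] intro!: mult_left_mono norm_triangle_ineq)
  moreover have "subspace S'"
    by (auto simp: subspace_def S'_def scaleR_conv_of_real zero_mem add_mem cmult_mem)
  moreover have "Re (\<phi> (F + G)) = Re (\<phi> F) + Re (\<phi> G)" if "F \<in> S'" "G \<in> S'" for F G
    using dual_spD(1)[OF \<phi>, of F G] that by (simp add: S'_def plus_bcontfun.rep_eq)
  moreover have "Re (\<phi> (t *\<^sub>R F)) = t * Re (\<phi> F)" if "F \<in> S'" for F t
    using dual_spD(2)[OF \<phi>, of F "of_real t"] that
    by (simp add: S'_def scaleR_bcontfun.rep_eq scaleR_conv_of_real)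
  moreover have "Re (\<phi> F) \<le> ?C * norm F" if "F \<in> S'" for F
    using norm_le_dnorm[OF \<phi>, of F] that complex_Re_le_cmod[of "\<phi> F"] supn_eq_norm[of F]
    by (simp add: S'_def apply_bcontfun_inverse apply_bcontfun)
  ultimately obtain w where w: "linear w" "\<And>F. w F \<le> ?C * norm F" "\<And>F. F \<in> S' \<Longrightarrow> w F = Re (\<phi> F)"
    using hahn_banach[of "\<lambda>F. ?C * norm F" S' "\<lambda>F. Re (\<phi> F)"] by blast
  have "w (Bcontfun f) = Re (\<phi> f)" if "f \<in> S" for f
    using that w(3)[of "Bcontfun f"] by (simp add: S'_def Bcontfun_inverse mem_bcontfun)
  then show ?thesis
    using that w(1,2) by blast
qed

theorem complex_hahn_banach:
  assumes \<phi>: "\<phi> \<in> dual_sp S"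
  obtains \<Phi> where "\<Phi> \<in> dual_sp bcontfun" "\<And>f. f \<in> S \<Longrightarrow> \<Phi> f = \<phi> f" "dnorm bcontfun \<Phi> \<le> dnorm S \<phi>"
proof -
  let ?C = "dnorm S \<phi>"
  obtain w :: "('x \<Rightarrow>\<^sub>C complex) \<Rightarrow> real" where w: "linear w" "\<And>F. w F \<le> ?C * norm F"
    "\<And>f. f \<in> S \<Longrightarrow> w (Bcontfun f) = Re (\<phi> f)"
    using Re_dual_extension[OF \<phi>] by metis
  define v where "v f = w (Bcontfun f)" for f
  define \<Phi> where "\<Phi> = (\<lambda>f. if f \<in> bcontfun then Complex (v f) (- v (\<lambda>x. \<i> * f x)) else 0)"
  have v_add: "v (\<lambda>x. f x + g x) = v f + v g" if "f \<in> bcontfun" "g \<in> bcontfun" for f g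
    by (simp add: v_def Bcontfun_add[OF that] linear_add[OF w(1)])
  have v_scale: "v (\<lambda>x. of_real t * f x) = t * v f" if "f \<in> bcontfun" for t f
    using Bcontfun_scaleR[OF that, of t] linear_scale[OF w(1), of t "Bcontfun f"]
    by (simp add: v_def scaleR_conv_of_real)
  have v_le: "v f \<le> ?C * supn f" if "f \<in> bcontfun" for f
    using w(2) by (simp add: v_def supn_eq_norm[OF that])
  have \<Phi>: "\<Phi> \<in> dual_sp bcontfun" "dnorm bcontfun \<Phi> \<le> ?C"
    unfolding \<Phi>_def
    by (rule bcontfun.dual_sp_complexify[OF v_add v_scale v_le dnorm_nonneg[OF \<phi>]]; assumption)+
  have "\<Phi> f = \<phi> f" if f: "f \<in> S" for f
    using w(3)[OF f] w(3)[OF cmult_mem[OF f]] mem_bcontfun[OF f] dual_spD(2)[OF \<phi> f]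
    by (simp add: \<Phi>_def v_def complex_eq_iff)
  then show ?thesis
    using that \<Phi> by blast
qed

end

subsection \<open>\<open>L\<close>-projections\<close>

lemma L_projD:
  assumes "L_proj S h P" "\<phi> \<in> dual_sp S"
  shows "\<psi> \<in> dual_sp S \<Longrightarrow> P (\<lambda>f. \<phi> f + \<psi> f) = (\<lambda>f. P \<phi> f + P \<psi> f)"
    and "P (\<lambda>f. c * \<phi> f) = (\<lambda>f. c * P \<phi> f)"
    and "P (P \<phi>) = P \<phi>"
    and "dnorm S \<phi> = dnorm S (P \<phi>) + dnorm S (\<lambda>f. \<phi> f - P \<phi> f)"
  using assms by (auto simp: L_proj_def)

lemma L_proj_range: "L_proj S h P \<Longrightarrow> P ` dual_sp S = {(\<lambda>f. c * pt_eval S h f) | c. True}"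
  by (simp add: L_proj_def)

context bcont_subspace
begin

lemma L_proj_in_dual_sp:
  assumes "L_proj S h P" "\<phi> \<in> dual_sp S"
  shows "P \<phi> \<in> dual_sp S"
proof -
  have "P \<phi> \<in> P ` dual_sp S"
    using assms(2) by blast
  then show ?thesis
    using dual_sp_cmult[OF dual_sp_pt_eval] by (auto simp: L_proj_range[OF assms(1)])
qed

lemma L_proj_diff:
  assumes P: "L_proj S h P" and "\<phi> \<in> dual_sp S" "\<psi> \<in> dual_sp S"
  shows "P (\<lambda>f. \<phi> f - \<psi> f) = (\<lambda>f. P \<phi> f - P \<psi> f)"
  using L_projD(1)[OF P assms(2) dual_sp_cmult[OF assms(3), of "-1"]]
    L_projD(2)[OF P assms(3), of "-1"]
  by simp

lemma L_proj_comp: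
  assumes P: "L_proj S h P" and Q: "L_proj S h Q" and \<phi>: "\<phi> \<in> dual_sp S"
  shows "P (Q \<phi>) = Q \<phi>"
proof -
  have "Q \<phi> \<in> P ` dual_sp S"
    using \<phi> L_proj_range[OF P] L_proj_range[OF Q] by blast
  then show ?thesis
    using L_projD(3)[OF P] by auto
qed

text \<open>For \<open>z = \<phi> - Q \<phi>\<close>, additivity of the norm under \<open>Q\<close> gives \<open>\<parallel>z - P z\<parallel> = \<parallel>P z\<parallel> + \<parallel>z\<parallel>\<close> and
  under \<open>P\<close> it gives \<open>\<parallel>z\<parallel> = \<parallel>P z\<parallel> + \<parallel>z - P z\<parallel>\<close>, so \<open>P z = 0\<close>.\<close>

lemma L_proj_unique:
  assumes P: "L_proj S h P" and Q: "L_proj S h Q" and \<phi>: "\<phi> \<in> dual_sp S"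
  shows "P \<phi> = Q \<phi>"
proof -
  define z where "z = (\<lambda>f. \<phi> f - Q \<phi> f)"
  have Q\<phi>: "Q \<phi> \<in> dual_sp S"
    by (rule L_proj_in_dual_sp[OF Q \<phi>])
  have z: "z \<in> dual_sp S"
    unfolding z_def by (rule dual_sp_diff[OF \<phi> Q\<phi>])
  have Pz: "P z \<in> dual_sp S"
    by (rule L_proj_in_dual_sp[OF P z])
  have "Q z = (\<lambda>f. 0)"
    unfolding z_def by (simp add: L_proj_diff[OF Q \<phi> Q\<phi>] L_projD(3)[OF Q \<phi>])
  then have "Q (\<lambda>f. z f - P z f) = (\<lambda>f. - P z f)"
    by (simp add: L_proj_diff[OF Q z Pz] L_proj_comp[OF Q P z])
  then have "dnorm S (\<lambda>f. z f - P z f) = dnorm S (P z) + dnorm S z"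
    using L_projD(4)[OF Q dual_sp_diff[OF z Pz]] by (simp add: dnorm_uminus)
  moreover have "dnorm S z = dnorm S (P z) + dnorm S (\<lambda>f. z f - P z f)"
    by (rule L_projD(4)[OF P z])
  ultimately have "P z = (\<lambda>f. 0)"
    by (intro dnorm_eq_0_imp[OF Pz]) simp
  moreover have "P z = (\<lambda>f. P \<phi> f - Q \<phi> f)"
    unfolding z_def by (simp add: L_proj_diff[OF P \<phi> Q\<phi>] L_proj_comp[OF P Q \<phi>])
  ultimately show ?thesis
    by (simp add: fun_eq_iff)
qed

end

subsection \<open>Helly's theorem\<close>

lemma sum_norm_diff_segment:
  fixes v x y :: "'i \<Rightarrow> complex"
  shows "(\<Sum>i\<in>A. (norm (v i - (of_real (1 - l) * x i + of_real l * y i)))\<^sup>2) =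
    (\<Sum>i\<in>A. (norm (v i - x i))\<^sup>2) - 2 * l * Re (\<Sum>i\<in>A. cnj (v i - x i) * (y i - x i))
    + l\<^sup>2 * (\<Sum>i\<in>A. (norm (y i - x i))\<^sup>2)"
proof -
  have "(norm (v i - (of_real (1 - l) * x i + of_real l * y i)))\<^sup>2 =
    (norm (v i - x i))\<^sup>2 - 2 * l * Re (cnj (v i - x i) * (y i - x i)) + l\<^sup>2 * (norm (y i - x i))\<^sup>2"
    for i
    unfolding cmod_power2 by (simp add: power2_eq_square algebra_simps)
  then show ?thesis
    by (simp only: sum.distrib sum_subtractf sum_distrib_left Re_sum)
qed

lemma sum_norm_diff_eq_Re:
  fixes v x :: "'i \<Rightarrow> complex"
  shows "(\<Sum>i\<in>A. (norm (v i - x i))\<^sup>2) =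
    Re (\<Sum>i\<in>A. cnj (v i - x i) * v i) - Re (\<Sum>i\<in>A. cnj (v i - x i) * x i)"
  unfolding Re_sum sum_subtractf[symmetric] cmod_power2
  by (intro sum.cong refl) (simp add: power2_eq_square algebra_simps)

lemma near_minimiser_variation_le:
  fixes v x y :: "'i \<Rightarrow> complex"
  assumes near: "(\<Sum>i\<in>A. (norm (v i - x i))\<^sup>2) \<le> d + l\<^sup>2"
    and segment: "d \<le> (\<Sum>i\<in>A. (norm (v i - (of_real (1 - l) * x i + of_real l * y i)))\<^sup>2)"
    and bound: "(\<Sum>i\<in>A. (norm (y i - x i))\<^sup>2) \<le> C" and l: "0 < l"
  shows "2 * Re (\<Sum>i\<in>A. cnj (v i - x i) * (y i - x i)) \<le> l * (1 + C)"
proof -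
  let ?r = "Re (\<Sum>i\<in>A. cnj (v i - x i) * (y i - x i))"
  have "d \<le> (d + l\<^sup>2) - 2 * l * ?r + l\<^sup>2 * C"
    using segment near mult_left_mono[OF bound, of "l\<^sup>2"] unfolding sum_norm_diff_segment by simp
  then have "l * (2 * ?r) \<le> l * (l * (1 + C))"
    by (simp add: power2_eq_square algebra_simps)
  then show ?thesis
    using l by simp
qed

text \<open>The functional \<open>w\<close> is \<open>v - x\<^sub>0\<close> for a near-minimiser \<open>x\<^sub>0\<close> of the distance to \<open>v\<close>; moving
  from \<open>x\<^sub>0\<close> a little towards \<open>y \<in> X\<close> cannot decrease the distance much.\<close>

lemma finite_dim_separation:
  fixes X :: "('i \<Rightarrow> complex) set" and v :: "'i \<Rightarrow> complex"
  assumes convex: "\<And>x y t. x \<in> X \<Longrightarrow> y \<in> X \<Longrightarrow> 0 \<le> t \<Longrightarrow> t \<le> 1 \<Longrightarrow>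
      (\<lambda>i. of_real (1 - t) * x i + of_real t * y i) \<in> X"
    and nonempty: "X \<noteq> {}" and bounded: "\<And>x i. x \<in> X \<Longrightarrow> i \<in> A \<Longrightarrow> norm (x i) \<le> B"
    and far: "\<And>x. x \<in> X \<Longrightarrow> \<delta> \<le> (\<Sum>i\<in>A. (norm (v i - x i))\<^sup>2)" "0 < \<delta>"
  obtains w b where "\<And>x. x \<in> X \<Longrightarrow> Re (\<Sum>i\<in>A. cnj (w i) * x i) \<le> b" "b < Re (\<Sum>i\<in>A. cnj (w i) * v i)"
proof -
  define q where "q x = (\<Sum>i\<in>A. (norm (v i - x i))\<^sup>2)" for x
  define d where "d = (INF x\<in>X. q x)"
  have bdd: "bdd_below (q ` X)"
    by (rule bdd_belowI[of _ 0]) (auto simp: q_def intro: sum_nonneg)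
  have d_le: "d \<le> q x" if "x \<in> X" for x
    unfolding d_def by (rule cINF_lower[OF bdd that])
  have d: "0 < d"
    using cINF_greatest[OF nonempty, of \<delta> q] far by (simp add: d_def q_def)
  define C where "C = real (card A) * (2 * B)\<^sup>2"
  have C: "0 \<le> C"
    by (simp add: C_def)
  define l where "l = min 1 (d / (1 + C))"
  have "l * (1 + C) \<le> d / (1 + C) * (1 + C)"
    using C by (intro mult_right_mono) (auto simp: l_def)
  then have l: "0 < l" "l \<le> 1" "l * (1 + C) \<le> d"
    using d C by (auto simp: l_def)
  have "\<exists>x\<in>X. q x < d + l\<^sup>2"
    unfolding d_def by (subst cINF_less_iff[symmetric, OF nonempty bdd]) (use l in simp)
  then obtain x where x: "x \<in> X" "q x < d + l\<^sup>2"
    by blast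
  define w where "w i = v i - x i" for i
  show ?thesis
  proof (rule that)
    fix y assume y: "y \<in> X"
    have "(norm (y i - x i))\<^sup>2 \<le> (2 * B)\<^sup>2" if "i \<in> A" for i
      using norm_triangle_ineq4[of "y i" "x i"] bounded[OF x(1) that] bounded[OF y that]
      by (intro power_mono) auto
    then have norm_le: "(\<Sum>i\<in>A. (norm (y i - x i))\<^sup>2) \<le> C"
      unfolding C_def by (rule sum_bounded_above)
    have "d \<le> q (\<lambda>i. of_real (1 - l) * x i + of_real l * y i)"
      by (rule d_le[OF convex]) (use x y l in auto)
    then have "2 * Re (\<Sum>i\<in>A. cnj (w i) * (y i - x i)) \<le> d"
      using near_minimiser_variation_le[OF _ _ norm_le l(1), of v d] x(2) l(3)
      by (simp add: q_def w_def)
    then show "Re (\<Sum>i\<in>A. cnj (w i) * y i) \<le> Re (\<Sum>i\<in>A. cnj (w i) * x i) + d / 2"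
      by (simp add: right_diff_distrib sum_subtractf)
  next
    show "Re (\<Sum>i\<in>A. cnj (w i) * x i) + d / 2 < Re (\<Sum>i\<in>A. cnj (w i) * v i)"
      using d_le[OF x(1)] d unfolding q_def sum_norm_diff_eq_Re w_def by linarith
  qed
qed

context bcont_subspace
begin

lemma convex_combination_unit_ball:
  assumes "f \<in> S" "supn f \<le> 1" "g \<in> S" "supn g \<le> 1" "0 \<le> t" "t \<le> 1"
  shows "supn (\<lambda>x. of_real (1 - t) * f x + of_real t * g x) \<le> 1"
proof (rule supn_le)
  fix x
  have "norm (f x) \<le> 1" "norm (g x) \<le> 1"
    using assms norm_le_supn[OF mem_bcontfun, of f x] norm_le_supn[OF mem_bcontfun, of g x] by auto
  then have "norm (of_real (1 - t) * f x + of_real t * g x) \<le> (1 - t) * 1 + t * 1"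
    using assms(5,6)
    by (intro order_trans[OF norm_triangle_ineq] add_mono)
      (simp_all add: norm_mult mult_left_le del: of_real_diff)
  then show "norm (of_real (1 - t) * f x + of_real t * g x) \<le> 1"
    by simp
qed

lemma convex_dual_image_unit_ball:
  assumes \<phi>: "\<And>i. i \<in> A \<Longrightarrow> \<phi> i \<in> dual_sp S"
  defines "X \<equiv> (\<lambda>f i. if i \<in> A then \<phi> i f else 0) ` {f\<in>S. supn f \<le> 1}"
  assumes "x \<in> X" "y \<in> X" and t: "0 \<le> t" "t \<le> 1"
  shows "(\<lambda>i. of_real (1 - t) * x i + of_real t * y i) \<in> X"
proof -
  obtain f g where fg: "f \<in> S" "supn f \<le> 1" "g \<in> S" "supn g \<le> 1"
    and x_eq: "x = (\<lambda>i. if i \<in> A then \<phi> i f else 0)"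
    and y_eq: "y = (\<lambda>i. if i \<in> A then \<phi> i g else 0)"
    using assms(3,4) by (auto simp: X_def)
  have "(\<lambda>i. of_real (1 - t) * x i + of_real t * y i)
      = (\<lambda>i. if i \<in> A then \<phi> i (\<lambda>z. of_real (1 - t) * f z + of_real t * g z) else 0)"
    using fg by (auto simp: x_eq y_eq dual_spD[OF \<phi>] cmult_mem simp del: of_real_diff)
  then show ?thesis
    using convex_combination_unit_ball[OF fg t] add_mem[OF cmult_mem cmult_mem, OF fg(1,3)]
    unfolding X_def by blast
qed

theorem helly:
  assumes A: "finite A" and \<phi>: "\<And>i. i \<in> A \<Longrightarrow> \<phi> i \<in> dual_sp S" and \<epsilon>: "0 < \<epsilon>"
    and dominated: "\<And>c. norm (\<Sum>i\<in>A. c i * v i) \<le> dnorm S (\<lambda>f. \<Sum>i\<in>A. c i * \<phi> i f)"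
  shows "\<exists>f\<in>S. supn f \<le> 1 \<and> (\<forall>i\<in>A. norm (\<phi> i f - v i) \<le> \<epsilon>)"
proof (rule ccontr)
  assume not_approx: "\<not> ?thesis"
  define X where "X = (\<lambda>f i. if i \<in> A then \<phi> i f else 0) ` {f\<in>S. supn f \<le> 1}"
  have far: "\<epsilon>\<^sup>2 \<le> (\<Sum>i\<in>A. (norm (v i - x i))\<^sup>2)" if x: "x \<in> X" for x
  proof -
    obtain i where i: "i \<in> A" "\<epsilon> < norm (x i - v i)"
      using x not_approx by (force simp: X_def)
    then have "\<epsilon>\<^sup>2 \<le> (norm (v i - x i))\<^sup>2"
      using \<epsilon> by (intro power_mono) (auto simp: norm_minus_commute)
    also have "\<dots> \<le> (\<Sum>i\<in>A. (norm (v i - x i))\<^sup>2)"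
      using A i(1) by (intro member_le_sum) auto
    finally show ?thesis .
  qed
  obtain w b where w: "\<And>x. x \<in> X \<Longrightarrow> Re (\<Sum>i\<in>A. cnj (w i) * x i) \<le> b"
    "b < Re (\<Sum>i\<in>A. cnj (w i) * v i)"
  proof (rule finite_dim_separation[of X A "\<Sum>i\<in>A. dnorm S (\<phi> i)" "\<epsilon>\<^sup>2" v])
    show "(\<lambda>i. of_real (1 - t) * x i + of_real t * y i) \<in> X"
      if "x \<in> X" "y \<in> X" "0 \<le> t" "t \<le> 1" for x y and t :: real
      unfolding X_def by (rule convex_dual_image_unit_ball[OF _ that[unfolded X_def]]) (rule \<phi>)
  next
    fix x i assume "x \<in> X" "i \<in> A"
    then have "norm (x i) \<le> dnorm S (\<phi> i)"
      using norm_le_dnorm_unit[OF \<phi>] by (auto simp: X_def)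
    also have "\<dots> \<le> (\<Sum>i\<in>A. dnorm S (\<phi> i))"
      using A \<open>i \<in> A\<close> by (intro member_le_sum dnorm_nonneg \<phi>) auto
    finally show "norm (x i) \<le> (\<Sum>i\<in>A. dnorm S (\<phi> i))" .
  qed (use far \<epsilon> zero_mem in \<open>auto simp: X_def\<close>)
  define \<Phi> where "\<Phi> = (\<lambda>f. \<Sum>i\<in>A. cnj (w i) * \<phi> i f)"
  have \<Phi>: "\<Phi> \<in> dual_sp S"
    unfolding \<Phi>_def by (intro dual_sp_sum dual_sp_cmult \<phi>)
  have "Re (\<Phi> f) \<le> b" if "f \<in> S" "supn f \<le> 1" for f
    using w(1)[of "\<lambda>i. if i \<in> A then \<phi> i f else 0"] that by (auto simp: \<Phi>_def X_def cong: sum.cong)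
  then have "dnorm S \<Phi> \<le> b"
    by (intro dnorm_least norm_le_mult_supn_if_Re_le[OF dual_spD(2)[OF \<Phi>]]) auto
  then show False
    using w(2) dominated[of "\<lambda>i. cnj (w i)"] complex_Re_le_cmod[of "\<Sum>i\<in>A. cnj (w i) * v i"]
    by (simp add: \<Phi>_def)
qed

end

subsection \<open>Bounded operators\<close>

lemma (in bcont_subspace) topspace_weak_top: "topspace (weak_top S) = S"
  unfolding weak_top_def topology_generated_by_topspace using dual_sp_zero by auto

lemma (in bcont_subspace) closedin_weak_top:
  assumes "\<phi> \<in> dual_sp S" "closed C"
  shows "closedin (weak_top S) {f\<in>S. \<phi> f \<in> C}"
proof -
  have "openin (weak_top S) (S \<inter> \<phi> -` (- C))"
    unfolding weak_top_def using assms by (intro topology_generated_by_Basis) auto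
  moreover have "S - {f\<in>S. \<phi> f \<in> C} = S \<inter> \<phi> -` (- C)"
    by auto
  ultimately show ?thesis
    by (auto simp: closedin_def topspace_weak_top)
qed

lemma (in bcont_subspace) weak_compact_pointwise_limit:
  assumes R: "compactin (weak_top S) R"
    and approx: "\<And>A \<epsilon>. finite A \<Longrightarrow> 0 < \<epsilon> \<Longrightarrow> \<exists>g\<in>R. \<forall>s\<in>A. norm (g s - v s) \<le> \<epsilon>"
  shows "v \<in> R"
proof -
  have R_S: "R \<subseteq> S"
    using compactin_subset_topspace[OF R] by (simp add: topspace_weak_top)
  define Z where "Z = (\<lambda>(s, \<epsilon>). {f\<in>S. pt_eval S s f \<in> cball (v s) \<epsilon>})"
  have Z_iff: "f \<in> Z (s, \<epsilon>) \<longleftrightarrow> norm (f s - v s) \<le> \<epsilon>" if "f \<in> R" for f s \<epsilon>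
    using that R_S by (auto simp: Z_def pt_eval_def dist_norm norm_minus_commute)
  have "R \<inter> \<Inter>\<F> \<noteq> {}" if fin: "finite \<F>" "\<F> \<subseteq> Z ` (UNIV \<times> {0<..})" for \<F>
  proof -
    obtain I where I: "finite I" "I \<subseteq> UNIV \<times> {0<..}" "\<F> = Z ` I"
      using finite_subset_image[OF fin] by blast
    define \<epsilon> where "\<epsilon> = Min (insert 1 (snd ` I))"
    have "0 < \<epsilon>"
      using I(1,2) by (auto simp: \<epsilon>_def)
    then obtain g where g: "g \<in> R" "\<And>s. s \<in> fst ` I \<Longrightarrow> norm (g s - v s) \<le> \<epsilon>"
      using approx[of "fst ` I" \<epsilon>] I(1) by auto
    have "g \<in> Z (s, e)" if "(s, e) \<in> I" for s e
    proof -
      have "\<epsilon> \<le> e" "s \<in> fst ` I"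
        using I(1) that by (auto simp: \<epsilon>_def intro!: Min_le intro: rev_image_eqI)
      then show ?thesis
        using g(2)[of s] by (simp add: Z_iff[OF g(1)])
    qed
    then have "g \<in> R \<inter> \<Inter>(Z ` I)"
      using g(1) by auto
    then show ?thesis
      unfolding I(3) by blast
  qed
  moreover have "closedin (weak_top S) C" if "C \<in> Z ` (UNIV \<times> {0<..})" for C
    using that by (auto simp: Z_def simp del: mem_cball intro!: closedin_weak_top dual_sp_pt_eval)
  ultimately have "R \<inter> \<Inter>(Z ` (UNIV \<times> {0<..})) \<noteq> {}"
    using R by (simp add: compactin_fip)
  then obtain g where g: "g \<in> R" "\<And>s \<epsilon>. 0 < \<epsilon> \<Longrightarrow> g \<in> Z (s, \<epsilon>)"
    by auto
  then have "norm (g s - v s) \<le> 0 + \<epsilon>" if "0 < \<epsilon>" for s \<epsilon>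
    using that Z_iff by simp
  then have "norm (g s - v s) \<le> 0" for s
    by (rule field_le_epsilon)
  then have "g = v"
    by (simp add: fun_eq_iff)
  then show ?thesis
    using g(1) by simp
qed

locale bcont_operator = bcont_subspace S for S :: "('x::topological_space \<Rightarrow> complex) set" +
  fixes T
  assumes bdd_clin: "bdd_clin S supn S supn T"
begin

lemmas op_mem = bdd_clinD(1)[OF bdd_clin]
  and op_add = bdd_clinD(2)[OF bdd_clin]
  and op_cmult = bdd_clinD(3)[OF bdd_clin]

lemma opnorm_bdd_above: "bdd_above ((\<lambda>f. supn (T f)) ` {f\<in>S. supn f \<le> 1})"
proof -
  obtain K where K: "\<And>f. f \<in> S \<Longrightarrow> supn (T f) \<le> K * supn f"
    using bdd_clin unfolding bdd_clin_def by blast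
  then show ?thesis
    by (intro bdd_aboveI[of _ "\<bar>K\<bar>"]) (auto intro: le_abs_on_unit_ball)
qed

lemma norm_le_opnorm:
  assumes "f \<in> S" "supn f \<le> 1"
  shows "norm (T f x) \<le> opnorm_on S T"
proof -
  have "norm (T f x) \<le> supn (T f)"
    by (intro norm_le_supn mem_bcontfun op_mem assms)
  also have "\<dots> \<le> opnorm_on S T"
    unfolding opnorm_on_def using assms by (intro cSUP_upper opnorm_bdd_above) auto
  finally show ?thesis .
qed

lemma opnorm_least: "(\<And>f x. f \<in> S \<Longrightarrow> supn f \<le> 1 \<Longrightarrow> norm (T f x) \<le> K) \<Longrightarrow> opnorm_on S T \<le> K"
  unfolding opnorm_on_def using zero_mem
  by (intro cSUP_least supn_le) (auto intro!: exI[of _ "\<lambda>x. 0"])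

lemma dual_sp_adj_pt: "adj_pt S T s \<in> dual_sp S"
  unfolding adj_pt_def by (rule dual_sp_eval[OF bdd_clin subset_bcontfun])

lemma dnorm_adj_pt_le: "dnorm S (adj_pt S T s) \<le> opnorm_on S T"
  by (rule dnorm_least) (simp add: adj_pt_def norm_le_opnorm)

lemma opnorm_approx:
  assumes "0 < e"
  obtains U where "open U" "U \<noteq> {}" "\<And>s. s \<in> U \<Longrightarrow> opnorm_on S T - e < dnorm S (adj_pt S T s)"
proof -
  have "\<not> opnorm_on S T \<le> opnorm_on S T - e"
    using assms by simp
  then obtain f x where f: "f \<in> S" "supn f \<le> 1" and x: "opnorm_on S T - e < norm (T f x)"
    using opnorm_least[of "opnorm_on S T - e"] by (meson not_le)
  define U where "U = {x. opnorm_on S T - e < norm (T f x)}"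
  show ?thesis
  proof (rule that)
    show "open U"
      using mem_bcontfun[OF op_mem[OF f(1)]] unfolding U_def
      by (intro open_Collect_less continuous_intros) (simp add: bcontfun_iff)
    show "U \<noteq> {}"
      using x by (auto simp: U_def)
    show "opnorm_on S T - e < dnorm S (adj_pt S T s)" if "s \<in> U" for s
      using that norm_le_dnorm_unit[OF dual_sp_adj_pt f, of s] f(1) by (simp add: U_def adj_pt_def)
  qed
qed

lemma bcont_operator_id_plus: "bcont_operator S (\<lambda>f x. f x + T f x)"
proof unfold_locales
  obtain K where K: "\<And>f. f \<in> S \<Longrightarrow> supn (T f) \<le> K * supn f"
    using bdd_clin unfolding bdd_clin_def by blast
  have "supn (\<lambda>x. f x + T f x) \<le> (1 + K) * supn f" if "f \<in> S" for f
  proof (rule supn_le)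
    fix x
    have "norm (f x) \<le> supn f" "norm (T f x) \<le> supn (T f)"
      by (intro norm_le_supn mem_bcontfun op_mem that)+
    then show "norm (f x + T f x) \<le> (1 + K) * supn f"
      using K[OF that] norm_triangle_ineq[of "f x" "T f x"] by (simp add: distrib_right)
  qed
  then have "\<exists>K. \<forall>f\<in>S. supn (\<lambda>x. f x + T f x) \<le> K * supn f"
    by blast
  then show "bdd_clin S supn S supn (\<lambda>f x. f x + T f x)"
    by (auto simp: bdd_clin_def op_add op_cmult distrib_left intro: add_mem op_mem)
qed

lemma opnorm_id_plus_le: "opnorm_on S (\<lambda>f x. f x + T f x) \<le> 1 + opnorm_on S T"
proof -
  interpret id_plus: bcont_operator S "\<lambda>f x. f x + T f x"
    by (rule bcont_operator_id_plus)
  have "norm (f x) \<le> 1" if "f \<in> S" "supn f \<le> 1" for f x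
    using norm_le_supn[OF mem_bcontfun[OF that(1)]] that(2) by (rule order_trans)
  then show ?thesis
    by (intro id_plus.opnorm_least order_trans[OF norm_triangle_ineq] add_mono norm_le_opnorm)
qed

lemma weakly_compact_pointwise_limit:
  assumes "weakly_compact_op S T"
    and approx: "\<And>A \<epsilon>. finite A \<Longrightarrow> 0 < \<epsilon> \<Longrightarrow> \<exists>f\<in>S. supn f \<le> 1 \<and> (\<forall>s\<in>A. norm (T f s - v s) \<le> \<epsilon>)"
  shows "v \<in> S"
proof -
  define R where "R = weak_top S closure_of (T ` {f\<in>S. supn f \<le> 1})"
  have "T ` {f\<in>S. supn f \<le> 1} \<subseteq> R"
    unfolding R_def by (rule closure_of_subset) (auto simp: topspace_weak_top op_mem)
  then have "\<exists>g\<in>R. \<forall>s\<in>A. norm (g s - v s) \<le> \<epsilon>" if "finite A" "0 < \<epsilon>" for A \<epsilon>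
    using approx[OF that] by blast
  moreover have "compactin (weak_top S) R"
    using assms(1) by (simp add: R_def weakly_compact_op_def)
  ultimately have "v \<in> R"
    by (intro weak_compact_pointwise_limit)
  then show ?thesis
    using closure_of_subset_topspace[of "weak_top S"] by (auto simp: R_def topspace_weak_top)
qed

end

subsection \<open>Operators factoring through \<open>c\<^sub>0\<close>\<close>

interpretation c0: bcont_subspace c0
proof
  show "c0 \<subseteq> bcontfun"
    by (auto simp: c0_def bcontfun_iff intro: convergent_imp_bounded continuous_on_discrete)
qed (auto simp: c0_def intro: tendsto_eq_intros)

definition truncate :: "nat \<Rightarrow> (nat \<Rightarrow> complex) \<Rightarrow> nat \<Rightarrow> complex" where
  "truncate N x n = (if n < N then x n else 0)"

lemma truncate_eq_sum: "truncate N x = (\<lambda>k. \<Sum>n<N. x n * of_bool (k = n))"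
  by (simp add: truncate_def of_bool_def if_distrib fun_eq_iff cong: if_cong)

lemma unit_vector_c0: "(\<lambda>k. of_bool (k = n)) \<in> c0"
proof -
  have "eventually (\<lambda>k. of_bool (k = n) = (0 :: complex)) sequentially"
    using eventually_gt_at_top[of n] by eventually_elim simp
  then show ?thesis
    unfolding c0_def by (simp add: tendsto_eventually)
qed

lemma truncate_c0: "truncate N x \<in> c0"
  unfolding truncate_eq_sum by (intro c0.sum_mem c0.cmult_mem unit_vector_c0)

lemma supn_diff_truncate_small:
  assumes "x \<in> c0" "0 < \<delta>"
  obtains N where "supn (\<lambda>n. x n - truncate N x n) \<le> \<delta>"
proof -
  obtain N where N: "\<And>n. N \<le> n \<Longrightarrow> norm (x n) < \<delta>"
    using assms LIMSEQ_D[of x 0] by (auto simp: c0_def)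
  then have "supn (\<lambda>n. x n - truncate N x n) \<le> \<delta>"
    using assms(2) by (intro supn_le) (auto simp: truncate_def less_imp_le not_less)
  then show ?thesis
    using that by blast
qed

lemma c0_dual_disjoint_supports:
  assumes \<Psi>: "\<Psi> \<in> dual_sp c0" and x: "x \<in> c0" "supn x \<le> 1" and z: "z \<in> c0" "supn z \<le> 1"
    and disjoint: "\<And>n. x n = 0 \<or> z n = 0"
  shows "norm (\<Psi> x) + norm (\<Psi> z) \<le> dnorm c0 \<Psi>"
proof -
  obtain c where c: "norm c = 1" "c * \<Psi> x = of_real (norm (\<Psi> x))"
    by (rule unimodular_factor)
  obtain d where d: "norm d = 1" "d * \<Psi> z = of_real (norm (\<Psi> z))"
    by (rule unimodular_factor)
  define y where "y n = c * x n + d * z n" for n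
  note y_parts = c0.cmult_mem[OF x(1), of c] c0.cmult_mem[OF z(1), of d]
  have y: "y \<in> c0"
    unfolding y_def by (rule c0.add_mem[OF y_parts])
  have "norm (y n) \<le> 1" for n
    using norm_le_supn[OF c0.mem_bcontfun[OF x(1)], of n]
      norm_le_supn[OF c0.mem_bcontfun[OF z(1)], of n]
      x(2) z(2) disjoint[of n] c(1) d(1) by (auto simp: y_def norm_mult)
  then have "norm (\<Psi> y) \<le> dnorm c0 \<Psi>"
    by (intro c0.norm_le_dnorm_unit \<Psi> y supn_le)
  moreover have "\<Psi> y = of_real (norm (\<Psi> x) + norm (\<Psi> z))"
    unfolding y_def dual_spD(1)[OF \<Psi> y_parts] by (simp add: dual_spD(2)[OF \<Psi>] x(1) z(1) c(2) d(2))
  then have "norm (\<Psi> y) = norm (\<Psi> x) + norm (\<Psi> z)"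
    by (simp only: norm_of_real abs_of_nonneg add_nonneg_nonneg norm_ge_zero)
  ultimately show ?thesis
    by simp
qed

text \<open>A finitely supported unit vector that nearly norms \<open>\<Psi>\<close> leaves little room for vectors
  supported off its support.\<close>

lemma c0_dual_tail_small:
  assumes \<Psi>: "\<Psi> \<in> dual_sp c0" and \<epsilon>: "0 < \<epsilon>"
  obtains N where "\<And>z. z \<in> c0 \<Longrightarrow> supn z \<le> 1 \<Longrightarrow> (\<And>n. n < N \<Longrightarrow> z n = 0) \<Longrightarrow> norm (\<Psi> z) \<le> \<epsilon>"
proof -
  let ?C = "dnorm c0 \<Psi>"
  have C: "0 \<le> ?C"
    by (rule c0.dnorm_nonneg[OF \<Psi>])
  have "\<not> ?C \<le> ?C - \<epsilon> / 2"
    using \<epsilon> by simp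
  then obtain x where x: "x \<in> c0" "supn x \<le> 1" "?C - \<epsilon> / 2 < norm (\<Psi> x)"
    using c0.dnorm_least[of \<Psi> "?C - \<epsilon> / 2"] by (meson not_le)
  define \<delta> where "\<delta> = \<epsilon> / (2 * (?C + 1))"
  have \<delta>: "0 < \<delta>" "?C * \<delta> \<le> \<epsilon> / 2"
    using \<epsilon> C by (auto simp: \<delta>_def field_simps)
  obtain N where N: "supn (\<lambda>n. x n - truncate N x n) \<le> \<delta>"
    using supn_diff_truncate_small[OF x(1) \<delta>(1)] .
  have "norm (\<Psi> x - \<Psi> (truncate N x)) \<le> ?C * supn (\<lambda>n. x n - truncate N x n)"
    using c0.norm_le_dnorm[OF \<Psi> c0.diff_mem[OF x(1) truncate_c0]]
    by (simp add: c0.dual_sp_diff_arg[OF \<Psi> x(1) truncate_c0])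
  also have "\<dots> \<le> \<epsilon> / 2"
    using mult_left_mono[OF N C] \<delta>(2) by simp
  finally have nearly_norming: "?C - \<epsilon> < norm (\<Psi> (truncate N x))"
    using x(3) norm_triangle_ineq2[of "\<Psi> x" "\<Psi> (truncate N x)"] by linarith
  have "norm (truncate N x n) \<le> 1" for n
    using norm_le_supn[OF c0.mem_bcontfun[OF x(1)], of n] x(2) by (simp add: truncate_def)
  then have unit: "supn (truncate N x) \<le> 1"
    by (rule supn_le)
  have "norm (\<Psi> z) \<le> \<epsilon>" if "z \<in> c0" "supn z \<le> 1" "\<And>n. n < N \<Longrightarrow> z n = 0" for z
    using c0_dual_disjoint_supports[OF \<Psi> truncate_c0 unit that(1,2)] that(3) nearly_norming
    by (force simp: truncate_def)
  then show ?thesis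
    using that by blast
qed

lemma c0_subspace_dual_coordinate_approx:
  assumes "bcont_subspace E" "E \<subseteq> c0" and \<psi>: "\<psi> \<in> dual_sp E" and \<epsilon>: "0 < \<epsilon>"
  obtains N y where "dnorm E (\<lambda>x. \<psi> x - (\<Sum>n<N. y n * pt_eval E n x)) \<le> \<epsilon>"
proof -
  interpret E: bcont_subspace E
    by fact
  obtain \<Psi>' where \<Psi>': "\<Psi>' \<in> dual_sp bcontfun" "\<And>x. x \<in> E \<Longrightarrow> \<Psi>' x = \<psi> x"
    using E.complex_hahn_banach[OF \<psi>] by metis
  define \<Psi> where "\<Psi> = (\<lambda>x. if x \<in> c0 then \<Psi>' x else 0)"
  have \<Psi>: "\<Psi> \<in> dual_sp c0"
    unfolding \<Psi>_def by (rule c0.dual_sp_restrict[OF \<Psi>'(1) c0.subset_bcontfun])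
  obtain N where N: "\<And>z. z \<in> c0 \<Longrightarrow> supn z \<le> 1 \<Longrightarrow> (\<And>n. n < N \<Longrightarrow> z n = 0) \<Longrightarrow> norm (\<Psi> z) \<le> \<epsilon>"
    using c0_dual_tail_small[OF \<Psi> \<epsilon>] by metis
  define y where "y n = \<Psi> (\<lambda>k. of_bool (k = n))" for n
  show ?thesis
  proof (rule that, rule E.dnorm_least)
    fix x assume x: "x \<in> E" "supn x \<le> 1"
    have x_c0: "x \<in> c0"
      using x(1) assms(2) by blast
    have "\<Psi> (truncate N x) = (\<Sum>n<N. y n * pt_eval E n x)"
      unfolding truncate_eq_sum
      by (subst c0.dual_sp_sum_arg[OF \<Psi>])
        (simp_all add: c0.cmult_mem unit_vector_c0 dual_spD(2)[OF \<Psi>]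
          y_def pt_eval_def x(1) mult.commute)
    then have "\<psi> x - (\<Sum>n<N. y n * pt_eval E n x) = \<Psi> (\<lambda>n. x n - truncate N x n)"
      using x(1) x_c0
      by (simp add: c0.dual_sp_diff_arg[OF \<Psi> x_c0 truncate_c0]) (simp add: \<Psi>_def \<Psi>'(2))
    also have "norm \<dots> \<le> \<epsilon>"
    proof (rule N)
      show "(\<lambda>n. x n - truncate N x n) \<in> c0"
        by (intro c0.diff_mem x_c0 truncate_c0)
      have "norm (x n - truncate N x n) \<le> 1" for n
        using norm_le_supn[OF c0.mem_bcontfun[OF x_c0], of n] x(2) by (simp add: truncate_def)
      then show "supn (\<lambda>n. x n - truncate N x n) \<le> 1"
        by (rule supn_le)
    qed (simp add: truncate_def)
    finally show "norm (\<psi> x - (\<Sum>n<N. y n * pt_eval E n x)) \<le> \<epsilon>" .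
  qed
qed

lemma (in bcont_operator) factors_c0_adj_pt_approx:
  assumes "factors_c0 S T"
  obtains \<xi> :: "nat \<Rightarrow> ('x \<Rightarrow> complex) \<Rightarrow> complex" where "\<And>n. \<xi> n \<in> dual_sp S"
    "\<And>s e. 0 < e \<Longrightarrow> \<exists>N y. dnorm S (\<lambda>f. adj_pt S T s f - (\<Sum>n<N. y n * \<xi> n f)) \<le> e"
proof -
  obtain E T1 T2 where E: "closed_subspace_c0 E" and T1: "bdd_clin S supn E supn T1"
    and T2: "bdd_clin E supn S supn T2" and T_eq: "\<And>f. f \<in> S \<Longrightarrow> T f = T2 (T1 f)"
    using assms unfolding factors_c0_def by blast
  have E_c0: "E \<subseteq> c0"
    using E by (simp add: closed_subspace_c0_def)
  interpret E: bcont_subspace E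
    using E c0.subset_bcontfun by unfold_locales (auto simp: closed_subspace_c0_def)
  obtain K where K: "\<And>f. f \<in> S \<Longrightarrow> supn (T1 f) \<le> K * supn f"
    using T1 unfolding bdd_clin_def by blast
  define \<xi> where "\<xi> n f = (if f \<in> S then T1 f n else 0)" for n f
  show ?thesis
  proof (rule that)
    show "\<xi> n \<in> dual_sp S" for n
      unfolding \<xi>_def by (rule dual_sp_eval[OF T1 E.subset_bcontfun])
  next
    fix s and e :: real assume e: "0 < e"
    define \<psi> where "\<psi> = (\<lambda>x. if x \<in> E then T2 x s else 0)"
    have \<psi>: "\<psi> \<in> dual_sp E"
      unfolding \<psi>_def by (rule E.dual_sp_eval[OF T2 subset_bcontfun])
    define \<epsilon> where "\<epsilon> = e / (\<bar>K\<bar> + 1)"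
    have \<epsilon>: "0 < \<epsilon>" "\<epsilon> * \<bar>K\<bar> \<le> e"
      using e by (auto simp: \<epsilon>_def field_simps add_pos_nonneg)
    obtain N y where y: "dnorm E (\<lambda>x. \<psi> x - (\<Sum>n<N. y n * pt_eval E n x)) \<le> \<epsilon>" (is "dnorm E ?\<rho> \<le> _")
      using c0_subspace_dual_coordinate_approx[OF E.bcont_subspace_axioms E_c0 \<psi> \<epsilon>(1)] by metis
    have \<rho>: "?\<rho> \<in> dual_sp E"
      by (intro E.dual_sp_diff \<psi> E.dual_sp_sum E.dual_sp_cmult E.dual_sp_pt_eval)
    have "dnorm S (\<lambda>f. adj_pt S T s f - (\<Sum>n<N. y n * \<xi> n f)) = dnorm S (\<lambda>f. ?\<rho> (T1 f))"
      by (rule dnorm_cong) (simp add: adj_pt_def \<xi>_def pt_eval_def \<psi>_def T_eq bdd_clinD(1)[OF T1])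
    also have "\<dots> \<le> dnorm E ?\<rho> * \<bar>K\<bar>"
      by (rule dnorm_compose_le[OF E.bcont_subspace_axioms \<rho> bdd_clinD(1)[OF T1] K])
    also have "\<dots> \<le> \<epsilon> * \<bar>K\<bar>"
      using y by (intro mult_right_mono) auto
    finally show "\<exists>N y. dnorm S (\<lambda>f. adj_pt S T s f - (\<Sum>n<N. y n * \<xi> n f)) \<le> e"
      using \<epsilon>(2) by (meson order_trans)
  qed
qed

section \<open>The Riesz--Markov theorem\<close>

definition subordinate :: "'g::topological_space set \<Rightarrow> ('g \<Rightarrow> real) set" where
  "subordinate U = {f. continuous_on UNIV f \<and> (\<forall>x. 0 \<le> f x \<and> f x \<le> 1) \<and> (\<forall>x. x \<notin> U \<longrightarrow> f x = 0)}"

lemma subordinateD: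
  assumes "f \<in> subordinate U"
  shows "continuous_on UNIV f" "0 \<le> f x" "f x \<le> 1" "x \<notin> U \<Longrightarrow> f x = 0"
  using assms by (auto simp: subordinate_def)

lemma subordinateI:
  assumes "continuous_on UNIV f" "\<And>x. 0 \<le> f x" "\<And>x. f x \<le> 1" "\<And>x. x \<notin> U \<Longrightarrow> f x = 0"
  shows "f \<in> subordinate U"
  using assms by (simp add: subordinate_def)

lemma subordinate_mono: "U \<subseteq> V \<Longrightarrow> subordinate U \<subseteq> subordinate V"
  by (auto simp: subordinate_def)

lemma zero_subordinate: "(\<lambda>x. 0) \<in> subordinate U"
  by (simp add: subordinate_def)

lemma urysohn_subordinate:
  fixes K U :: "'g::t2_space set"
  assumes "compact (UNIV :: 'g set)" "closed K" "open U" "K \<subseteq> U"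
  obtains u where "u \<in> subordinate U" "\<And>x. x \<in> K \<Longrightarrow> u x = 1"
proof -
  have "normal_space (euclidean :: 'g topology)"
    using assms(1) separation_t2
    by (intro compact_Hausdorff_or_regular_imp_normal_space disjI1)
      (auto simp: compact_space_def Hausdorff_space_def disjnt_def)
  then obtain u where u: "continuous_map euclidean (top_of_set {0..1::real}) u"
    "u ` (- U) \<subseteq> {0}" "u ` K \<subseteq> {1}"
    using Urysohn_lemma[of "euclidean :: 'g topology" "- U" K 0 1] assms
    by (auto simp: disjnt_def closed_Compl)
  then have "u \<in> subordinate U"
    by (auto simp: subordinate_def continuous_map_in_subtopology)
  then show ?thesis
    using u(3) that by blast
qed

lemma radonD:
  assumes "radon M"
  shows "sets M = sets borel" "finite_measure M" "space M = UNIV"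
  using assms sets_eq_imp_space_eq[of M borel] by (auto simp: radon_def)

lemma radon_borel_measurable:
  assumes "radon M" "continuous_on UNIV f"
  shows "f \<in> borel_measurable M"
  using borel_measurable_continuous_onI[OF assms(2)]
  by (simp add: measurable_cong_sets[OF radonD(1)[OF assms(1)] refl])

lemma radon_integrable:
  fixes f :: "'g::topological_space \<Rightarrow> 'b::{banach, second_countable_topology}"
  assumes "compact (UNIV :: 'g set)" "radon M" "continuous_on UNIV f"
  shows "integrable M f"
proof -
  interpret finite_measure M
    by (rule radonD[OF assms(2)])
  obtain B where "\<And>x. norm (f x) \<le> B"
    using compact_imp_bounded[OF compact_continuous_image[OF assms(3,1)]]
    by (auto simp: bounded_iff)
  then show ?thesis
    by (intro integrable_const_bound[of _ B] radon_borel_measurable assms) auto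
qed

lemma radon_if_outer_regular:
  fixes M :: "'g::t2_space measure"
  assumes compact_UNIV: "compact (UNIV :: 'g set)"
    and sets: "sets M = sets borel" and "finite_measure M"
    and outer_regular: "\<And>A. A \<in> sets borel \<Longrightarrow>
      emeasure M A = (INF U\<in>{U. open U \<and> A \<subseteq> U}. emeasure M U)"
  shows "radon M"
proof -
  interpret finite_measure M by fact
  have "emeasure M A = (SUP K\<in>{K. compact K \<and> K \<subseteq> A}. emeasure M K)" (is "_ = ?inner")
    if A: "A \<in> sets borel" for A
  proof (rule antisym)
    show "?inner \<le> emeasure M A"
      using A sets by (intro SUP_least emeasure_mono) auto
    show "emeasure M A \<le> ?inner"
    proof (rule ennreal_le_epsilon)
      fix e :: real assume "0 < e"
      then obtain U where U: "open U" "- A \<subseteq> U" "emeasure M U < emeasure M (- A) + ennreal e"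
        using INF_approx_ennreal[OF _ outer_regular[of "- A"]] A emeasure_finite by auto
      have "compact (- U)"
        using compact_UNIV U(1) compact_Int_closed[of UNIV "- U"] by (simp add: closed_Compl)
      then have compl_le: "emeasure M (- U) \<le> ?inner"
        using U(2) by (intro SUP_upper) auto
      have "emeasure M (- A) + emeasure M (A \<inter> U) = emeasure M U"
        using A U sets by (subst plus_emeasure) (auto intro!: arg_cong[of _ _ "emeasure M"])
      then have "emeasure M (- A) + emeasure M (A \<inter> U) \<le> emeasure M (- A) + ennreal e"
        using U(3) by simp
      then have "emeasure M (A \<inter> U) \<le> ennreal e"
        by (simp add: ennreal_add_left_cancel_le emeasure_finite)
      moreover have "emeasure M A = emeasure M (- U) + emeasure M (A \<inter> U)"
        using A U sets by (subst plus_emeasure) (auto intro!: arg_cong[of _ _ "emeasure M"])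
      ultimately show "emeasure M A \<le> ?inner + ennreal e"
        using compl_le by (simp add: add_mono)
    qed
  qed
  then show ?thesis
    using sets \<open>finite_measure M\<close> outer_regular unfolding radon_def by blast
qed

locale real_functional =
  fixes P :: "('g::t2_space \<Rightarrow> real) \<Rightarrow> real"
  assumes compact_UNIV: "compact (UNIV :: 'g set)"
    and functional_add: "continuous_on UNIV f \<Longrightarrow> continuous_on UNIV g \<Longrightarrow>
      P (\<lambda>x. f x + g x) = P f + P g"
    and functional_cmult: "continuous_on UNIV f \<Longrightarrow> P (\<lambda>x. c * f x) = c * P f"
begin

lemma functional_diff:
  "continuous_on UNIV f \<Longrightarrow> continuous_on UNIV g \<Longrightarrow> P (\<lambda>x. f x - g x) = P f - P g"
  using functional_add[of f "\<lambda>x. -1 * g x"] functional_cmult[of g "-1"]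
  by (auto intro: continuous_intros)

lemma functional_zero: "P (\<lambda>x. 0) = 0"
  using functional_cmult[of "\<lambda>x. 0" 0] by simp

lemma functional_sum:
  "(\<And>i. i \<in> I \<Longrightarrow> continuous_on UNIV (f i)) \<Longrightarrow> P (\<lambda>x. \<Sum>i\<in>I. f i x) = (\<Sum>i\<in>I. P (f i))"
  by (induction I rule: infinite_finite_induct)
    (simp_all add: functional_zero functional_add continuous_on_sum)

end

locale positive_functional = real_functional P for P :: "('g::t2_space \<Rightarrow> real) \<Rightarrow> real" +
  assumes functional_nonneg: "continuous_on UNIV f \<Longrightarrow> (\<And>x. 0 \<le> f x) \<Longrightarrow> 0 \<le> P f"
begin

lemma functional_mono:
  "continuous_on UNIV f \<Longrightarrow> continuous_on UNIV g \<Longrightarrow> (\<And>x. f x \<le> g x) \<Longrightarrow> P f \<le> P g"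
  using functional_nonneg[of "\<lambda>x. g x - f x"] functional_diff[of g f]
  by (auto intro: continuous_intros)

lemma subordinate_nonneg: "f \<in> subordinate U \<Longrightarrow> 0 \<le> P f"
  by (intro functional_nonneg subordinateD)

subsection \<open>The outer measure of a positive functional\<close>

definition open_content :: "'g set \<Rightarrow> ennreal" where
  "open_content U = (SUP f\<in>subordinate U. ennreal (P f))"

definition outer :: "'g set \<Rightarrow> ennreal" where
  "outer A = (INF U\<in>{U. open U \<and> A \<subseteq> U}. open_content U)"

lemma open_content_upper: "f \<in> subordinate U \<Longrightarrow> ennreal (P f) \<le> open_content U"
  unfolding open_content_def by (rule SUP_upper)

lemma open_content_mono: "U \<subseteq> V \<Longrightarrow> open_content U \<le> open_content V"
  unfolding open_content_def by (intro SUP_subset_mono subordinate_mono order_refl)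

lemma open_content_empty: "open_content {} = 0"
proof -
  have "subordinate {} = {\<lambda>x::'g. 0}"
    by (auto simp: subordinate_def)
  then show ?thesis
    by (simp add: open_content_def functional_zero)
qed

lemma open_content_UNIV: "open_content UNIV = ennreal (P (\<lambda>x. 1))"
proof (rule antisym)
  show "open_content UNIV \<le> ennreal (P (\<lambda>x. 1))"
    unfolding open_content_def
    by (intro SUP_least ennreal_leI functional_mono) (auto simp: subordinate_def)
  show "ennreal (P (\<lambda>x. 1)) \<le> open_content UNIV"
    by (intro open_content_upper subordinateI) auto
qed

lemma outer_open: "open U \<Longrightarrow> outer U = open_content U"
  unfolding outer_def by (rule antisym) (auto intro: INF_lower INF_greatest open_content_mono)

lemma outer_mono: "A \<subseteq> B \<Longrightarrow> outer A \<le> outer B"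
  unfolding outer_def by (rule INF_superset_mono) auto

lemma outer_less_top: "outer A < top"
  using outer_mono[of A UNIV] open_content_UNIV by (simp add: outer_open order.strict_trans1)

lemma outer_approx:
  assumes "0 < e"
  shows "\<exists>U. open U \<and> A \<subseteq> U \<and> open_content U < outer A + ennreal e"
  using INF_approx_ennreal[OF assms outer_def[of A]] outer_less_top[of A] by auto

text \<open>The truncation \<open>max (f - d) 0\<close> lowers \<open>P f\<close> by at most \<open>d * P 1\<close> and is carried by the
  closed set \<open>{f \<ge> d}\<close> inside \<open>U\<close>.\<close>

lemma subordinate_closed_support:
  assumes f: "f \<in> subordinate U" and e: "0 < e"
  obtains g K where "g \<in> subordinate K" "closed K" "K \<subseteq> U"
    "ennreal (P f) \<le> ennreal (P g) + ennreal e"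
proof -
  define d where "d = e / (P (\<lambda>x. 1) + 1)"
  have "0 \<le> P (\<lambda>x. 1)"
    by (rule functional_nonneg) auto
  then have d: "0 < d" "d * P (\<lambda>x. 1) \<le> e"
    using e by (auto simp: d_def field_simps)
  define g where "g x = max (f x - d) 0" for x
  note cont_f = subordinateD(1)[OF f]
  have cont_g: "continuous_on UNIV g"
    unfolding g_def by (intro continuous_intros cont_f)
  have g: "g \<in> subordinate {x. d \<le> f x}"
  proof (rule subordinateI[OF cont_g])
    show "0 \<le> g x" "g x \<le> 1" "x \<notin> {x. d \<le> f x} \<Longrightarrow> g x = 0" for x
      using subordinateD(3)[OF f, of x] d(1) by (auto simp: g_def)
  qed
  have "P f \<le> P (\<lambda>x. g x + d * 1)"
    using cont_f cont_g by (intro functional_mono continuous_intros) (auto simp: g_def)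
  also have "\<dots> = P g + d * P (\<lambda>x. 1)"
    using functional_add[OF cont_g, of "\<lambda>x. d * 1"] functional_cmult[of "\<lambda>x. 1" d] by simp
  finally have "ennreal (P f) \<le> ennreal (P g) + ennreal e"
    using d(2) e subordinate_nonneg[OF g]
    by (simp add: ennreal_plus[symmetric] ennreal_leI del: ennreal_plus)
  moreover have "closed {x. d \<le> f x}"
    using cont_f by (intro closed_Collect_le) auto
  moreover have "{x. d \<le> f x} \<subseteq> U"
    using subordinateD(4)[OF f] d(1) by (force simp: not_le)
  ultimately show ?thesis
    using g that by blast
qed

lemma open_content_Un_le:
  assumes "open U" "open V"
  shows "open_content (U \<union> V) \<le> open_content U + open_content V"
  unfolding open_content_def[of "U \<union> V"]
proof (rule SUP_least, rule ennreal_le_epsilon)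
  fix f and e :: real assume "f \<in> subordinate (U \<union> V)" "0 < e"
  then obtain g K where g: "g \<in> subordinate K" and K: "closed K" "K \<subseteq> U \<union> V"
    and fg: "ennreal (P f) \<le> ennreal (P g) + ennreal e"
    by (rule subordinate_closed_support)
  obtain u where u: "u \<in> subordinate U" "\<And>x. x \<in> K - V \<Longrightarrow> u x = 1"
    using urysohn_subordinate[of "K - V" U] compact_UNIV K assms by (auto simp: closed_Diff)
  have cont: "continuous_on UNIV (\<lambda>x. g x * u x)" "continuous_on UNIV (\<lambda>x. g x * (1 - u x))"
    by (intro continuous_intros subordinateD(1)[OF g] subordinateD(1)[OF u(1)])+
  have gu: "(\<lambda>x. g x * u x) \<in> subordinate U"
    using cont subordinateD[OF g] subordinateD[OF u(1)]
    by (intro subordinateI) (auto intro: mult_le_one)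
  have "g x * (1 - u x) = 0" if "x \<notin> V" for x
    using that subordinateD(4)[OF g, of x] u(2)[of x] by (cases "x \<in> K") auto
  then have gu': "(\<lambda>x. g x * (1 - u x)) \<in> subordinate V"
    using cont subordinateD[OF g] subordinateD[OF u(1)]
    by (intro subordinateI) (auto intro: mult_le_one)
  have "P g = P (\<lambda>x. g x * u x) + P (\<lambda>x. g x * (1 - u x))"
    using functional_add[OF cont] by (simp add: algebra_simps)
  then have "ennreal (P g) = ennreal (P (\<lambda>x. g x * u x)) + ennreal (P (\<lambda>x. g x * (1 - u x)))"
    using subordinate_nonneg[OF gu] subordinate_nonneg[OF gu'] by simp
  also have "\<dots> \<le> open_content U + open_content V"
    by (intro add_mono open_content_upper gu gu')
  finally show "ennreal (P f) \<le> open_content U + open_content V + ennreal e"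
    using fg by (meson add_right_mono order_trans)
qed

lemma open_content_finite_UN_le:
  "finite I \<Longrightarrow> (\<And>i. i \<in> I \<Longrightarrow> open (U i)) \<Longrightarrow>
    open_content (\<Union>i\<in>I. U i) \<le> (\<Sum>i\<in>I. open_content (U i))"
proof (induction I rule: finite_induct)
  case (insert i I)
  then have "open_content (\<Union>i\<in>insert i I. U i) \<le> open_content (U i) + open_content (\<Union>i\<in>I. U i)"
    using open_content_Un_le[of "U i" "\<Union>i\<in>I. U i"] by auto
  also have "\<dots> \<le> open_content (U i) + (\<Sum>i\<in>I. open_content (U i))"
    using insert by (intro add_left_mono) auto
  finally show ?case
    using insert by simp
qed (simp add: open_content_empty)

lemma open_content_UN_le:
  fixes U :: "nat \<Rightarrow> 'g set"
  assumes op: "\<And>i. open (U i)"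
  shows "open_content (\<Union>i. U i) \<le> (\<Sum>i. open_content (U i))"
  unfolding open_content_def[of "\<Union>i. U i"]
proof (rule SUP_least, rule ennreal_le_epsilon)
  fix f and e :: real assume "f \<in> subordinate (\<Union>i. U i)" "0 < e"
  then obtain g K where g: "g \<in> subordinate K" and K: "closed K" "K \<subseteq> (\<Union>i. U i)"
    and fg: "ennreal (P f) \<le> ennreal (P g) + ennreal e"
    by (rule subordinate_closed_support)
  have "compact K"
    using compact_UNIV K(1) compact_Int_closed[of UNIV K] by simp
  then obtain I where I: "finite I" "K \<subseteq> (\<Union>i\<in>I. U i)"
    using compactE_image[of K UNIV U] K(2) op by metis
  then have "g \<in> subordinate (\<Union>i\<in>I. U i)"
    using g subordinate_mono by blast
  then have "ennreal (P g) \<le> (\<Sum>i\<in>I. open_content (U i))"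
    by (rule order_trans[OF open_content_upper open_content_finite_UN_le[OF I(1) op]])
  also have "\<dots> \<le> (\<Sum>i. open_content (U i))"
    by (rule sum_le_suminf) (use I in auto)
  finally show "ennreal (P f) \<le> (\<Sum>i. open_content (U i)) + ennreal e"
    using fg by (meson add_right_mono order_trans)
qed

lemma outer_UN_le: "outer (\<Union>i::nat. A i) \<le> (\<Sum>i. outer (A i))"
proof (rule ennreal_le_epsilon)
  fix e :: real assume e: "0 < e"
  have "\<exists>U. open U \<and> A i \<subseteq> U \<and> open_content U < outer (A i) + ennreal (e * (1/2) ^ Suc i)" for i
    using e by (intro outer_approx) auto
  then obtain U where U: "\<And>i. open (U i)" "\<And>i. A i \<subseteq> U i"
    "\<And>i. open_content (U i) < outer (A i) + ennreal (e * (1/2) ^ Suc i)"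
    by metis
  have "outer (\<Union>i. A i) \<le> outer (\<Union>i. U i)"
    using U by (intro outer_mono) auto
  also have "\<dots> \<le> (\<Sum>i. open_content (U i))"
    using open_content_UN_le U by (simp add: outer_open open_UN)
  also have "\<dots> \<le> (\<Sum>i. outer (A i) + ennreal (e * (1/2) ^ Suc i))"
    using U by (intro suminf_le less_imp_le) auto
  also have "\<dots> = (\<Sum>i. outer (A i)) + (\<Sum>i. ennreal (e * (1/2) ^ Suc i))"
    by (rule suminf_add[symmetric]) auto
  also have "(\<Sum>i. ennreal (e * (1/2) ^ Suc i)) = ennreal e"
    using sums_mult[OF power_half_series, of e] e by (intro suminf_ennreal_eq) auto
  finally show "outer (\<Union>i. A i) \<le> (\<Sum>i. outer (A i)) + ennreal e" .
qed

lemma outer_empty: "outer {} = 0"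
  by (simp add: outer_open open_content_empty)

lemma outer_Un_le: "outer (A \<union> B) \<le> outer A + outer B"
proof -
  have "(\<Sum>i. outer (binaryset A B i)) = outer A + outer B"
    using sums_finite[of "{..<2}" "\<lambda>i. outer (binaryset A B i)"]
    by (simp add: binaryset_def outer_empty sums_iff numeral_2_eq_2)
  then show ?thesis
    using outer_UN_le[of "binaryset A B"] by (simp add: UN_binaryset_eq)
qed

lemma outer_measure_space_outer: "outer_measure_space (Pow UNIV) outer"
  unfolding outer_measure_space_def
  by (auto simp: positive_def increasing_def countably_subadditive_def
      outer_empty outer_mono outer_UN_le)

lemma open_content_Diff_closed:
  assumes g: "g \<in> subordinate K" and K: "K \<subseteq> W"
  shows "ennreal (P g) + open_content (W - K) \<le> open_content W"
proof -
  have "ennreal (P g) + ennreal (P h) \<le> open_content W" if h: "h \<in> subordinate (W - K)" for h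
  proof -
    have "g x + h x \<le> 1 \<and> (x \<notin> W \<longrightarrow> g x + h x = 0)" for x
      using K subordinateD(3,4)[OF g, of x] subordinateD(3,4)[OF h, of x] by (cases "x \<in> K") auto
    then have "(\<lambda>x. g x + h x) \<in> subordinate W"
      using subordinateD[OF g] subordinateD[OF h] by (intro subordinateI continuous_intros) auto
    then have "ennreal (P g + P h) \<le> open_content W"
      using open_content_upper[of "\<lambda>x. g x + h x" W]
        functional_add[OF subordinateD(1)[OF g] subordinateD(1)[OF h]]
      by simp
    then show ?thesis
      using subordinate_nonneg[OF g] subordinate_nonneg[OF h] by simp
  qed
  then have "(SUP h\<in>subordinate (W - K). ennreal (P g) + ennreal (P h)) \<le> open_content W"
    by (rule SUP_least)
  moreover have "(SUP h\<in>subordinate (W - K). ennreal (P g) + ennreal (P h))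
      = ennreal (P g) + open_content (W - K)"
    unfolding open_content_def using zero_subordinate
    by (intro ennreal_SUP_add_right[symmetric]) auto
  ultimately show ?thesis
    by simp
qed

lemma open_content_Int_outer_Diff_le:
  assumes "open W" "open U"
  shows "open_content (W \<inter> U) + outer (W - U) \<le> open_content W"
proof -
  have "ennreal (P f) + outer (W - U) \<le> open_content W" if f: "f \<in> subordinate (W \<inter> U)" for f
  proof (rule ennreal_le_epsilon)
    fix e :: real assume "0 < e"
    with f obtain g K where g: "g \<in> subordinate K" and K: "closed K" "K \<subseteq> W \<inter> U"
      and fg: "ennreal (P f) \<le> ennreal (P g) + ennreal e"
      by (rule subordinate_closed_support)
    have "outer (W - U) \<le> outer (W - K)"
      using K by (intro outer_mono) auto
    also have "\<dots> = open_content (W - K)"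
      using assms(1) K by (intro outer_open open_Diff)
    finally have "ennreal (P f) + outer (W - U) \<le> (ennreal (P g) + ennreal e) + open_content (W - K)"
      using fg by (rule add_mono[rotated])
    also have "\<dots> = (ennreal (P g) + open_content (W - K)) + ennreal e"
      by (simp add: ac_simps)
    also have "\<dots> \<le> open_content W + ennreal e"
      using open_content_Diff_closed[OF g] K(2) by (intro add_right_mono) auto
    finally show "ennreal (P f) + outer (W - U) \<le> open_content W + ennreal e" .
  qed
  then have "(SUP f\<in>subordinate (W \<inter> U). ennreal (P f) + outer (W - U)) \<le> open_content W"
    by (rule SUP_least)
  moreover have "(SUP f\<in>subordinate (W \<inter> U). ennreal (P f) + outer (W - U))
      = open_content (W \<inter> U) + outer (W - U)"
    unfolding open_content_def using zero_subordinate by (intro ennreal_SUP_add_left) auto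
  ultimately show ?thesis
    by simp
qed

lemma open_lambda_system:
  assumes U: "open U"
  shows "U \<in> lambda_system UNIV (Pow UNIV) outer"
proof -
  have "outer (U \<inter> X) + outer ((UNIV - U) \<inter> X) \<le> outer X" for X
    unfolding outer_def[of X]
  proof (rule INF_greatest)
    fix W assume "W \<in> {W. open W \<and> X \<subseteq> W}"
    then have W: "open W" "X \<subseteq> W"
      by auto
    have "outer (U \<inter> X) + outer ((UNIV - U) \<inter> X) \<le> outer (W \<inter> U) + outer (W - U)"
      using W by (intro add_mono outer_mono) auto
    also have "\<dots> \<le> open_content W"
      using open_content_Int_outer_Diff_le[OF W(1) U] W(1) U by (simp add: outer_open open_Int)
    finally show "outer (U \<inter> X) + outer ((UNIV - U) \<inter> X) \<le> open_content W" .
  qed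
  moreover have "outer X \<le> outer (U \<inter> X) + outer ((UNIV - U) \<inter> X)" for X
    using outer_Un_le[of "U \<inter> X" "(UNIV - U) \<inter> X"] by (simp add: Un_Diff Int_Un_distrib2[symmetric])
  ultimately show ?thesis
    by (auto simp: lambda_system_def intro!: antisym)
qed

subsection \<open>The representing measure\<close>

definition riesz_measure :: "'g measure" where
  "riesz_measure = measure_of UNIV (sets borel) outer"

lemma sets_riesz_measure [simp, measurable_cong]: "sets riesz_measure = sets borel"
  and space_riesz_measure [simp]: "space riesz_measure = UNIV"
  using sets.sigma_sets_eq[of "borel :: 'g measure"] by (auto simp: riesz_measure_def)

lemma emeasure_riesz_measure:
  assumes "A \<in> sets borel"
  shows "emeasure riesz_measure A = outer A"
proof -
  let ?L = "lambda_system UNIV (Pow UNIV) outer"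
  have L: "measure_space UNIV ?L outer"
    by (rule sigma_algebra.caratheodory_lemma[OF sigma_algebra_Pow outer_measure_space_outer])
  then have "sigma_algebra UNIV ?L"
    by (simp add: measure_space_def)
  then have "sets (borel :: 'g measure) \<subseteq> ?L"
    using sigma_algebra.sigma_sets_subset[of UNIV ?L "Collect open"] open_lambda_system
    by (auto simp: borel_def)
  then have "positive (sets borel) outer" "countably_additive (sets borel) outer"
    using L unfolding measure_space_def positive_def countably_additive_def by blast+
  then show ?thesis
    using assms by (intro emeasure_measure_of[OF riesz_measure_def]) auto
qed

lemma radon_riesz_measure: "radon riesz_measure"
proof (rule radon_if_outer_regular[OF compact_UNIV sets_riesz_measure])
  show "finite_measure riesz_measure"
    by (rule finite_measureI) (use outer_less_top[of UNIV] in \<open>auto simp: emeasure_riesz_measure\<close>)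
  show "emeasure riesz_measure A = (INF U\<in>{U. open U \<and> A \<subseteq> U}. emeasure riesz_measure U)"
    if "A \<in> sets borel" for A
    using that by (simp add: emeasure_riesz_measure outer_open) (simp add: outer_def)
qed

lemma finite_measure_riesz_measure: "finite_measure riesz_measure"
  by (rule radonD[OF radon_riesz_measure])

lemma measure_riesz_measure_UNIV: "measure riesz_measure UNIV = P (\<lambda>x. 1)"
  using functional_nonneg[of "\<lambda>x. 1"]
  by (simp add: measure_def emeasure_riesz_measure outer_open open_content_UNIV)

lemma subordinate_le_measure:
  assumes "open U" "f \<in> subordinate U"
  shows "P f \<le> measure riesz_measure U"
proof -
  interpret finite_measure riesz_measure
    by (rule finite_measure_riesz_measure)
  have "ennreal (P f) \<le> ennreal (measure riesz_measure U)"
    using open_content_upper[OF assms(2)] assms(1)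
    by (simp add: outer_open[symmetric] emeasure_riesz_measure[symmetric] emeasure_eq_measure)
  then show ?thesis
    by simp
qed

definition slice :: "('g \<Rightarrow> real) \<Rightarrow> nat \<Rightarrow> 'g \<Rightarrow> real" where
  "slice f k x = max 0 (min 1 (f x - real k))"

lemma slice_subordinate: "continuous_on UNIV f \<Longrightarrow> slice f k \<in> subordinate {x. real k < f x}"
  unfolding slice_def by (intro subordinateI continuous_intros) auto

lemma sum_slice:
  assumes "0 \<le> f x"
  shows "(\<Sum>k<n. slice f k x) = min (f x) (real n)"
  using assms by (induction n) (auto simp: slice_def)

lemma measure_le_integral_slice:
  assumes "continuous_on UNIV f"
  shows "measure riesz_measure {x. real (Suc k) < f x} \<le> (\<integral>x. slice f k x \<partial>riesz_measure)"
proof -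
  interpret finite_measure riesz_measure
    by (rule finite_measure_riesz_measure)
  have "open {x. real (Suc k) < f x}"
    using assms by (intro open_Collect_less) auto
  then have "(\<integral>x. indicator {x. real (Suc k) < f x} x \<partial>riesz_measure)
      \<le> (\<integral>x. slice f k x \<partial>riesz_measure)"
    by (intro integral_mono integrable_real_indicator
        radon_integrable[OF compact_UNIV radon_riesz_measure]
        subordinateD(1)[OF slice_subordinate[OF assms]])
      (auto simp: slice_def indicator_def less_top[symmetric])
  then show ?thesis
    by simp
qed

lemma functional_le_integral_plus:
  assumes f: "continuous_on UNIV f" "\<And>x. 0 \<le> f x" "\<And>x. f x \<le> real n"
  shows "P f \<le> (\<integral>x. f x \<partial>riesz_measure) + measure riesz_measure UNIV"
proof -
  interpret finite_measure riesz_measure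
    by (rule finite_measure_riesz_measure)
  define a where "a k = measure riesz_measure {x. real k < f x}" for k
  have op: "open {x. real k < f x}" for k
    using f(1) by (intro open_Collect_less) auto
  have f_eq: "f = (\<lambda>x. \<Sum>k<n. slice f k x)"
    using f by (simp add: fun_eq_iff sum_slice)
  note slice = slice_subordinate[OF f(1)]
  have "P f = (\<Sum>k<n. P (slice f k))"
    by (subst f_eq) (intro functional_sum subordinateD(1)[OF slice])
  also have "\<dots> \<le> (\<Sum>k<n. a k)"
    unfolding a_def by (intro sum_mono subordinate_le_measure op slice)
  also have "\<dots> = (\<Sum>k<n. a (Suc k)) + (a 0 - a n)"
    using sum_lessThan_telescope'[of a n] by (simp add: sum_subtractf)
  also have "\<dots> \<le> (\<integral>x. f x \<partial>riesz_measure) + measure riesz_measure UNIV"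
  proof (rule add_mono)
    have int: "integrable riesz_measure (slice f k)" for k
      by (rule radon_integrable[OF compact_UNIV radon_riesz_measure subordinateD(1)[OF slice]])
    have "a (Suc k) \<le> (\<integral>x. slice f k x \<partial>riesz_measure)" for k
      unfolding a_def by (rule measure_le_integral_slice[OF f(1)])
    then have "(\<Sum>k<n. a (Suc k)) \<le> (\<Sum>k<n. \<integral>x. slice f k x \<partial>riesz_measure)"
      by (intro sum_mono)
    also have "\<dots> = (\<integral>x. (\<Sum>k<n. slice f k x) \<partial>riesz_measure)"
      by (rule Bochner_Integration.integral_sum[symmetric]) (rule int)
    finally show "(\<Sum>k<n. a (Suc k)) \<le> (\<integral>x. f x \<partial>riesz_measure)"
      by (simp only: f_eq[symmetric])
    show "a 0 - a n \<le> measure riesz_measure UNIV"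
      using bounded_measure[of "{x. real 0 < f x}"] by (simp add: a_def add_increasing2 diff_le_eq)
  qed
  finally show ?thesis .
qed

lemma functional_le_integral:
  assumes f: "continuous_on UNIV f" "\<And>x. 0 \<le> f x" "\<And>x. f x \<le> 1"
  shows "P f \<le> (\<integral>x. f x \<partial>riesz_measure)"
proof -
  have "P f \<le> (\<integral>x. f x \<partial>riesz_measure) + measure riesz_measure UNIV / real (Suc n)" for n
  proof -
    have "P (\<lambda>x. real (Suc n) * f x)
        \<le> (\<integral>x. real (Suc n) * f x \<partial>riesz_measure) + measure riesz_measure UNIV"
      using f
      by (intro functional_le_integral_plus[of _ "Suc n"] continuous_intros mult_nonneg_nonneg)
        (auto simp: mult_left_le simp del: of_nat_Suc)
    then have "real (Suc n) * (P f - (\<integral>x. f x \<partial>riesz_measure)) \<le> measure riesz_measure UNIV"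
      using functional_cmult[OF f(1)] by (simp add: right_diff_distrib del: of_nat_Suc)
    then show ?thesis
      by (simp add: field_simps del: of_nat_Suc)
  qed
  moreover have "(\<lambda>n. (\<integral>x. f x \<partial>riesz_measure) + measure riesz_measure UNIV / real (Suc n))
      \<longlonglongrightarrow> (\<integral>x. f x \<partial>riesz_measure) + 0"
    by (intro tendsto_intros LIMSEQ_Suc[OF lim_const_over_n])
  ultimately show ?thesis
    by (intro LIMSEQ_le_const) (auto simp del: of_nat_Suc)
qed

lemma integral_riesz_measure:
  assumes f: "continuous_on UNIV f"
  shows "(\<integral>x. f x \<partial>riesz_measure) = P f"
proof -
  interpret finite_measure riesz_measure
    by (rule finite_measure_riesz_measure)
  have unit: "(\<integral>x. g x \<partial>riesz_measure) = P g"
    if g: "continuous_on UNIV g" "\<And>x. 0 \<le> g x" "\<And>x. g x \<le> 1" for g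
  proof (rule antisym)
    have "P (\<lambda>x. 1 - g x) \<le> (\<integral>x. 1 - g x \<partial>riesz_measure)"
      using g by (intro functional_le_integral continuous_intros) auto
    then show "(\<integral>x. g x \<partial>riesz_measure) \<le> P g"
      using functional_diff[of "\<lambda>x. 1" g] g(1)
        radon_integrable[OF compact_UNIV radon_riesz_measure g(1)] measure_riesz_measure_UNIV
      by simp
  qed (rule functional_le_integral[OF g])
  have "bounded (range f)"
    using compact_continuous_image[OF f compact_UNIV] by (rule compact_imp_bounded)
  then obtain B where B: "B > 0" "\<And>x. \<bar>f x\<bar> \<le> B"
    by (auto simp: bounded_pos)
  define g where "g x = 1/2 + (1/(2*B)) * f x" for x
  have g: "continuous_on UNIV g" "0 \<le> g x" "g x \<le> 1" for x
    using f B(1) B(2)[of x] by (auto simp: g_def abs_le_iff field_simps intro!: continuous_intros)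
  have f_eq: "f = (\<lambda>x. 2 * B * g x - B * 1)"
    using B by (simp add: g_def field_simps)
  have "P f = 2 * B * P g - B * P (\<lambda>x. 1)"
    unfolding f_eq using g(1) functional_diff[of "\<lambda>x. 2 * B * g x" "\<lambda>x. B * 1"]
      functional_cmult[of g "2 * B"] functional_cmult[of "\<lambda>x. 1" B]
    by (simp add: continuous_intros)
  moreover have "(\<integral>x. f x \<partial>riesz_measure) = 2 * B * (\<integral>x. g x \<partial>riesz_measure) - B * P (\<lambda>x. 1)"
    unfolding f_eq using radon_integrable[OF compact_UNIV radon_riesz_measure g(1)]
      measure_riesz_measure_UNIV
    by simp
  ultimately show ?thesis
    using unit[OF g] by simp
qed

theorem riesz_markov: "\<exists>M. radon M \<and> (\<forall>f. continuous_on UNIV f \<longrightarrow> P f = (\<integral>x. f x \<partial>M))"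
  using radon_riesz_measure integral_riesz_measure by metis

end

section \<open>Complex measures as functionals\<close>

lemma bcontfun_compact_iff:
  assumes "compact (UNIV :: 'g::topological_space set)"
  shows "f \<in> bcontfun \<longleftrightarrow> continuous_on (UNIV :: 'g set) f"
  using compact_imp_bounded[OF compact_continuous_image[OF _ assms]] by (auto simp: bcontfun_iff)

definition sup_pos :: "('g::topological_space \<Rightarrow>\<^sub>C real) \<Rightarrow> real" where
  "sup_pos F = (SUP x. max 0 (apply_bcontfun F x))"

lemma sup_pos_le_iff: "sup_pos F \<le> b \<longleftrightarrow> 0 \<le> b \<and> (\<forall>x. apply_bcontfun F x \<le> b)"
proof -
  have "bdd_above (range (\<lambda>x. max 0 (apply_bcontfun F x)))"
    using norm_bounded[of F] by (intro bdd_aboveI[of _ "norm F"]) (auto simp: abs_le_iff)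
  then show ?thesis
    unfolding sup_pos_def by (subst cSUP_le_iff) auto
qed

lemma sup_pos_nonneg: "0 \<le> sup_pos F"
  and le_sup_pos: "apply_bcontfun F x \<le> sup_pos F"
  using sup_pos_le_iff[of F "sup_pos F"] by auto

lemma sublinear_sup_pos:
  assumes "0 \<le> C"
  shows "sublinear (\<lambda>F :: 'g::topological_space \<Rightarrow>\<^sub>C real. C * sup_pos F)"
proof (rule sublinearI)
  have "sup_pos (F + G) \<le> sup_pos F + sup_pos G" for F G :: "'g \<Rightarrow>\<^sub>C real"
    by (auto simp: sup_pos_le_iff intro!: add_mono add_nonneg_nonneg sup_pos_nonneg le_sup_pos)
  then show "C * sup_pos (F + G) \<le> C * sup_pos F + C * sup_pos G" for F G :: "'g \<Rightarrow>\<^sub>C real"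
    using assms by (simp add: distrib_left[symmetric] mult_left_mono)
next
  have "sup_pos (t *\<^sub>R F) \<le> t * sup_pos F" if "0 < t" for t and F :: "'g \<Rightarrow>\<^sub>C real"
    using that
    by (auto simp: sup_pos_le_iff intro!: mult_left_mono mult_nonneg_nonneg sup_pos_nonneg le_sup_pos)
  then show "C * sup_pos (t *\<^sub>R F) \<le> t * (C * sup_pos F)" if "0 < t" for t and F :: "'g \<Rightarrow>\<^sub>C real"
    using mult_left_mono[OF _ assms] that by (simp add: mult.left_commute)
qed (simp add: sup_pos_def)

lemma real_functional_linear:
  fixes w :: "('g::t2_space \<Rightarrow>\<^sub>C real) \<Rightarrow> real"
  assumes compact_UNIV: "compact (UNIV :: 'g set)" and w: "linear w"
  shows "real_functional (\<lambda>f. w (Bcontfun f))"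
proof
  fix f :: "'g \<Rightarrow> real" assume f: "continuous_on UNIV f"
  show "w (Bcontfun (\<lambda>x. c * f x)) = c * w (Bcontfun f)" for c
    using Bcontfun_scaleR[of f c] f
    by (simp add: bcontfun_compact_iff[OF compact_UNIV] linear_scale[OF w])
  show "w (Bcontfun (\<lambda>x. f x + g x)) = w (Bcontfun f) + w (Bcontfun g)"
    if "continuous_on UNIV g" for g
    using f that by (simp add: Bcontfun_add bcontfun_compact_iff[OF compact_UNIV] linear_add[OF w])
qed (rule compact_UNIV)

text \<open>The sandwich form of the Hahn--Banach theorem yields \<open>Q \<ge> P\<close> on the positive cone with
  \<open>Q F \<le> C * sup_pos F\<close>, which makes \<open>Q\<close> positive.\<close>

lemma (in real_functional) positive_majorant:
  assumes bound: "\<And>f b. continuous_on UNIV f \<Longrightarrow> (\<And>x. \<bar>f x\<bar> \<le> b) \<Longrightarrow> P f \<le> C * b" and C: "0 \<le> C"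
  obtains Q where "positive_functional Q" "positive_functional (\<lambda>f. Q f - P f)"
proof -
  define cone where "cone = {(F :: 'g \<Rightarrow>\<^sub>C real, P F) | F. \<forall>x. 0 \<le> apply_bcontfun F x}"
  have mem_cone: "(F, c) \<in> cone \<longleftrightarrow> c = P F \<and> (\<forall>x. 0 \<le> apply_bcontfun F x)" for F c
    by (auto simp: cone_def)
  have "convex_cone cone"
    unfolding convex_cone_iff
    by (auto simp: zero_prod_def mem_cone functional_zero functional_add functional_cmult)
  moreover have "c \<le> C * sup_pos F" if "(F, c) \<in> cone" for F c
    using that bound[of F "sup_pos F"] le_sup_pos[of F] by (simp add: mem_cone)
  ultimately obtain w where w: "linear w" "\<And>F. w F \<le> C * sup_pos F"
    "\<And>F c. (F, c) \<in> cone \<Longrightarrow> c \<le> w F"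
    using hahn_banach_cone[OF sublinear_sup_pos[OF C]] by metis
  interpret Q: real_functional "\<lambda>f. w (Bcontfun f)"
    by (rule real_functional_linear[OF compact_UNIV w(1)])
  have "positive_functional (\<lambda>f. w (Bcontfun f))"
  proof unfold_locales
    fix f :: "'g \<Rightarrow> real" assume f: "continuous_on UNIV f" "\<And>x. 0 \<le> f x"
    then have "sup_pos (- Bcontfun f) \<le> 0"
      by (simp add: sup_pos_le_iff Bcontfun_inverse bcontfun_compact_iff[OF compact_UNIV])
    then have "w (- Bcontfun f) \<le> 0"
      using w(2)[of "- Bcontfun f"] C by (meson mult_nonneg_nonpos order_trans)
    then show "0 \<le> w (Bcontfun f)"
      by (simp add: linear_neg[OF w(1)])
  qed
  moreover have "positive_functional (\<lambda>f. w (Bcontfun f) - P f)"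
  proof unfold_locales
    fix f :: "'g \<Rightarrow> real" assume f: "continuous_on UNIV f" "\<And>x. 0 \<le> f x"
    then show "0 \<le> w (Bcontfun f) - P f"
      using w(3)[of "Bcontfun f" "P f"]
      by (simp add: mem_cone Bcontfun_inverse bcontfun_compact_iff[OF compact_UNIV])
  qed (simp_all add: compact_UNIV Q.functional_add Q.functional_cmult
      functional_add functional_cmult right_diff_distrib)
  ultimately show ?thesis
    using that by blast
qed

lemma dual_sp_Re_radon_difference:
  fixes \<Phi> :: "('g::t2_space \<Rightarrow> complex) \<Rightarrow> complex"
  assumes compact_UNIV: "compact (UNIV :: 'g set)" and \<Phi>: "\<Phi> \<in> dual_sp bcontfun"
  obtains M N where "radon M" "radon N"
    "\<And>f. continuous_on UNIV f \<Longrightarrow> Re (\<Phi> (\<lambda>x. of_real (f x))) = (\<integral>x. f x \<partial>M) - (\<integral>x. f x \<partial>N)"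
proof -
  define P where "P f = Re (\<Phi> (\<lambda>x. of_real (f x)))" for f :: "'g \<Rightarrow> real"
  have mem: "(\<lambda>x. complex_of_real (f x)) \<in> bcontfun" if "continuous_on UNIV f" for f :: "'g \<Rightarrow> real"
    using that by (simp add: bcontfun_compact_iff[OF compact_UNIV] continuous_on_of_real)
  interpret P: real_functional P
    by unfold_locales (simp_all add: compact_UNIV P_def dual_spD[OF \<Phi>] mem)
  have "P f \<le> dnorm bcontfun \<Phi> * b" if f: "continuous_on UNIV f" "\<And>x. \<bar>f x\<bar> \<le> b" for f b
  proof -
    have "P f \<le> norm (\<Phi> (\<lambda>x. of_real (f x)))"
      unfolding P_def by (rule complex_Re_le_cmod)
    also have "\<dots> \<le> dnorm bcontfun \<Phi> * supn (\<lambda>x. complex_of_real (f x))"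
      by (rule bcontfun.norm_le_dnorm[OF \<Phi> mem[OF f(1)]])
    also have "\<dots> \<le> dnorm bcontfun \<Phi> * b"
      using f(2) by (intro mult_left_mono supn_le bcontfun.dnorm_nonneg \<Phi>) simp
    finally show ?thesis .
  qed
  then obtain Q where Q: "positive_functional Q" "positive_functional (\<lambda>f. Q f - P f)"
    using P.positive_majorant bcontfun.dnorm_nonneg[OF \<Phi>] by metis
  obtain M where M: "radon M" "\<And>f. continuous_on UNIV f \<Longrightarrow> Q f = (\<integral>x. f x \<partial>M)"
    using positive_functional.riesz_markov[OF Q(1)] by blast
  obtain N where N: "radon N" "\<And>f. continuous_on UNIV f \<Longrightarrow> Q f - P f = (\<integral>x. f x \<partial>N)"
    using positive_functional.riesz_markov[OF Q(2)] by blast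
  show ?thesis
  proof (rule that[OF M(1) N(1)])
    show "Re (\<Phi> (\<lambda>x. of_real (f x))) = (\<integral>x. f x \<partial>M) - (\<integral>x. f x \<partial>N)" if "continuous_on UNIV f" for f
      using M(2)[OF that] N(2)[OF that] by (simp add: P_def)
  qed
qed

lemma cm_int_linear:
  fixes f g :: "'g::topological_space \<Rightarrow> complex"
  assumes "compact (UNIV :: 'g set)" "is_cmeasure \<mu>"
  shows "continuous_on UNIV f \<Longrightarrow> continuous_on UNIV g \<Longrightarrow>
      cm_int \<mu> (\<lambda>x. f x + g x) = cm_int \<mu> f + cm_int \<mu> g"
    and "cm_int \<mu> (\<lambda>x. c * f x) = c * cm_int \<mu> f"
  using assms(2)
  by (auto simp: cm_int_def is_cmeasure_def radon_integrable[OF assms(1)] algebra_simps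
      split: prod.splits)

lemma dual_sp_eq_cm_intI:
  fixes \<Phi> :: "('g::topological_space \<Rightarrow> complex) \<Rightarrow> complex"
  assumes compact_UNIV: "compact (UNIV :: 'g set)" and \<Phi>: "\<Phi> \<in> dual_sp bcontfun" and \<mu>: "is_cmeasure \<mu>"
    and eq_real: "\<And>f. continuous_on UNIV f \<Longrightarrow> \<Phi> (\<lambda>x. of_real (f x)) = cm_int \<mu> (\<lambda>x. of_real (f x))"
    and f: "continuous_on UNIV f"
  shows "\<Phi> f = cm_int \<mu> f"
proof -
  define re im where "re x = complex_of_real (Re (f x))" and "im x = complex_of_real (Im (f x))"
    for x
  have cont: "continuous_on UNIV re" "continuous_on UNIV im" "continuous_on UNIV (\<lambda>x. \<i> * im x)"
    unfolding re_def im_def using f by (auto intro!: continuous_intros)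
  have f_eq: "f = (\<lambda>x. re x + \<i> * im x)"
    by (simp add: complex_eq fun_eq_iff re_def im_def)
  have "\<Phi> f = \<Phi> re + \<i> * \<Phi> im"
    unfolding f_eq using cont by (simp add: dual_spD[OF \<Phi>] bcontfun_compact_iff[OF compact_UNIV])
  also have "\<dots> = cm_int \<mu> re + \<i> * cm_int \<mu> im"
    unfolding re_def im_def using f by (simp add: eq_real continuous_on_Re continuous_on_Im)
  also have "\<dots> = cm_int \<mu> f"
    unfolding f_eq using cont by (simp add: cm_int_linear[OF compact_UNIV \<mu>])
  finally show ?thesis .
qed

theorem cmeasure_representation:
  fixes \<Phi> :: "('g::t2_space \<Rightarrow> complex) \<Rightarrow> complex"
  assumes compact_UNIV: "compact (UNIV :: 'g set)" and \<Phi>: "\<Phi> \<in> dual_sp bcontfun"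
  obtains \<mu> where "is_cmeasure \<mu>" "\<And>f. continuous_on UNIV f \<Longrightarrow> \<Phi> f = cm_int \<mu> f"
proof -
  obtain m1 m2 where m12: "radon m1" "radon m2"
    "\<And>f. continuous_on UNIV f \<Longrightarrow> Re (\<Phi> (\<lambda>x. of_real (f x))) = (\<integral>x. f x \<partial>m1) - (\<integral>x. f x \<partial>m2)"
    using dual_sp_Re_radon_difference[OF compact_UNIV \<Phi>] by metis
  obtain m3 m4 where m34: "radon m3" "radon m4"
    "\<And>f. continuous_on UNIV f \<Longrightarrow> Re (- \<i> * \<Phi> (\<lambda>x. of_real (f x))) = (\<integral>x. f x \<partial>m3) - (\<integral>x. f x \<partial>m4)"
    using dual_sp_Re_radon_difference[OF compact_UNIV bcontfun.dual_sp_cmult[OF \<Phi>, of "- \<i>"]] by metis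
  define \<mu> where "\<mu> = (m1, m2, m3, m4)"
  have \<mu>: "is_cmeasure \<mu>"
    using m12 m34 by (simp add: \<mu>_def is_cmeasure_def)
  have "\<Phi> (\<lambda>x. of_real (f x)) = cm_int \<mu> (\<lambda>x. of_real (f x))" if "continuous_on UNIV f" for f
    using m12(3)[OF that] m34(3)[OF that] by (simp add: \<mu>_def cm_int_def complex_eq_iff)
  then show ?thesis
    using that[OF \<mu>] dual_sp_eq_cm_intI[OF compact_UNIV \<Phi> \<mu>] by blast
qed

section \<open>Atoms of functionals\<close>

definition bumps_at :: "'g::topological_space \<Rightarrow> ('g \<Rightarrow> real) filter" where
  "bumps_at h = (INF V\<in>{V. open V \<and> h \<in> V}. principal {u\<in>subordinate V. u h = 1})"

lemma eventually_bumps_at: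
  "eventually Q (bumps_at h) \<longleftrightarrow> (\<exists>V. open V \<and> h \<in> V \<and> (\<forall>u\<in>subordinate V. u h = 1 \<longrightarrow> Q u))"
  unfolding bumps_at_def
proof (subst eventually_INF_base)
  show "\<exists>X\<in>{V. open V \<and> h \<in> V}. principal {u\<in>subordinate X. u h = 1}
      \<le> inf (principal {u\<in>subordinate V. u h = 1}) (principal {u\<in>subordinate W. u h = 1})"
    if "V \<in> {V. open V \<and> h \<in> V}" "W \<in> {V. open V \<and> h \<in> V}" for V W
    using that subordinate_mono[of "V \<inter> W"] by (intro bexI[of _ "V \<inter> W"]) auto
qed (auto simp: eventually_principal)

lemma eventually_bumps_at_subordinate:
  "open V \<Longrightarrow> h \<in> V \<Longrightarrow> \<forall>\<^sub>F u in bumps_at h. u \<in> subordinate V \<and> u h = 1"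
  by (auto simp: eventually_bumps_at)

lemma bumps_at_neq_bot:
  fixes h :: "'g::t2_space"
  assumes "compact (UNIV :: 'g set)"
  shows "bumps_at h \<noteq> bot"
proof
  assume "bumps_at h = bot"
  then obtain V where V: "open V" "h \<in> V" "\<forall>u\<in>subordinate V. u h \<noteq> 1"
    using eventually_bumps_at[of "\<lambda>_. False" h] by auto
  then show False
    using urysohn_subordinate[OF assms, of "{h}" V] by auto
qed

text \<open>The point mass at \<open>h\<close> of the measure representing \<open>\<Phi>\<close>, read off from \<open>\<Phi>\<close> alone.\<close>

definition has_atom :: "(('g::topological_space \<Rightarrow> complex) \<Rightarrow> complex) \<Rightarrow> 'g \<Rightarrow> complex \<Rightarrow> bool" where
  "has_atom \<Phi> h c \<longleftrightarrow> ((\<lambda>u. \<Phi> (\<lambda>x. of_real (u x))) \<longlongrightarrow> c) (bumps_at h)"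

lemma has_atom_unique:
  fixes h :: "'g::t2_space"
  assumes "compact (UNIV :: 'g set)" "has_atom \<Phi> h c" "has_atom \<Phi> h d"
  shows "c = d"
  using tendsto_unique[OF bumps_at_neq_bot[OF assms(1)]] assms(2,3) unfolding has_atom_def by blast

lemma has_atom_add: "has_atom \<Phi> h c \<Longrightarrow> has_atom \<Psi> h d \<Longrightarrow> has_atom (\<lambda>f. \<Phi> f + \<Psi> f) h (c + d)"
  unfolding has_atom_def by (rule tendsto_add)

lemma has_atom_cmult: "has_atom \<Phi> h c \<Longrightarrow> has_atom (\<lambda>f. a * \<Phi> f) h (a * c)"
  unfolding has_atom_def by (rule tendsto_mult_left)

lemma has_atom_diff: "has_atom \<Phi> h c \<Longrightarrow> has_atom \<Psi> h d \<Longrightarrow> has_atom (\<lambda>f. \<Phi> f - \<Psi> f) h (c - d)"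
  unfolding has_atom_def by (rule tendsto_diff)

lemma has_atom_pt_eval:
  fixes h t :: "'g::t2_space"
  assumes "compact (UNIV :: 'g set)"
  shows "has_atom (pt_eval bcontfun t) h (of_bool (t = h))"
proof -
  obtain V where V: "open V" "h \<in> V" "t \<noteq> h \<Longrightarrow> t \<notin> V"
    using hausdorff[of t h] open_UNIV by blast
  have "\<forall>\<^sub>F u in bumps_at h. pt_eval bcontfun t (\<lambda>x. of_real (u x)) = of_bool (t = h)"
    using eventually_bumps_at_subordinate[OF V(1,2)]
  proof eventually_elim
    case (elim u)
    then have "(\<lambda>x. complex_of_real (u x)) \<in> bcontfun"
      by (auto simp: bcontfun_compact_iff[OF assms]
          intro!: continuous_on_of_real dest: subordinateD(1))
    then show ?case
      using elim V(3) subordinateD(4)[of u V t] by (auto simp: pt_eval_def)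
  qed
  then show ?thesis
    unfolding has_atom_def by (rule tendsto_eventually)
qed

lemma radon_tendsto_atom:
  fixes h :: "'g::t2_space"
  assumes compact_UNIV: "compact (UNIV :: 'g set)" and M: "radon M"
  shows "((\<lambda>u. \<integral>x. u x \<partial>M) \<longlongrightarrow> measure M {h}) (bumps_at h)"
proof (rule tendstoI)
  interpret finite_measure M
    by (rule radonD[OF M])
  note sets = radonD(1)[OF M]
  fix e :: real assume e: "0 < e"
  have "emeasure M {h} = (INF U\<in>{U. open U \<and> {h} \<subseteq> U}. emeasure M U)"
    using M by (auto simp: radon_def)
  from INF_approx_ennreal[OF e this] obtain V where V: "open V" "h \<in> V"
    "emeasure M V < emeasure M {h} + ennreal e"
    using emeasure_finite by auto
  then have V_less: "measure M V < measure M {h} + e"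
    using e
    by (simp add: emeasure_eq_measure ennreal_plus[symmetric] ennreal_less_iff del: ennreal_plus)
  show "\<forall>\<^sub>F u in bumps_at h. dist (\<integral>x. u x \<partial>M) (measure M {h}) < e"
    using eventually_bumps_at_subordinate[OF V(1,2)]
  proof eventually_elim
    case (elim u)
    have int: "integrable M u"
      using elim by (intro radon_integrable[OF compact_UNIV M]) (auto dest: subordinateD(1))
    have "(\<integral>x. indicator {h} x \<partial>M) \<le> (\<integral>x. u x \<partial>M)"
      using elim subordinateD(2)[of u V]
      by (intro integral_mono int integrable_real_indicator)
        (auto simp: sets indicator_def less_top[symmetric] emeasure_finite)
    moreover have "(\<integral>x. u x \<partial>M) \<le> (\<integral>x. indicator V x \<partial>M)"
      using elim subordinateD(3,4)[of u V] V(1)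
      by (intro integral_mono int integrable_real_indicator)
        (auto simp: sets indicator_def less_top[symmetric] emeasure_finite)
    ultimately show ?case
      using V_less radonD(3)[OF M] by (simp add: dist_real_def)
  qed
qed

lemma has_atom_cmeasure:
  fixes h :: "'g::t2_space"
  assumes compact_UNIV: "compact (UNIV :: 'g set)" and \<mu>: "is_cmeasure \<mu>"
    and repr: "\<And>f. continuous_on UNIV f \<Longrightarrow> \<Phi> f = cm_int \<mu> f"
  shows "has_atom \<Phi> h (cm_val \<mu> {h})"
proof -
  obtain m1 m2 m3 m4 where m: "\<mu> = (m1, m2, m3, m4)"
    by (cases \<mu>)
  then have radon: "radon m1" "radon m2" "radon m3" "radon m4"
    using \<mu> by (auto simp: is_cmeasure_def)
  have "((\<lambda>u. of_real ((\<integral>x. u x \<partial>m1) - (\<integral>x. u x \<partial>m2)) + \<i> * of_real ((\<integral>x. u x \<partial>m3) - (\<integral>x. u x \<partial>m4)))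
      \<longlongrightarrow> cm_val \<mu> {h}) (bumps_at h)"
    unfolding m cm_val_def prod.case by (intro tendsto_intros radon_tendsto_atom compact_UNIV radon)
  moreover have "\<forall>\<^sub>F u in bumps_at h. \<Phi> (\<lambda>x. of_real (u x))
      = of_real ((\<integral>x. u x \<partial>m1) - (\<integral>x. u x \<partial>m2)) + \<i> * of_real ((\<integral>x. u x \<partial>m3) - (\<integral>x. u x \<partial>m4))"
    using eventually_bumps_at_subordinate[OF open_UNIV UNIV_I]
    by eventually_elim (simp add: repr m cm_int_def continuous_on_of_real subordinateD(1)[of _ UNIV])
  ultimately show ?thesis
    unfolding has_atom_def by (simp add: tendsto_cong)
qed

lemma tendsto_bump_mult_zero:
  fixes g :: "'g::t2_space \<Rightarrow> complex"
  assumes compact_UNIV: "compact (UNIV :: 'g set)" and \<Phi>: "\<Phi> \<in> dual_sp bcontfun"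
    and g: "continuous_on UNIV g" "g h = 0"
  shows "((\<lambda>u. \<Phi> (\<lambda>x. g x * of_real (u x))) \<longlongrightarrow> 0) (bumps_at h)"
proof (rule tendstoI)
  let ?C = "dnorm bcontfun \<Phi>"
  have C: "0 \<le> ?C"
    by (rule bcontfun.dnorm_nonneg[OF \<Phi>])
  fix e :: real assume e: "0 < e"
  define d where "d = e / (?C + 1)"
  have d: "0 < d" "?C * d < e"
    using e C by (auto simp: d_def field_simps)
  define V where "V = {x. norm (g x) < d}"
  have V: "open V" "h \<in> V"
    unfolding V_def using d(1) g by (auto intro!: open_Collect_less continuous_intros)
  show "\<forall>\<^sub>F u in bumps_at h. dist (\<Phi> (\<lambda>x. g x * of_real (u x))) 0 < e"
    using eventually_bumps_at_subordinate[OF V]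
  proof eventually_elim
    case (elim u)
    then have u: "u \<in> subordinate V"
      by blast
    have "norm (g x * of_real (u x)) \<le> d" for x
    proof (cases "x \<in> V")
      case True
      then have "norm (g x) * u x \<le> d * 1"
        using subordinateD(2,3)[OF u, of x] d(1) by (intro mult_mono) (auto simp: V_def)
      then show ?thesis
        using subordinateD(2)[OF u, of x] by (simp add: norm_mult)
    qed (use subordinateD(4)[OF u, of x] d(1) in simp)
    then have "supn (\<lambda>x. g x * of_real (u x)) \<le> d"
      by (rule supn_le)
    moreover have "(\<lambda>x. g x * of_real (u x)) \<in> bcontfun"
      unfolding bcontfun_compact_iff[OF compact_UNIV]
      by (intro continuous_intros g(1) subordinateD(1)[OF u])
    ultimately have "norm (\<Phi> (\<lambda>x. g x * of_real (u x))) \<le> ?C * d"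
      using bcontfun.norm_le_dnorm[OF \<Phi>] C by (meson mult_left_mono order_trans)
    then show ?case
      using d(2) by simp
  qed
qed

lemma has_atom_tendsto_mult:
  fixes f :: "'g::t2_space \<Rightarrow> complex"
  assumes compact_UNIV: "compact (UNIV :: 'g set)" and \<Phi>: "\<Phi> \<in> dual_sp bcontfun"
    and atom: "has_atom \<Phi> h a"
    and f: "continuous_on UNIV f"
  shows "((\<lambda>u. \<Phi> (\<lambda>x. f x * of_real (u x))) \<longlongrightarrow> f h * a) (bumps_at h)"
proof -
  have "((\<lambda>u. \<Phi> (\<lambda>x. (f x - f h) * of_real (u x))) \<longlongrightarrow> 0) (bumps_at h)"
    by (intro tendsto_bump_mult_zero[OF compact_UNIV \<Phi>] continuous_intros f) simp
  then have "((\<lambda>u. \<Phi> (\<lambda>x. (f x - f h) * of_real (u x)) + f h * \<Phi> (\<lambda>x. of_real (u x)))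
      \<longlongrightarrow> 0 + f h * a) (bumps_at h)"
    using atom unfolding has_atom_def by (intro tendsto_intros)
  moreover have "\<forall>\<^sub>F u in bumps_at h. \<Phi> (\<lambda>x. f x * of_real (u x))
      = \<Phi> (\<lambda>x. (f x - f h) * of_real (u x)) + f h * \<Phi> (\<lambda>x. of_real (u x))"
    using eventually_bumps_at_subordinate[OF open_UNIV UNIV_I]
  proof eventually_elim
    case (elim u)
    then have "continuous_on UNIV u"
      by (auto dest: subordinateD(1))
    then have u: "(\<lambda>x. complex_of_real (u x)) \<in> bcontfun"
      "(\<lambda>x. (f x - f h) * of_real (u x)) \<in> bcontfun"
      unfolding bcontfun_compact_iff[OF compact_UNIV] by (intro continuous_intros f; assumption)+
    have "(\<lambda>x. f x * of_real (u x)) = (\<lambda>x. (f x - f h) * of_real (u x) + f h * of_real (u x))"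
      by (simp add: algebra_simps)
    then show ?case
      using dual_spD(1)[OF \<Phi> u(2) cmult_bcontfun[OF u(1)]] dual_spD(2)[OF \<Phi> u(1)] by simp
  qed
  ultimately show ?thesis
    by (simp add: tendsto_cong)
qed

lemma norm_bump_replacement_le:
  assumes f: "f \<in> bcontfun" "supn f \<le> 1" and u: "u \<in> subordinate V" and "norm c = 1" "norm d = 1"
  shows "norm (c * (f x - f x * of_real (u x)) + d * complex_of_real (u x)) \<le> 1"
proof -
  have "c * (f x - f x * of_real (u x)) + d * of_real (u x)
      = c * (f x * of_real (1 - u x)) + d * of_real (u x)"
    by (simp add: algebra_simps)
  also have "norm \<dots> \<le> norm (c * (f x * of_real (1 - u x))) + norm (d * complex_of_real (u x))"
    by (rule norm_triangle_ineq)
  also have "\<dots> = norm (f x) * (1 - u x) + u x"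
    using assms(4,5) subordinateD(2,3)[OF u, of x] by (simp add: norm_mult del: of_real_diff)
  also have "\<dots> \<le> 1 * (1 - u x) + u x"
    using norm_le_supn[OF f(1), of x] f(2) subordinateD(3)[OF u, of x]
    by (intro add_right_mono mult_right_mono) auto
  finally show ?thesis
    by simp
qed

text \<open>Test \<open>\<Phi>\<close> against \<open>c f (1 - u) + d u\<close> with narrow bumps \<open>u\<close> and unimodular \<open>c\<close>, \<open>d\<close>.\<close>

lemma atom_splitting:
  fixes f :: "'g::t2_space \<Rightarrow> complex"
  assumes compact_UNIV: "compact (UNIV :: 'g set)" and \<Phi>: "\<Phi> \<in> dual_sp bcontfun"
    and atom: "has_atom \<Phi> h a"
    and f: "f \<in> bcontfun" "supn f \<le> 1"
  shows "norm (\<Phi> f - a * f h) + norm a \<le> dnorm bcontfun \<Phi>"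
proof -
  obtain c where c: "norm c = 1" "c * (\<Phi> f - a * f h) = of_real (norm (\<Phi> f - a * f h))"
    by (rule unimodular_factor)
  obtain d where d: "norm d = 1" "d * a = of_real (norm a)"
    by (rule unimodular_factor)
  have cont: "continuous_on UNIV f"
    using f(1) by (simp add: bcontfun_iff)
  have lim: "((\<lambda>u. norm (c * (\<Phi> f - \<Phi> (\<lambda>x. f x * of_real (u x))) + d * \<Phi> (\<lambda>x. of_real (u x))))
      \<longlongrightarrow> norm (c * (\<Phi> f - f h * a) + d * a)) (bumps_at h)"
    using has_atom_tendsto_mult[OF compact_UNIV \<Phi> atom cont] atom unfolding has_atom_def
    by (intro tendsto_intros)
  have "\<forall>\<^sub>F u in bumps_at h.
      norm (c * (\<Phi> f - \<Phi> (\<lambda>x. f x * of_real (u x))) + d * \<Phi> (\<lambda>x. of_real (u x)))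
      \<le> dnorm bcontfun \<Phi>"
    using eventually_bumps_at_subordinate[OF open_UNIV UNIV_I]
  proof eventually_elim
    case (elim u)
    then have u: "u \<in> subordinate UNIV"
      by blast
    have mem: "(\<lambda>x. complex_of_real (u x)) \<in> bcontfun" "(\<lambda>x. f x * of_real (u x)) \<in> bcontfun"
      unfolding bcontfun_compact_iff[OF compact_UNIV]
      by (intro continuous_intros cont subordinateD(1)[OF u])+
    define H where "H x = c * (f x - f x * of_real (u x)) + d * of_real (u x)" for x
    note test = bcontfun.cmult_mem[OF bcontfun.diff_mem[OF f(1) mem(2)], of c]
      bcontfun.cmult_mem[OF mem(1), of d]
    have H: "H \<in> bcontfun"
      unfolding H_def by (rule bcontfun.add_mem[OF test])
    have "\<Phi> H = c * (\<Phi> f - \<Phi> (\<lambda>x. f x * of_real (u x))) + d * \<Phi> (\<lambda>x. of_real (u x))"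
      unfolding H_def dual_spD(1)[OF \<Phi> test]
      by (simp add: dual_spD(2)[OF \<Phi>] bcontfun.diff_mem bcontfun.dual_sp_diff_arg[OF \<Phi>] f(1) mem)
    moreover have "norm (H x) \<le> 1" for x
      unfolding H_def by (rule norm_bump_replacement_le[OF f u c(1) d(1)])
    ultimately show ?case
      using bcontfun.norm_le_dnorm_unit[OF \<Phi> H supn_le] by simp
  qed
  with lim have "norm (c * (\<Phi> f - f h * a) + d * a) \<le> dnorm bcontfun \<Phi>"
    by (rule tendsto_upperbound[OF _ _ bumps_at_neq_bot[OF compact_UNIV]])
  moreover have "c * (\<Phi> f - f h * a) + d * a = of_real (norm (\<Phi> f - a * f h) + norm a)"
    using c d by (simp add: mult.commute)
  ultimately show ?thesis
    by (simp only: norm_of_real)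
qed

section \<open>The point-mass functionals\<close>

locale atomless_annihilator = bcont_subspace S for S :: "('g::t2_space \<Rightarrow> complex) set" +
  assumes compact_UNIV: "compact (UNIV :: 'g set)"
    and has_atom_annihilator:
      "\<Phi> \<in> dual_sp bcontfun \<Longrightarrow> (\<And>f. f \<in> S \<Longrightarrow> \<Phi> f = 0) \<Longrightarrow> has_atom \<Phi> h 0"
begin

definition pmass :: "'g \<Rightarrow> (('g \<Rightarrow> complex) \<Rightarrow> complex) \<Rightarrow> complex" where
  "pmass h \<phi> = (THE c. \<exists>\<Phi>\<in>dual_sp bcontfun. (\<forall>f\<in>S. \<Phi> f = \<phi> f) \<and> has_atom \<Phi> h c)"

lemma pmass_eq:
  assumes "\<Phi> \<in> dual_sp bcontfun" "\<And>f. f \<in> S \<Longrightarrow> \<Phi> f = \<phi> f" "has_atom \<Phi> h c"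
  shows "pmass h \<phi> = c"
  unfolding pmass_def
proof (rule the_equality)
  show "\<exists>\<Phi>\<in>dual_sp bcontfun. (\<forall>f\<in>S. \<Phi> f = \<phi> f) \<and> has_atom \<Phi> h c"
    using assms by blast
next
  fix c' assume "\<exists>\<Phi>\<in>dual_sp bcontfun. (\<forall>f\<in>S. \<Phi> f = \<phi> f) \<and> has_atom \<Phi> h c'"
  then obtain \<Psi> where \<Psi>: "\<Psi> \<in> dual_sp bcontfun" "\<And>f. f \<in> S \<Longrightarrow> \<Psi> f = \<phi> f" "has_atom \<Psi> h c'"
    by blast
  have "has_atom (\<lambda>f. \<Phi> f - \<Psi> f) h 0"
    using assms(2) \<Psi>(2) by (intro has_atom_annihilator bcontfun.dual_sp_diff assms(1) \<Psi>(1)) auto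
  then have "c - c' = 0"
    using has_atom_unique[OF compact_UNIV has_atom_diff[OF assms(3) \<Psi>(3)]] by blast
  then show "c' = c"
    by simp
qed

lemma pmass_extension:
  assumes "\<phi> \<in> dual_sp S"
  obtains \<Phi> where "\<Phi> \<in> dual_sp bcontfun" "\<And>f. f \<in> S \<Longrightarrow> \<Phi> f = \<phi> f"
    "dnorm bcontfun \<Phi> \<le> dnorm S \<phi>" "\<And>h. has_atom \<Phi> h (pmass h \<phi>)"
proof -
  obtain \<Phi> where \<Phi>: "\<Phi> \<in> dual_sp bcontfun" "\<And>f. f \<in> S \<Longrightarrow> \<Phi> f = \<phi> f" "dnorm bcontfun \<Phi> \<le> dnorm S \<phi>"
    using complex_hahn_banach[OF assms] by metis
  obtain \<mu> where \<mu>: "is_cmeasure \<mu>" "\<And>f. continuous_on UNIV f \<Longrightarrow> \<Phi> f = cm_int \<mu> f"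
    using cmeasure_representation[OF compact_UNIV \<Phi>(1)] by metis
  have atom: "has_atom \<Phi> h (cm_val \<mu> {h})" for h
    by (rule has_atom_cmeasure[OF compact_UNIV \<mu>])
  have "pmass h \<phi> = cm_val \<mu> {h}" for h
    by (rule pmass_eq[OF \<Phi>(1,2) atom])
  then show ?thesis
    using that \<Phi> atom by metis
qed

lemma pmass_add:
  assumes "\<phi> \<in> dual_sp S" "\<psi> \<in> dual_sp S"
  shows "pmass h (\<lambda>f. \<phi> f + \<psi> f) = pmass h \<phi> + pmass h \<psi>"
proof -
  obtain \<Phi> where \<Phi>: "\<Phi> \<in> dual_sp bcontfun" "\<And>f. f \<in> S \<Longrightarrow> \<Phi> f = \<phi> f" "has_atom \<Phi> h (pmass h \<phi>)"
    using pmass_extension[OF assms(1)] by metis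
  obtain \<Psi> where \<Psi>: "\<Psi> \<in> dual_sp bcontfun" "\<And>f. f \<in> S \<Longrightarrow> \<Psi> f = \<psi> f" "has_atom \<Psi> h (pmass h \<psi>)"
    using pmass_extension[OF assms(2)] by metis
  show ?thesis
    by (rule pmass_eq[OF bcontfun.dual_sp_add[OF \<Phi>(1) \<Psi>(1)] _ has_atom_add[OF \<Phi>(3) \<Psi>(3)]])
      (simp add: \<Phi> \<Psi>)
qed

lemma pmass_cmult:
  assumes "\<phi> \<in> dual_sp S"
  shows "pmass h (\<lambda>f. c * \<phi> f) = c * pmass h \<phi>"
proof -
  obtain \<Phi> where \<Phi>: "\<Phi> \<in> dual_sp bcontfun" "\<And>f. f \<in> S \<Longrightarrow> \<Phi> f = \<phi> f" "has_atom \<Phi> h (pmass h \<phi>)"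
    using pmass_extension[OF assms(1)] by metis
  show ?thesis
    by (rule pmass_eq[OF bcontfun.dual_sp_cmult[OF \<Phi>(1)] _ has_atom_cmult[OF \<Phi>(3)]]) (simp add: \<Phi>)
qed

lemma pmass_diff:
  assumes "\<phi> \<in> dual_sp S" "\<psi> \<in> dual_sp S"
  shows "pmass h (\<lambda>f. \<phi> f - \<psi> f) = pmass h \<phi> - pmass h \<psi>"
  using pmass_add[OF assms(1) dual_sp_cmult[OF assms(2)], of h "-1"]
    pmass_cmult[OF assms(2), of h "-1"]
  by simp

lemma pmass_sum:
  "(\<And>i. i \<in> I \<Longrightarrow> \<phi> i \<in> dual_sp S) \<Longrightarrow> pmass h (\<lambda>f. \<Sum>i\<in>I. \<phi> i f) = (\<Sum>i\<in>I. pmass h (\<phi> i))"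
  using pmass_cmult[OF dual_sp_zero, of h 0]
  by (induction I rule: infinite_finite_induct) (simp_all add: pmass_add dual_sp_sum)

lemma pmass_pt_eval: "pmass h (pt_eval S t) = of_bool (t = h)"
  by (rule pmass_eq[OF bcontfun.dual_sp_pt_eval _ has_atom_pt_eval[OF compact_UNIV]])
    (use mem_bcontfun in \<open>auto simp: pt_eval_def\<close>)

definition pmass_proj :: "'g \<Rightarrow> (('g \<Rightarrow> complex) \<Rightarrow> complex) \<Rightarrow> ('g \<Rightarrow> complex) \<Rightarrow> complex" where
  "pmass_proj h \<phi> = (\<lambda>f. pmass h \<phi> * pt_eval S h f)"

lemma pmass_proj_cong: "pmass h \<phi> = pmass h \<psi> \<Longrightarrow> pmass_proj h \<phi> = pmass_proj h \<psi>"
  by (simp add: pmass_proj_def)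

lemma pmass_proj_cmult_pt_eval: "pmass_proj h (\<lambda>f. c * pt_eval S h f) = (\<lambda>f. c * pt_eval S h f)"
  by (simp add: pmass_proj_def pmass_cmult dual_sp_pt_eval pmass_pt_eval)

lemma dual_sp_pmass_proj: "pmass_proj h \<phi> \<in> dual_sp S"
  unfolding pmass_proj_def by (intro dual_sp_cmult dual_sp_pt_eval)

lemma pmass_pmass_proj: "pmass t (pmass_proj h \<phi>) = of_bool (h = t) * pmass h \<phi>"
  by (simp add: pmass_proj_def pmass_cmult dual_sp_pt_eval pmass_pt_eval)

lemma dnorm_pmass_splitting:
  assumes \<phi>: "\<phi> \<in> dual_sp S"
  shows "dnorm S \<phi> = norm (pmass h \<phi>) + dnorm S (\<lambda>f. \<phi> f - pmass_proj h \<phi> f)"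
proof (rule antisym)
  have "dnorm S (pmass_proj h \<phi>) \<le> norm (pmass h \<phi>) * dnorm S (pt_eval S h)"
    unfolding pmass_proj_def by (rule dnorm_cmult_le[OF dual_sp_pt_eval])
  also have "\<dots> \<le> norm (pmass h \<phi>) * 1"
    by (intro mult_left_mono dnorm_pt_eval_le norm_ge_zero)
  finally show "dnorm S \<phi> \<le> norm (pmass h \<phi>) + dnorm S (\<lambda>f. \<phi> f - pmass_proj h \<phi> f)"
    using dnorm_triangle[OF dual_sp_pmass_proj dual_sp_diff[OF \<phi> dual_sp_pmass_proj], of h \<phi> h \<phi>]
    by simp
next
  obtain \<Phi> where \<Phi>: "\<Phi> \<in> dual_sp bcontfun" "\<And>f. f \<in> S \<Longrightarrow> \<Phi> f = \<phi> f"
    "dnorm bcontfun \<Phi> \<le> dnorm S \<phi>" "has_atom \<Phi> h (pmass h \<phi>)"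
    using pmass_extension[OF \<phi>] by metis
  have "norm (\<phi> f - pmass_proj h \<phi> f) \<le> dnorm S \<phi> - norm (pmass h \<phi>)"
    if "f \<in> S" "supn f \<le> 1" for f
    using atom_splitting[OF compact_UNIV \<Phi>(1,4) mem_bcontfun[OF that(1)] that(2)] \<Phi>(2,3) that(1)
    by (simp add: pmass_proj_def pt_eval_def)
  then have "dnorm S (\<lambda>f. \<phi> f - pmass_proj h \<phi> f) \<le> dnorm S \<phi> - norm (pmass h \<phi>)"
    by (rule dnorm_least)
  then show "norm (pmass h \<phi>) + dnorm S (\<lambda>f. \<phi> f - pmass_proj h \<phi> f) \<le> dnorm S \<phi>"
    by simp
qed

lemma pmass_le_dnorm:
  assumes "\<phi> \<in> dual_sp S"
  shows "norm (pmass h \<phi>) \<le> dnorm S \<phi>"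
proof -
  have "0 \<le> dnorm S (\<lambda>f. \<phi> f - pmass_proj h \<phi> f)"
    by (intro dnorm_nonneg dual_sp_diff assms dual_sp_pmass_proj)
  then show ?thesis
    using dnorm_pmass_splitting[OF assms, of h] by simp
qed

lemma sum_pmass_le_dnorm: "finite F \<Longrightarrow> \<phi> \<in> dual_sp S \<Longrightarrow> (\<Sum>t\<in>F. norm (pmass t \<phi>)) \<le> dnorm S \<phi>"
proof (induction F arbitrary: \<phi> rule: finite_induct)
  case (insert h F)
  let ?\<psi> = "\<lambda>f. \<phi> f - pmass_proj h \<phi> f"
  have "pmass t ?\<psi> = pmass t \<phi>" if "t \<in> F" for t
    using that insert.hyps(2)
    by (auto simp: pmass_diff[OF insert.prems dual_sp_pmass_proj] pmass_pmass_proj)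
  then have "(\<Sum>t\<in>F. norm (pmass t \<phi>)) \<le> dnorm S ?\<psi>"
    using insert.IH[of ?\<psi>] insert.prems by (simp add: dual_sp_diff dual_sp_pmass_proj)
  then show ?case
    using insert dnorm_pmass_splitting[of \<phi> h] by simp
qed (simp add: dnorm_nonneg)

lemma countable_pmass_nonzero:
  assumes "\<phi> \<in> dual_sp S"
  shows "countable {t. pmass t \<phi> \<noteq> 0}"
proof -
  have "(\<lambda>t. norm (pmass t \<phi>)) summable_on UNIV"
    using sum_pmass_le_dnorm[OF _ assms]
    by (intro nonneg_bdd_above_summable_on) (auto intro: bdd_aboveI[of _ "dnorm S \<phi>"])
  then show ?thesis
    using summable_countable_real by fastforce
qed

lemma pmass_eq_0_if_approx:
  assumes \<phi>: "\<phi> \<in> dual_sp S"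
    and approx: "\<And>e. 0 < e \<Longrightarrow> \<exists>\<psi>\<in>dual_sp S. pmass t \<psi> = 0 \<and> dnorm S (\<lambda>f. \<phi> f - \<psi> f) \<le> e"
  shows "pmass t \<phi> = 0"
proof -
  have "norm (pmass t \<phi>) \<le> 0 + e" if e: "0 < e" for e
  proof -
    obtain \<psi> where \<psi>: "\<psi> \<in> dual_sp S" "pmass t \<psi> = 0" "dnorm S (\<lambda>f. \<phi> f - \<psi> f) \<le> e"
      using approx[OF e] by blast
    then show ?thesis
      using pmass_le_dnorm[OF dual_sp_diff[OF \<phi> \<psi>(1)], of t] by (simp add: pmass_diff[OF \<phi> \<psi>(1)])
  qed
  then have "norm (pmass t \<phi>) \<le> 0"
    by (rule field_le_epsilon)
  then show ?thesis
    by simp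
qed

lemma dnorm_pmass_proj: "dnorm S (pmass_proj h \<phi>) = norm (pmass h \<phi>)"
proof -
  have "dnorm S (\<lambda>f. 0) = 0"
    using dnorm_cmult_le[OF dual_sp_zero, of 0] dnorm_nonneg[OF dual_sp_zero] by simp
  moreover have "pmass_proj h (pmass_proj h \<phi>) = pmass_proj h \<phi>"
    by (rule pmass_proj_cong) (simp add: pmass_pmass_proj)
  ultimately show ?thesis
    using dnorm_pmass_splitting[OF dual_sp_pmass_proj[of h \<phi>], of h] by (simp add: pmass_pmass_proj)
qed

lemma L_proj_pmass_proj: "L_proj S h (pmass_proj h)"
  unfolding L_proj_def
proof (intro conjI ballI allI)
  fix \<phi> \<psi> assume \<phi>: "\<phi> \<in> dual_sp S"
  show "pmass_proj h (pmass_proj h \<phi>) = pmass_proj h \<phi>"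
    by (rule pmass_proj_cong) (simp add: pmass_pmass_proj)
  show "dnorm S \<phi> = dnorm S (pmass_proj h \<phi>) + dnorm S (\<lambda>f. \<phi> f - pmass_proj h \<phi> f)"
    unfolding dnorm_pmass_proj by (rule dnorm_pmass_splitting[OF \<phi>])
  show "pmass_proj h (\<lambda>f. c * \<phi> f) = (\<lambda>f. c * pmass_proj h \<phi> f)" for c
    by (simp add: pmass_proj_def pmass_cmult[OF \<phi>] mult.assoc)
  assume \<psi>: "\<psi> \<in> dual_sp S"
  show "pmass_proj h (\<lambda>f. \<phi> f + \<psi> f) = (\<lambda>f. pmass_proj h \<phi> f + pmass_proj h \<psi> f)"
    by (simp add: pmass_proj_def pmass_add[OF \<phi> \<psi>] distrib_right)
next
  have "(\<lambda>f. c * pt_eval S h f) \<in> pmass_proj h ` dual_sp S" for c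
    by (rule image_eqI[where x = "\<lambda>f. c * pt_eval S h f"])
      (simp_all add: pmass_proj_cmult_pt_eval dual_sp_cmult dual_sp_pt_eval)
  then show "pmass_proj h ` dual_sp S = {\<lambda>f. c * pt_eval S h f |c. True}"
    by (auto simp: pmass_proj_def)
qed

lemma pi_fun_eq_pmass:
  assumes \<phi>: "\<phi> \<in> dual_sp S"
  shows "pi_fun S h \<phi> = pmass h \<phi>"
proof -
  have "L_proj S h (Pi_proj S h)"
    unfolding Pi_proj_def by (rule someI[where P = "L_proj S h", OF L_proj_pmass_proj])
  then have Pi_eq: "Pi_proj S h \<phi> = pmass_proj h \<phi>"
    using L_proj_unique[OF _ L_proj_pmass_proj \<phi>] by blast
  have "c = pmass h \<phi>" if "Pi_proj S h \<phi> = (\<lambda>f. c * pt_eval S h f)" for c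
    using arg_cong[OF that, of "pmass h"]
    by (simp add: Pi_eq pmass_pmass_proj pmass_cmult dual_sp_pt_eval pmass_pt_eval)
  then show ?thesis
    unfolding pi_fun_def using Pi_eq by (intro some_equality) (auto simp: pmass_proj_def)
qed

lemma dnorm_pt_eval_plus_ge:
  assumes \<phi>: "\<phi> \<in> dual_sp S"
  shows "1 + dnorm S \<phi> \<le> dnorm S (\<lambda>f. pt_eval S h f + \<phi> f) + 2 * norm (pmass h \<phi>)"
proof -
  let ?rest = "dnorm S (\<lambda>f. \<phi> f - pmass_proj h \<phi> f)"
  have "pmass h (\<lambda>f. pt_eval S h f + \<phi> f) = 1 + pmass h \<phi>"
    by (simp add: pmass_add[OF dual_sp_pt_eval \<phi>] pmass_pt_eval)
  then have "dnorm S (\<lambda>f. pt_eval S h f + \<phi> f) = norm (1 + pmass h \<phi>) + ?rest"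
    using dnorm_pmass_splitting[OF dual_sp_add[OF dual_sp_pt_eval \<phi>], of h h]
    by (simp add: pmass_proj_def distrib_right)
  moreover have "dnorm S \<phi> = norm (pmass h \<phi>) + ?rest"
    by (rule dnorm_pmass_splitting[OF \<phi>])
  moreover have "1 - norm (pmass h \<phi>) \<le> norm (1 + pmass h \<phi>)"
    using norm_triangle_ineq2[of 1 "- pmass h \<phi>"] by simp
  ultimately show ?thesis
    by linarith
qed

end

section \<open>The Daugavet equation\<close>

locale atomless_annihilator_operator = atomless_annihilator S + bcont_operator S T
  for S :: "('g::t2_space \<Rightarrow> complex) set" and T
begin

lemma daugavet_if_small_atoms:
  assumes small: "\<And>U e. open U \<Longrightarrow> U \<noteq> {} \<Longrightarrow> 0 < e \<Longrightarrow> \<exists>s\<in>U. norm (pmass s (adj_pt S T s)) \<le> e"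
  shows "opnorm_on S (\<lambda>f x. f x + T f x) = 1 + opnorm_on S T"
proof (rule antisym[OF opnorm_id_plus_le field_le_epsilon])
  interpret id_plus: bcont_operator S "\<lambda>f x. f x + T f x"
    by (rule bcont_operator_id_plus)
  fix \<epsilon> :: real assume "0 < \<epsilon>"
  then have e: "0 < \<epsilon> / 3"
    by simp
  obtain U where U: "open U" "U \<noteq> {}" "\<And>s. s \<in> U \<Longrightarrow> opnorm_on S T - \<epsilon> / 3 < dnorm S (adj_pt S T s)"
    using opnorm_approx[OF e] by metis
  obtain s where s: "s \<in> U" "norm (pmass s (adj_pt S T s)) \<le> \<epsilon> / 3"
    using small[OF U(1,2) e] by blast
  have "adj_pt S (\<lambda>f x. f x + T f x) s = (\<lambda>f. pt_eval S s f + adj_pt S T s f)"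
    by (simp add: adj_pt_def pt_eval_def fun_eq_iff)
  then have "dnorm S (\<lambda>f. pt_eval S s f + adj_pt S T s f) \<le> opnorm_on S (\<lambda>f x. f x + T f x)"
    using id_plus.dnorm_adj_pt_le[of s] by simp
  then show "1 + opnorm_on S T \<le> opnorm_on S (\<lambda>f x. f x + T f x) + \<epsilon>"
    using dnorm_pt_eval_plus_ge[OF dual_sp_adj_pt, of s s] U(3)[OF s(1)] s(2) by linarith
qed

lemma factors_c0_countable_atoms:
  assumes "factors_c0 S T"
  obtains D where "countable D" "\<And>s t. t \<notin> D \<Longrightarrow> pmass t (adj_pt S T s) = 0"
proof -
  obtain \<xi> :: "nat \<Rightarrow> ('g \<Rightarrow> complex) \<Rightarrow> complex" where \<xi>: "\<And>n. \<xi> n \<in> dual_sp S"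
    and approx: "\<And>s e. 0 < e \<Longrightarrow> \<exists>N y. dnorm S (\<lambda>f. adj_pt S T s f - (\<Sum>n<N. y n * \<xi> n f)) \<le> e"
    using factors_c0_adj_pt_approx[OF assms] by metis
  show ?thesis
  proof (rule that)
    show "countable (\<Union>n. {t. pmass t (\<xi> n) \<noteq> 0})"
      by (intro countable_UN countableI_type countable_pmass_nonzero \<xi>)
  next
    fix s t assume t: "t \<notin> (\<Union>n. {t. pmass t (\<xi> n) \<noteq> 0})"
    show "pmass t (adj_pt S T s) = 0"
    proof (rule pmass_eq_0_if_approx[OF dual_sp_adj_pt])
      fix e :: real assume "0 < e"
      then obtain N y where y: "dnorm S (\<lambda>f. adj_pt S T s f - (\<Sum>n<N. y n * \<xi> n f)) \<le> e"
        using approx by blast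
      have "pmass t (\<lambda>f. \<Sum>n<N. y n * \<xi> n f) = (\<Sum>n<N. y n * pmass t (\<xi> n))"
        by (simp add: pmass_sum dual_sp_cmult \<xi> pmass_cmult)
      also have "\<dots> = 0"
        using t by simp
      finally show "\<exists>\<psi>\<in>dual_sp S. pmass t \<psi> = 0 \<and> dnorm S (\<lambda>f. adj_pt S T s f - \<psi> f) \<le> e"
        using y by (intro bexI[of _ "\<lambda>f. \<Sum>n<N. y n * \<xi> n f"] dual_sp_sum dual_sp_cmult \<xi>) simp
    qed
  qed
qed

lemma weakly_compact_continuous_atoms:
  assumes "weakly_compact_op S T"
  shows "continuous_on UNIV (\<lambda>s. pmass t (adj_pt S T s))"
proof -
  have "(\<lambda>s. pmass t (adj_pt S T s)) \<in> S"
  proof (rule weakly_compact_pointwise_limit[OF assms])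
    fix A :: "'g set" and \<epsilon> :: real assume A: "finite A" and \<epsilon>: "0 < \<epsilon>"
    have "norm (\<Sum>s\<in>A. c s * pmass t (adj_pt S T s))
        \<le> dnorm S (\<lambda>f. \<Sum>s\<in>A. c s * adj_pt S T s f)" for c
      using pmass_le_dnorm[of "\<lambda>f. \<Sum>s\<in>A. c s * adj_pt S T s f" t]
      by (simp add: pmass_sum pmass_cmult dual_sp_sum dual_sp_cmult dual_sp_adj_pt)
    then show "\<exists>f\<in>S. supn f \<le> 1 \<and> (\<forall>s\<in>A. norm (T f s - pmass t (adj_pt S T s)) \<le> \<epsilon>)"
      using helly[OF A dual_sp_adj_pt \<epsilon>, of "\<lambda>s. pmass t (adj_pt S T s)"]
      by (fastforce simp: adj_pt_def)
  qed
  then show ?thesis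
    using mem_bcontfun by (simp add: bcontfun_iff)
qed

text \<open>A new point \<open>r \<in> W\<close> is a large atom for \<open>s = r\<close>, hence by continuity for all \<open>s\<close> near \<open>r\<close>.\<close>

lemma arbitrarily_many_large_atoms:
  assumes cont: "\<And>t. continuous_on UNIV (\<lambda>s. pmass t (adj_pt S T s))"
    and infinite_open: "\<And>V :: 'g set. open V \<Longrightarrow> V \<noteq> {} \<Longrightarrow> infinite V"
    and U: "open U" "U \<noteq> {}" and large: "\<And>s. s \<in> U \<Longrightarrow> e < norm (pmass s (adj_pt S T s))"
  shows "\<exists>F W. finite F \<and> card F = n \<and> open W \<and> W \<noteq> {} \<and> W \<subseteq> U \<and>
    (\<forall>s\<in>W. \<forall>t\<in>F. e < norm (pmass t (adj_pt S T s)))"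
proof (induction n)
  case 0
  show ?case
    using U by (intro exI[of _ "{}"] exI[of _ U]) auto
next
  case (Suc n)
  then obtain F W where F: "finite F" "card F = n" and W: "open W" "W \<noteq> {}" "W \<subseteq> U"
    and large_F: "\<And>s t. s \<in> W \<Longrightarrow> t \<in> F \<Longrightarrow> e < norm (pmass t (adj_pt S T s))"
    by blast
  obtain r where r: "r \<in> W" "r \<notin> F"
    using infinite_open[OF W(1,2)] F(1) finite_subset[of W F] by blast
  define W' where "W' = W \<inter> {s. e < norm (pmass r (adj_pt S T s))}"
  have "open W'"
    unfolding W'_def by (intro open_Int W(1) open_Collect_less continuous_intros cont)
  moreover have "r \<in> W'"
    using r large W(3) by (auto simp: W'_def)
  ultimately show ?case
    using F W(3) large_F r(2)
    by (intro exI[of _ "insert r F"] exI[of _ W']) (auto simp: W'_def)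
qed

lemma small_atoms_if_continuous:
  assumes cont: "\<And>t. continuous_on UNIV (\<lambda>s. pmass t (adj_pt S T s))"
    and infinite_open: "\<And>V :: 'g set. open V \<Longrightarrow> V \<noteq> {} \<Longrightarrow> infinite V"
    and U: "open U" "U \<noteq> {}" and e: "0 < e"
  shows "\<exists>s\<in>U. norm (pmass s (adj_pt S T s)) \<le> e"
proof (rule ccontr)
  assume "\<not> ?thesis"
  then have large: "e < norm (pmass s (adj_pt S T s))" if "s \<in> U" for s
    using that by (simp add: not_le)
  obtain n :: nat where n: "opnorm_on S T / e < real n"
    using reals_Archimedean2 by blast
  obtain F s where F: "finite F" "card F = n" "\<And>t. t \<in> F \<Longrightarrow> e < norm (pmass t (adj_pt S T s))"
    using arbitrarily_many_large_atoms[OF cont infinite_open U large, of n] by blast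
  have "real (card F) * e \<le> (\<Sum>t\<in>F. norm (pmass t (adj_pt S T s)))"
    using F(3) by (intro sum_bounded_below) (simp add: less_imp_le)
  also have "\<dots> \<le> dnorm S (adj_pt S T s)"
    by (rule sum_pmass_le_dnorm[OF F(1) dual_sp_adj_pt])
  also have "\<dots> \<le> opnorm_on S T"
    by (rule dnorm_adj_pt_le)
  finally show False
    using n e F(2) by (simp add: field_simps)
qed

end

section \<open>Compact abelian groups\<close>

lemma haar_radon: "haar m \<Longrightarrow> radon m"
  and haar_UNIV: "haar m \<Longrightarrow> emeasure m UNIV = 1"
  and haar_translation: "haar m \<Longrightarrow> A \<in> sets borel \<Longrightarrow> emeasure m ((\<lambda>y. x + y) ` A) = emeasure m A"
  using radonD(3)[of m] by (auto simp: haar_def)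

lemma translation_eq_vimage:
  fixes x :: "'g::group_add"
  shows "(\<lambda>y. x + y) ` A = (\<lambda>y. - x + y) -` A"
proof (rule set_eqI)
  fix z
  have "z = x + (- x + z)"
    by (simp add: add.assoc[symmetric])
  then show "z \<in> (\<lambda>y. x + y) ` A \<longleftrightarrow> z \<in> (\<lambda>y. - x + y) -` A"
    by (auto simp: add.assoc[symmetric] intro: image_eqI[of z _ "- x + z"])
qed

lemma haar_measurable_translation:
  fixes m :: "'g::topological_ab_group_add measure"
  assumes "haar m"
  shows "(\<lambda>y. x + y) \<in> measurable m m"
proof -
  note sets = radonD(1)[OF haar_radon[OF assms]]
  show ?thesis
    unfolding measurable_cong_sets[OF sets sets]
    by (intro borel_measurable_continuous_onI continuous_intros)
qed

lemma haar_distr: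
  fixes m :: "'g::topological_ab_group_add measure"
  assumes m: "haar m"
  shows "distr m m (\<lambda>y. x + y) = m"
proof (rule measure_eqI)
  fix A assume "A \<in> sets (distr m m (\<lambda>y. x + y))"
  then have A: "A \<in> sets m" "A \<in> sets borel"
    using radonD(1)[OF haar_radon[OF m]] by auto
  have "emeasure (distr m m (\<lambda>y. x + y)) A = emeasure m ((\<lambda>y. x + y) -` A)"
    using emeasure_distr[OF haar_measurable_translation[OF m] A(1)] radonD(3)[OF haar_radon[OF m]]
    by simp
  then show "emeasure (distr m m (\<lambda>y. x + y)) A = emeasure m A"
    using haar_translation[OF m A(2), of "- x"] translation_eq_vimage[of "- x" A] by simp
qed simp

lemma haar_integral_translation:
  fixes f :: "'g::topological_ab_group_add \<Rightarrow> complex"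
  assumes m: "haar m" and f: "continuous_on UNIV f"
  shows "(\<integral>y. f (x + y) \<partial>m) = (\<integral>y. f y \<partial>m)"
proof -
  have "(\<integral>y. f y \<partial>distr m m (\<lambda>y. x + y)) = (\<integral>y. f (x + y) \<partial>m)"
    by (intro integral_distr haar_measurable_translation radon_borel_measurable haar_radon m f)
  then show ?thesis
    by (simp add: haar_distr[OF m])
qed

lemma dual_groupD:
  assumes "\<gamma> \<in> dual_group"
  shows "continuous_on UNIV \<gamma>" "\<gamma> (x + y) = \<gamma> x * \<gamma> y" "norm (\<gamma> x) = 1" "\<gamma> x * cnj (\<gamma> x) = 1"
  using assms complex_norm_square[of "\<gamma> x"] by (auto simp: dual_group_def)

lemma fourier_character_orthogonal:
  fixes m :: "'g::topological_ab_group_add measure"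
  assumes m: "haar m" and \<gamma>: "\<gamma> \<in> dual_group" and \<gamma>': "\<gamma>' \<in> dual_group" and "\<gamma> \<noteq> \<gamma>'"
  shows "fourier m \<gamma> \<gamma>' = 0"
proof -
  define \<xi> where "\<xi> x = \<gamma> x * cnj (\<gamma>' x)" for x
  obtain x where x: "\<gamma> x \<noteq> \<gamma>' x"
    using \<open>\<gamma> \<noteq> \<gamma>'\<close> by blast
  have "\<gamma> x = \<xi> x * \<gamma>' x"
    using dual_groupD(4)[OF \<gamma>', of x] by (simp add: \<xi>_def mult.assoc mult.commute[of "cnj _"])
  then have "\<xi> x \<noteq> 1"
    using x by auto
  have mult: "\<xi> (x + y) = \<xi> x * \<xi> y" for y
    by (simp add: \<xi>_def dual_groupD(2)[OF \<gamma>] dual_groupD(2)[OF \<gamma>'])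
  have "(\<integral>y. \<xi> y \<partial>m) = (\<integral>y. \<xi> (x + y) \<partial>m)"
    unfolding \<xi>_def
    by (intro haar_integral_translation[OF m, symmetric] continuous_intros dual_groupD(1) \<gamma> \<gamma>')
  also have "\<dots> = \<xi> x * (\<integral>y. \<xi> y \<partial>m)"
    by (simp add: mult)
  finally have "(1 - \<xi> x) * (\<integral>y. \<xi> y \<partial>m) = 0"
    by (simp add: left_diff_distrib)
  then show ?thesis
    using \<open>\<xi> x \<noteq> 1\<close> by (simp add: fourier_def \<xi>_def)
qed

lemma haar_singleton:
  fixes m :: "'g::{topological_ab_group_add, t2_space} measure"
  assumes m: "haar m" and inf: "infinite (UNIV :: 'g set)"
  shows "emeasure m {x} = 0"
proof -
  interpret finite_measure m
    by (rule radonD[OF haar_radon[OF m]])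
  note sets = radonD(1)[OF haar_radon[OF m]]
  have measure_eq: "measure m {y} = measure m {0}" for y
    using haar_translation[OF m, of "{0}" y] by (simp add: measure_def)
  obtain a :: "nat \<Rightarrow> 'g" where "inj a"
    using infinite_countable_subset[OF inf] by blast
  then have "(\<lambda>i. measure m {a i}) sums measure m (\<Union>i. {a i})"
    by (intro finite_measure_UNION) (auto simp: sets disjoint_family_on_def inj_def)
  then have "summable (\<lambda>i :: nat. measure m {0})"
    by (simp add: sums_iff measure_eq[of "a i" for i])
  then show ?thesis
    using measure_eq[of x] by (simp add: summable_const_iff emeasure_eq_measure)
qed

lemma haar_uncountable:
  fixes m :: "'g::{topological_ab_group_add, t2_space} measure"
  assumes m: "haar m" and inf: "infinite (UNIV :: 'g set)"
  shows "uncountable (UNIV :: 'g set)"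
proof
  assume "countable (UNIV :: 'g set)"
  then have "(\<Union>x\<in>UNIV. {x}) \<in> null_sets m"
    using haar_singleton[OF assms] radonD(1)[OF haar_radon[OF m]] by (intro null_sets_UN') auto
  then show False
    using haar_UNIV[OF m] by (simp add: null_sets_def)
qed

lemma finite_translates_cover:
  fixes U :: "'g::topological_ab_group_add set"
  assumes "compact (UNIV :: 'g set)" "open U" "U \<noteq> {}"
  obtains I where "finite I" "(\<Union>x\<in>I. (\<lambda>y. x + y) ` U) = UNIV"
proof -
  obtain u where "u \<in> U"
    using assms(3) by blast
  then have "z \<in> (\<lambda>y. (z - u) + y) ` U" for z
    by (intro image_eqI[of _ _ u]) simp_all
  then have "UNIV \<subseteq> (\<Union>x. (\<lambda>y. x + y) ` U)"
    by blast
  moreover have "open ((\<lambda>y. x + y) ` U)" for x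
    unfolding translation_eq_vimage by (intro open_vimage assms(2) continuous_intros)
  ultimately obtain I where "finite I" "UNIV \<subseteq> (\<Union>x\<in>I. (\<lambda>y. x + y) ` U)"
    using compactE_image[OF assms(1), of UNIV "\<lambda>x. (\<lambda>y. x + y) ` U"] by metis
  then show ?thesis
    using that by blast
qed

lemma haar_open_uncountable:
  fixes m :: "'g::{topological_ab_group_add, t2_space} measure" and U :: "'g set"
  assumes "compact (UNIV :: 'g set)" "infinite (UNIV :: 'g set)" "haar m" "open U" "U \<noteq> {}"
  shows "uncountable U"
proof
  assume "countable U"
  obtain I where "finite I" "(\<Union>x\<in>I. (\<lambda>y. x + y) ` U) = UNIV"
    using finite_translates_cover[OF assms(1,4,5)] .
  then have "countable (UNIV :: 'g set)"
    using \<open>countable U\<close> by (metis countable_UN countable_finite countable_image)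
  then show False
    using haar_uncountable[OF assms(3,2)] by blast
qed

lemma bcont_subspace_C_Lambda:
  fixes m :: "'g::topological_ab_group_add measure"
  assumes compact_UNIV: "compact (UNIV :: 'g set)" and m: "haar m"
  shows "bcont_subspace (C_Lambda m L)"
proof
  have int: "integrable m (\<lambda>x. f x * cnj (\<gamma> x))" if "continuous_on UNIV f" "\<gamma> \<in> dual_group" for f \<gamma>
    using that dual_groupD(1)
    by (intro radon_integrable[OF compact_UNIV haar_radon[OF m]] continuous_intros) auto
  show "(\<lambda>x. f x + g x) \<in> C_Lambda m L" if "f \<in> C_Lambda m L" "g \<in> C_Lambda m L" for f g
    using that by (auto simp: C_Lambda_def fourier_def distrib_right int intro!: continuous_intros)
  show "C_Lambda m L \<subseteq> bcontfun"
    by (auto simp: bcontfun_compact_iff[OF compact_UNIV] C_Lambda_def)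
qed (auto simp: C_Lambda_def fourier_def mult.assoc intro!: continuous_intros)

lemma character_in_C_Lambda:
  assumes "haar m" "L \<subseteq> dual_group" "\<gamma> \<in> L"
  shows "\<gamma> \<in> C_Lambda m L"
  using assms dual_groupD(1)[of \<gamma>] fourier_character_orthogonal[OF assms(1), of \<gamma>]
  by (auto simp: C_Lambda_def)

lemma fs_transform_eq_0_if_annihilates:
  assumes "haar m" "L \<subseteq> dual_group" and "\<And>f. f \<in> C_Lambda m L \<Longrightarrow> cm_int \<mu> f = 0"
    and "\<gamma> \<in> neg_set L"
  shows "fs_transform \<mu> \<gamma> = 0"
  using assms character_in_C_Lambda[OF assms(1,2)] by (auto simp: neg_set_def fs_transform_def)

lemma atomless_annihilator_C_Lambda:
  fixes m :: "'g::{topological_ab_group_add, t2_space} measure"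
  assumes compact_UNIV: "compact (UNIV :: 'g set)" and m: "haar m" and L: "L \<subseteq> dual_group"
    and semi_riesz: "semi_riesz (dual_group - neg_set L)"
  shows "atomless_annihilator (C_Lambda m L)"
proof -
  interpret bcont_subspace "C_Lambda m L"
    by (rule bcont_subspace_C_Lambda[OF compact_UNIV m])
  show ?thesis
  proof
    fix \<Phi> :: "('g \<Rightarrow> complex) \<Rightarrow> complex" and h
    assume \<Phi>: "\<Phi> \<in> dual_sp bcontfun" "\<And>f. f \<in> C_Lambda m L \<Longrightarrow> \<Phi> f = 0"
    obtain \<mu> where \<mu>: "is_cmeasure \<mu>" "\<And>f. continuous_on UNIV f \<Longrightarrow> \<Phi> f = cm_int \<mu> f"
      using cmeasure_representation[OF compact_UNIV \<Phi>(1)] by metis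
    have "cm_int \<mu> f = 0" if "f \<in> C_Lambda m L" for f
      using \<Phi>(2)[OF that] \<mu>(2)[of f] that by (simp add: C_Lambda_def)
    then have "\<mu> \<in> M_spec (dual_group - neg_set L)"
      using \<mu>(1) fs_transform_eq_0_if_annihilates[OF m L] by (auto simp: M_spec_def)
    then have "cm_val \<mu> {h} = 0"
      using semi_riesz by (auto simp: semi_riesz_def M_diff_def)
    then show "has_atom \<Phi> h 0"
      using has_atom_cmeasure[OF compact_UNIV \<mu>, of h] by simp
  qed (rule compact_UNIV)
qed

theorem theorem3p7:
  fixes m :: "'g::{topological_ab_group_add, t2_space} measure"
    and L :: "('g \<Rightarrow> complex) set"
    and T :: "('g \<Rightarrow> complex) \<Rightarrow> ('g \<Rightarrow> complex)"
  assumes "compact (UNIV :: 'g set)" and "infinite (UNIV :: 'g set)"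
    and "haar m"
    and "L \<subseteq> dual_group"
    and "semi_riesz (dual_group - neg_set L)"
    and "bdd_clin (C_Lambda m L) supn (C_Lambda m L) supn T"
    and "weakly_compact_op (C_Lambda m L) T \<or> factors_c0 (C_Lambda m L) T \<or>
         (\<forall>h. continuous_on UNIV (\<lambda>g. pi_fun (C_Lambda m L) h (adj_pt (C_Lambda m L) T g)))"
  shows "opnorm_on (C_Lambda m L) (\<lambda>f x. f x + T f x) = 1 + opnorm_on (C_Lambda m L) T"
proof -
  interpret atomless_annihilator "C_Lambda m L"
    by (rule atomless_annihilator_C_Lambda[OF assms(1,3-5)])
  interpret atomless_annihilator_operator "C_Lambda m L" T
    by unfold_locales (rule assms(6))
  note uncountable_open = haar_open_uncountable[OF assms(1-3)]
  show ?thesis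
  proof (cases "factors_c0 (C_Lambda m L) T")
    case True
    then obtain D where D: "countable D" "\<And>s t. t \<notin> D \<Longrightarrow> pmass t (adj_pt (C_Lambda m L) T s) = 0"
      using factors_c0_countable_atoms by metis
    have "\<exists>s\<in>U. s \<notin> D" if "open U" "U \<noteq> {}" for U :: "'g set"
      using uncountable_open[OF that] D(1) countable_subset[of U D] by blast
    then show ?thesis
      using D(2) by (intro daugavet_if_small_atoms) fastforce
  next
    case False
    then have "continuous_on UNIV (\<lambda>s. pmass t (adj_pt (C_Lambda m L) T s))" for t
      using assms(7) weakly_compact_continuous_atoms pi_fun_eq_pmass[OF dual_sp_adj_pt] by auto
    then show ?thesis
      by (intro daugavet_if_small_atoms small_atoms_if_continuous uncountable_infinite uncountable_open)
  qed
qed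

end
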